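(* Let $n\geq 3$, $\alpha\in(0,n)$, $\sigma_1,\sigma_2\in[0,\alpha)$, and suppose $q\geq p>1$ and $\sigma_1\geq\sigma_2$. Let $u,v$ be positive solutions of $$u(x)=\int_{\mathbb{R}^n}\frac{v(y)^q}{|x-y|^{n-\alpha}|y|^{\sigma_1}}\,dy,\qquad v(x)=\int_{\mathbb{R}^n}\frac{u(y)^p}{|x-y|^{n-\alpha}|y|^{\sigma_2}}\,dy,\qquad x\in\mathbb{R}^n,$$ and assume the non-subcritical condition $$\frac{n-\sigma_1}{1+q}+\frac{n-\sigma_2}{1+p}\leq n-\alpha.$$ (i) Then $u,v$ are integrable solutions if and only if $u,v$ are bounded and, as $|x|\to\infty$, $u(x)\simeq|x|^{-(n-\alpha)}$ and $$v(x)\simeq\begin{cases}|x|^{-(n-\alpha)}, & \text{if } p(n-\alpha)+\sigma_2>n,\\ |x|^{-(n-\alpha)}\ln|x|, & \text{if } p(n-\alpha)+\sigma_2=n,\\ |x|^{-(p(n-\alpha)-(\alpha-\sigma_2))}, & \text{if } p(n-\alpha)+\sigma_2<n.\end{cases}$$ (ii) Suppose in addition $\alpha\in(1,n)$. If $u,v$ are integrable solutions, then necessarily $$\frac{n-\sigma_1}{1+q}+\frac{n-\sigma_2}{1+p}=n-\alpha.$$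
   Context: Define $$p_0=\frac{\alpha(1+p)-(\sigma_2+\sigma_1p)}{pq-1},\qquad q_0=\frac{\alpha(1+q)-(\sigma_1+\sigma_2q)}{pq-1},\qquad r_0=\frac{n}{q_0},\qquad s_0=\frac{n}{p_0}.$$ A positive solution $u,v$ is integrable if $u\in L^{r_0}(\mathbb{R}^n)$ and $v\in L^{s_0}(\mathbb{R}^n)$. The notation $f(x)\simeq g(x)$ means there exist constants $c,C>0$ with $cg(x)\leq f(x)\leq Cg(x)$ as $|x|\to\infty$. *)

theory Defs
  imports "HOL-Analysis.Analysis"
begin

definition exp_p0 :: "real \<Rightarrow> real \<Rightarrow> real \<Rightarrow> real \<Rightarrow> real \<Rightarrow> real" where
  "exp_p0 \<alpha> \<sigma>1 \<sigma>2 p q = (\<alpha> * (1 + p) - (\<sigma>2 + \<sigma>1 * p)) / (p * q - 1)"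

definition exp_q0 :: "real \<Rightarrow> real \<Rightarrow> real \<Rightarrow> real \<Rightarrow> real \<Rightarrow> real" where
  "exp_q0 \<alpha> \<sigma>1 \<sigma>2 p q = (\<alpha> * (1 + q) - (\<sigma>1 + \<sigma>2 * q)) / (p * q - 1)"

definition in_Lp :: "('a::euclidean_space \<Rightarrow> real) \<Rightarrow> real \<Rightarrow> bool" where
  "in_Lp f r \<longleftrightarrow> f \<in> borel_measurable lborel \<and>
     (\<integral>\<^sup>+ x. ennreal (\<bar>f x\<bar> powr r) \<partial>lborel) < \<infinity>"

definition integrable_sol ::
  "('a::euclidean_space \<Rightarrow> real) \<Rightarrow> ('a \<Rightarrow> real) \<Rightarrow> real \<Rightarrow> real \<Rightarrow> real \<Rightarrow> real \<Rightarrow> real \<Rightarrow> bool" where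
  "integrable_sol u v \<alpha> \<sigma>1 \<sigma>2 p q \<longleftrightarrow>
     in_Lp u (real DIM('a) / exp_q0 \<alpha> \<sigma>1 \<sigma>2 p q) \<and>
     in_Lp v (real DIM('a) / exp_p0 \<alpha> \<sigma>1 \<sigma>2 p q)"

definition asymp_sim :: "('a::real_normed_vector \<Rightarrow> real) \<Rightarrow> ('a \<Rightarrow> real) \<Rightarrow> bool" where
  "asymp_sim f g \<longleftrightarrow> (\<exists>c C R. c > 0 \<and> C > 0 \<and>
      (\<forall>x. norm x \<ge> R \<longrightarrow> c * g x \<le> f x \<and> f x \<le> C * g x))"

end

theory Submission
  imports Defs
begin

text \<open>
  Write \<open>l = n - \<alpha>\<close>. Only elementary estimates of the potential of kernel \<open>|x - y|\<^sup>-\<^sup>l\<close> are needed.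

  Local boundedness: in terms of decreasing rearrangements, the large values of \<open>u\<close> and \<open>v\<close> satisfy a
  linear system with small coefficients, because the critical Lebesgue norms of the truncations \<open>u 1\<^bsub>{u > A}\<^esub>\<close>
  and \<open>v 1\<^bsub>{v > A}\<^esub>\<close> tend to zero. Comparison with the barrier \<open>r\<^sup>-\<^sup>g + c r\<^sup>-\<^sup>b\<close>, where \<open>g < b\<close> and \<open>b\<close> is the
  critical exponent, is finite a priori for every \<open>c > 0\<close> and contracts to a bound independent of \<open>c\<close>; letting
  \<open>c\<close> tend to zero improves the integrability. The only analytic input is the weak-type estimate of the potential.

  Decay: once \<open>u\<close> and \<open>v\<close> are bounded, splitting the potential into a small ball and its complement shows that
  \<open>u\<close> and \<open>v\<close> are of smaller order than the critical powers at infinity, and the same barrier argument, now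
  pointwise with \<open>g > b\<close>, gives decay up to the fast rate.

  The exponents \<open>a\<close> and \<open>b\<close> below are the \<open>q\<^sub>0\<close> and \<open>p\<^sub>0\<close> of the statement, and the non-subcritical
  condition is \<open>a + b \<le> l\<close>.
\<close>

section \<open>Power kernels\<close>

text \<open>The exponents \<open>a\<close> and \<open>b\<close> are those of the scaling t^a u(tx),
  t^b v(tx) that leaves the system invariant, so an estimate at the critical powers alone yields no
  gain. The gain comes from writing \<open>v powr q\<close> as \<open>v powr (q - 1)\<close> times
  \<open>v\<close> and bounding the first factor by a small multiple of the critical power, only the
  second by the barrier. One pass through an equation then moves a barrier exponent g of v to g + a
  - b for u, and the other equation moves it back. Hence all g in (0, b) are available only if b <=
  a (both exponents must stay positive), and g above b is limited by g + a - b < l, the rate of the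
  kernel. That window contains some g with q g + s1 > n, because (q - 1)(l - a) > 0. From there the
  source of u has finite mass and u decays exactly like the kernel; the three regimes of v record
  whether the mass of its own source in B(0, r) stays bounded, grows like ln r or grows like a
  power. In (ii), \<open>1 < \<alpha>\<close> is the local integrability of the gradient kernel |x -
  y|^-(l + 1).\<close>

definition riesz :: "real \<Rightarrow> ('a::euclidean_space \<Rightarrow> real) \<Rightarrow> 'a \<Rightarrow> ennreal" where
  "riesz l f x = (\<integral>\<^sup>+ y. ennreal (f y * norm (x - y) powr - l) \<partial>lborel)"

text \<open>The condition \<open>superlevel_le w (\<psi> r) r\<close> for all \<open>r > 0\<close> says that the decreasing rearrangement of \<open>w\<close> at volume \<open>r\<^sup>n\<close>
  is at most \<open>\<psi> r\<close>; indexing by a radius keeps all exponents in the scale of powers of \<open>|x|\<close>.\<close>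

abbreviation superlevel_le :: "('a::euclidean_space \<Rightarrow> 'b::linorder) \<Rightarrow> 'b \<Rightarrow> real \<Rightarrow> bool" where
  "superlevel_le w T r \<equiv> emeasure lborel {x. T < w x} \<le> ennreal (r ^ DIM('a))"

abbreviation trunc :: "real \<Rightarrow> ('a \<Rightarrow> real) \<Rightarrow> 'a \<Rightarrow> real" where
  "trunc A w \<equiv> \<lambda>x. w x * indicator {x. A < w x} x"

section \<open>Dyadic scales, geometric summation and the halving iteration\<close>

lemma ball_in_sets_borel [measurable]: "ball (x :: 'a::euclidean_space) r \<in> sets borel"
  by simp

text \<open>A discrete intermediate-value principle: it selects the dyadic shell or level to which a
  point belongs, without any monotonicity of \<open>P\<close>.\<close>

lemma nat_switch:
  assumes "P 0" "\<not> P k"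
  shows "\<exists>k::nat. P k \<and> \<not> P (Suc k)"
proof (rule ccontr)
  assume "\<not> ?thesis"
  then have "P k" for k by (induction k) (use assms in auto)
  with assms show False by blast
qed

lemma dyadic_below:
  fixes d r :: real
  assumes "0 < d" "d < r"
  shows "\<exists>k. d < r / 2 ^ k \<and> r / 2 ^ Suc k \<le> d"
proof -
  obtain k where "r / d < 2 ^ k"
    using real_arch_pow[of 2 "r / d"] by auto
  then have "\<not> d < r / 2 ^ k"
    using assms by (simp add: field_simps)
  from nat_switch[of "\<lambda>k. d < r / 2 ^ k", OF _ this] assms show ?thesis
    by (auto simp: not_less)
qed

lemma dyadic_above:
  fixes d r :: real
  assumes "0 < r" "r \<le> d"
  shows "\<exists>k. r * 2 ^ k \<le> d \<and> d < r * 2 ^ Suc k"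
proof -
  obtain k where "d / r < 2 ^ k"
    using real_arch_pow[of 2 "d / r"] by auto
  then have "\<not> r * 2 ^ k \<le> d"
    using assms by (simp add: field_simps)
  from nat_switch[of "\<lambda>k. r * 2 ^ k \<le> d", OF _ this] assms show ?thesis
    by (auto simp: not_le)
qed

lemma ennreal_mult_indicator_mono:
  "a \<le> b \<Longrightarrow> (x \<in> A \<Longrightarrow> x \<in> B) \<Longrightarrow> ennreal a * indicator A x \<le> ennreal b * indicator B x"
  by (auto simp: indicator_def intro: ennreal_leI)

lemma suminf_geometric_ennreal:
  assumes "0 \<le> A" "0 \<le> c" "c < 1"
  shows "(\<Sum>k. ennreal (A * c ^ k)) = ennreal (A / (1 - c))"
proof (rule suminf_ennreal_eq)
  show "(\<lambda>k. A * c ^ k) sums (A / (1 - c))"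
    using sums_mult[OF geometric_sums[of c], of A] assms by simp
qed (use assms in auto)

text \<open>Each point need only be covered by one of the \<open>h k\<close>, since all terms are
  nonnegative and a single term is below the sum. This is the common form of the decompositions into
  dyadic shells or dyadic levels; the alternative \<open>g y = 0\<close> takes care of points that
  no shell contains.\<close>

lemma nn_integral_le_geometric:
  fixes g :: "'a \<Rightarrow> ennreal"
  assumes [measurable]: "\<And>k. h k \<in> borel_measurable M"
    and g: "\<And>y. g y = 0 \<or> (\<exists>k. g y \<le> h k y)"
    and h: "\<And>k. (\<integral>\<^sup>+ y. h k y \<partial>M) \<le> ennreal (A * c ^ k)" and c: "0 \<le> A" "0 \<le> c" "c < 1"
  shows "(\<integral>\<^sup>+ y. g y \<partial>M) \<le> ennreal (A / (1 - c))"
proof -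
  have "g y \<le> (\<Sum>k. h k y)" for y
  proof -
    have "h k y \<le> (\<Sum>k. h k y)" for k using sum_le_suminf[of "\<lambda>k. h k y" "{k}"] by simp
    then show ?thesis using g[of y] order_trans by fastforce
  qed
  then have "(\<integral>\<^sup>+ y. g y \<partial>M) \<le> (\<integral>\<^sup>+ y. (\<Sum>k. h k y) \<partial>M)" by (intro nn_integral_mono)
  also have "\<dots> = (\<Sum>k. \<integral>\<^sup>+ y. h k y \<partial>M)" by (intro nn_integral_suminf) measurable
  also have "\<dots> \<le> (\<Sum>k. ennreal (A * c ^ k))" by (intro suminf_le h) auto
  also have "\<dots> = ennreal (A / (1 - c))" using c by (intro suminf_geometric_ennreal)
  finally show ?thesis .
qed

lemma two_pow_powr: "((2::real) ^ k) powr a = (2 powr a) ^ k"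
  by (simp add: powr_realpow[symmetric] powr_powr mult.commute)

lemma nn_integral_lincomb:
  fixes c d :: ennreal
  assumes [measurable]: "f \<in> borel_measurable M" "g \<in> borel_measurable M"
  shows "(\<integral>\<^sup>+ x. c * f x + d * g x \<partial>M) = c * (\<integral>\<^sup>+ x. f x \<partial>M) + d * (\<integral>\<^sup>+ x. g x \<partial>M)"
  by (simp add: nn_integral_add nn_integral_cmult)

text \<open>Both passes of the coupled iteration must contract by 1/2 with the same smallness
  \<open>e\<close>; the exponents \<open>q - 1\<close> and \<open>p - 1\<close> are positive, so a
  small \<open>e\<close> serves.\<close>

lemma ex_small_powr_coeff:
  fixes C1 C2 p q :: real
  assumes C1: "0 < C1" and C2: "0 < C2" and p: "1 < p" and q: "1 < q"
  shows "\<exists>e>0. C1 * e powr (q - 1) \<le> 1 / 2 \<and> C2 * e powr (p - 1) \<le> 1 / 2"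
proof -
  define e where "e = min ((1 / (2 * C1)) powr (1 / (q - 1))) ((1 / (2 * C2)) powr (1 / (p - 1)))"
  have e: "0 < e" using C1 C2 by (simp add: e_def)
  have le: "C * e powr z \<le> 1 / 2" if "0 < C" "0 < z" "e \<le> (1 / (2 * C)) powr (1 / z)" for C z
  proof -
    have "e powr z \<le> ((1 / (2 * C)) powr (1 / z)) powr z"
      using that e by (intro powr_mono2) auto
    also have "\<dots> = 1 / (2 * C)" using that by (simp add: powr_powr)
    finally show ?thesis using that by (simp add: field_simps)
  qed
  show ?thesis
    using C1 C2 p q by (intro exI[of _ e] conjI e le) (auto simp: e_def)
qed

text \<open>The map S -> S/2 + K has fixed point 2K, and the excess over it halves at each step. The
  initial bound \<open>T\<close> affects only the number of steps, which makes the final bound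
  uniform in the parameter c of the barrier.\<close>

lemma halving_iteration:
  fixes K T :: real
  assumes K: "0 < K" and T: "0 < T" and base: "P T"
    and mono: "\<And>S S'. P S \<Longrightarrow> S \<le> S' \<Longrightarrow> P S'" and step: "\<And>S. P S \<Longrightarrow> 0 < S \<Longrightarrow> P (S / 2 + K)"
  shows "P (3 * K)"
proof -
  have iter: "P (2 * K + T / 2 ^ k)" for k
  proof (induction k)
    case 0
    show ?case using K by (intro mono[OF base]) simp
  next
    case (Suc k)
    have "P ((2 * K + T / 2 ^ k) / 2 + K)"
      using Suc T K by (intro step) (auto intro!: add_pos_pos)
    then show ?case by (rule mono) (simp add: field_simps)
  qed
  obtain k where "T / K < 2 ^ k" using real_arch_pow[of 2 "T / K"] by auto
  then have "T / 2 ^ k \<le> K" using K T by (simp add: field_simps)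
  then show ?thesis by (intro mono[OF iter[of k]]) simp
qed

section \<open>Integrals of power kernels over balls, exteriors and sets of given volume\<close>

lemma nn_integral_norm_powr_ball:
  assumes "0 \<le> h" "h < real DIM('a::euclidean_space)"
  shows "\<exists>C>0. \<forall>r>0. \<forall>x::'a. (\<integral>\<^sup>+ y. ennreal (norm (x - y) powr - h) * indicator (ball x r) y \<partial>lborel)
            \<le> ennreal (C * r powr (real DIM('a) - h))"
proof -
  define n where "n = real DIM('a)"
  define w where "w = unit_ball_vol n"
  have w: "w > 0" unfolding w_def n_def by simp
  \<comment> \<open>Passing to the next smaller shell multiplies the volume by 2^-n and the kernel
    by 2^h; \<open>c\<close> is this ratio, below 1 because h < n.\<close>
  define c where "c = 2 powr (h - n)"
  have c: "0 \<le> c" "c < 1"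
    using assms unfolding c_def n_def by (auto simp: powr_less_one)
  show ?thesis
  proof (intro exI[of _ "w * 2 powr h / (1 - c)"] conjI allI impI)
    show "w * 2 powr h / (1 - c) > 0" using w c by auto
    fix r :: real and x :: 'a
    assume r: "r > 0"
    have "(\<integral>\<^sup>+ y. ennreal (norm (x - y) powr - h) * indicator (ball x r) y \<partial>lborel)
      \<le> ennreal ((w * 2 powr h * r powr (n - h)) / (1 - c))"
    proof (rule nn_integral_le_geometric)
      show "(\<lambda>y. ennreal ((r / 2 ^ Suc k) powr - h) * indicator (ball x (r / 2 ^ k)) y) \<in> borel_measurable lborel" for k
        by measurable
      fix y
      show "ennreal (norm (x - y) powr - h) * indicator (ball x r) y = 0 \<or>
        (\<exists>k. ennreal (norm (x - y) powr - h) * indicator (ball x r) y \<le> ennreal ((r / 2 ^ Suc k) powr - h) * indicator (ball x (r / 2 ^ k)) y)"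
      \<comment> \<open>At \<open>y = x\<close> the integrand is 0, because
        \<open>0 powr - h = 0\<close>.\<close>
      proof (cases "y \<in> ball x r \<and> y \<noteq> x")
        case True
        then have "0 < dist x y" "dist x y < r" by auto
        from dyadic_below[OF this] obtain k where k: "dist x y < r / 2 ^ k" "r / 2 ^ Suc k \<le> dist x y"
          by blast
        have "norm (x - y) powr - h \<le> (r / 2 ^ Suc k) powr - h"
          using k r assms by (intro powr_mono2') (auto simp: dist_norm)
        then show ?thesis
          using k by (intro disjI2 exI[of _ k] ennreal_mult_indicator_mono) auto
      qed auto
    next
      fix k
      have "(\<integral>\<^sup>+ y. ennreal ((r / 2 ^ Suc k) powr - h) * indicator (ball x (r / 2 ^ k)) y \<partial>lborel)
         = ennreal ((r / 2 ^ Suc k) powr - h) * ennreal (w * (r / 2 ^ k) ^ DIM('a))"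
        using r by (simp add: nn_integral_cmult_indicator emeasure_ball w_def n_def)
      also have "\<dots> = ennreal ((r / 2 ^ Suc k) powr - h * (w * (r / 2 ^ k) powr n))"
        using w r by (subst ennreal_mult[symmetric]) (auto simp: n_def powr_realpow)
      also have "(r / 2 ^ Suc k) powr - h * (w * (r / 2 ^ k) powr n) = (w * 2 powr h * r powr (n - h)) * c ^ k"
      proof -
        have "(r / 2 ^ Suc k) powr - h = r powr - h * 2 powr h * (2 powr h) ^ k"
          using r by (simp add: powr_divide powr_minus divide_simps powr_mult two_pow_powr)
        moreover have "(r / 2 ^ k) powr n = r powr n * (2 powr - n) ^ k"
          using r by (simp add: powr_divide powr_minus divide_simps two_pow_powr power_one_over)
        moreover have "c ^ k = (2 powr h) ^ k * (2 powr - n) ^ k"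
          unfolding c_def power_mult_distrib[symmetric] powr_add[symmetric] by simp
        moreover have "r powr (n - h) = r powr n * r powr - h"
          unfolding powr_add[symmetric] by simp
        ultimately show ?thesis by simp
      qed
      finally show "(\<integral>\<^sup>+ y. ennreal ((r / 2 ^ Suc k) powr - h) * indicator (ball x (r / 2 ^ k)) y \<partial>lborel)
         \<le> ennreal ((w * 2 powr h * r powr (n - h)) * c ^ k)" by simp
    qed (use w c in auto)
    then show "(\<integral>\<^sup>+ y. ennreal (norm (x - y) powr - h) * indicator (ball x r) y \<partial>lborel)
            \<le> ennreal (w * 2 powr h / (1 - c) * r powr (real DIM('a) - h))"
      by (simp add: n_def)
  qed
qed

lemma nn_integral_norm_powr_compl_ball:
  assumes "h > real DIM('a::euclidean_space)"
  shows "\<exists>C>0. \<forall>r>0. (\<integral>\<^sup>+ (y::'a). ennreal (norm y powr - h) * indicator (- ball 0 r) y \<partial>lborel)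
            \<le> ennreal (C * r powr (real DIM('a) - h))"
proof -
  define n where "n = real DIM('a)"
  define w where "w = unit_ball_vol n"
  have w: "w > 0" unfolding w_def n_def by simp
  \<comment> \<open>The ratio of consecutive outer shells: the volume grows by 2^n and the kernel
    shrinks by 2^h, so that now h > n gives convergence.\<close>
  define c where "c = 2 powr (n - h)"
  have c: "0 \<le> c" "c < 1"
    using assms unfolding c_def n_def by (auto simp: powr_less_one)
  show ?thesis
  proof (intro exI[of _ "w * 2 powr n / (1 - c)"] conjI allI impI)
    show "w * 2 powr n / (1 - c) > 0" using w c by auto
    fix r :: real
    assume r: "r > 0"
    have "(\<integral>\<^sup>+ (y::'a). ennreal (norm y powr - h) * indicator (- ball 0 r) y \<partial>lborel)
      \<le> ennreal ((w * 2 powr n * r powr (n - h)) / (1 - c))"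
    proof (rule nn_integral_le_geometric)
      show "(\<lambda>y::'a. ennreal ((r * 2 ^ k) powr - h) * indicator (ball 0 (r * 2 ^ Suc k)) y) \<in> borel_measurable lborel" for k
        by measurable
      fix y :: 'a
      show "ennreal (norm y powr - h) * indicator (- ball 0 r) y = 0 \<or>
        (\<exists>k. ennreal (norm y powr - h) * indicator (- ball 0 r) y \<le> ennreal ((r * 2 ^ k) powr - h) * indicator (ball 0 (r * 2 ^ Suc k)) y)"
      proof (cases "y \<in> - ball 0 r")
        case True
        then have "r \<le> norm y" by auto
        from dyadic_above[OF r this] obtain k where k: "r * 2 ^ k \<le> norm y" "norm y < r * 2 ^ Suc k"
          by blast
        have "norm y powr - h \<le> (r * 2 ^ k) powr - h"
          using k r assms by (intro powr_mono2') auto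
        then show ?thesis
          using k by (intro disjI2 exI[of _ k] ennreal_mult_indicator_mono) auto
      qed auto
    next
      fix k
      have "(\<integral>\<^sup>+ (y::'a). ennreal ((r * 2 ^ k) powr - h) * indicator (ball 0 (r * 2 ^ Suc k)) y \<partial>lborel)
         = ennreal ((r * 2 ^ k) powr - h) * ennreal (w * (r * 2 ^ Suc k) ^ DIM('a))"
        using r by (simp add: nn_integral_cmult_indicator emeasure_ball w_def n_def)
      also have "\<dots> = ennreal ((r * 2 ^ k) powr - h * (w * (r * 2 ^ Suc k) powr n))"
        using w r by (subst ennreal_mult[symmetric]) (auto simp: n_def powr_realpow)
      also have "(r * 2 ^ k) powr - h * (w * (r * 2 ^ Suc k) powr n) = (w * 2 powr n * r powr (n - h)) * c ^ k"
      proof -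
        have "(r * 2 ^ k) powr - h = r powr - h * (2 powr - h) ^ k"
          using r by (simp add: powr_mult two_pow_powr)
        moreover have "(r * 2 ^ Suc k) powr n = r powr n * 2 powr n * (2 powr n) ^ k"
          using r by (simp add: powr_mult two_pow_powr)
        moreover have "c ^ k = (2 powr n) ^ k * (2 powr - h) ^ k"
          unfolding c_def power_mult_distrib[symmetric] powr_add[symmetric] by simp
        moreover have "r powr (n - h) = r powr n * r powr - h"
          unfolding powr_add[symmetric] by simp
        ultimately show ?thesis by simp
      qed
      finally show "(\<integral>\<^sup>+ (y::'a). ennreal ((r * 2 ^ k) powr - h) * indicator (ball 0 (r * 2 ^ Suc k)) y \<partial>lborel)
         \<le> ennreal ((w * 2 powr n * r powr (n - h)) * c ^ k)" by simp
    qed (use w c in auto)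
    then show "(\<integral>\<^sup>+ (y::'a). ennreal (norm y powr - h) * indicator (- ball 0 r) y \<partial>lborel)
            \<le> ennreal (w * 2 powr n / (1 - c) * r powr (real DIM('a) - h))"
      by (simp add: n_def)
  qed
qed

text \<open>Among sets of given volume a ball around \<open>x\<close> is essentially the worst:
  outside \<open>ball x r\<close> the kernel is at most \<open>r powr - h\<close>, and the part of
  \<open>E\<close> lying there has measure at most r^n. The bound sees \<open>E\<close> only through
  its volume, which is all that rearrangement arguments know.\<close>

lemma nn_integral_norm_powr_set:
  assumes "0 \<le> h" "h < real DIM('a::euclidean_space)"
  shows "\<exists>C>0. \<forall>r>0. \<forall>x::'a. \<forall>E\<in>sets borel. emeasure lborel E \<le> ennreal (r ^ DIM('a)) \<longrightarrow>
     (\<integral>\<^sup>+ y. ennreal (norm (x - y) powr - h) * indicator E y \<partial>lborel)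
            \<le> ennreal (C * r powr (real DIM('a) - h))"
proof -
  obtain C where C: "C > 0" "\<And>r x::'a. r > 0 \<Longrightarrow> 
     (\<integral>\<^sup>+ y. ennreal (norm (x - y) powr - h) * indicator (ball x r) y \<partial>lborel)
            \<le> ennreal (C * r powr (real DIM('a) - h))"
    using nn_integral_norm_powr_ball[OF assms] by blast
  show ?thesis
  proof (intro exI[of _ "C + 1"] conjI allI ballI impI)
    fix r :: real and x :: 'a and E :: "'a set"
    assume r: "r > 0" and E [measurable]: "E \<in> sets borel" and EE: "emeasure lborel E \<le> ennreal (r ^ DIM('a))"
    have "(\<integral>\<^sup>+ y. ennreal (norm (x - y) powr - h) * indicator E y \<partial>lborel)
       \<le> (\<integral>\<^sup>+ y. ennreal (norm (x - y) powr - h) * indicator (ball x r) y 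
               + ennreal (r powr - h) * indicator E y \<partial>lborel)"
    proof (intro nn_integral_mono)
      fix y
      show "ennreal (norm (x - y) powr - h) * indicator E y
        \<le> ennreal (norm (x - y) powr - h) * indicator (ball x r) y + ennreal (r powr - h) * indicator E y"
      proof (cases "y \<in> ball x r")
        case True
        then show ?thesis by (auto simp: indicator_def)
      next
        case False
        then have "norm (x - y) powr - h \<le> r powr - h"
          using r assms by (intro powr_mono2') (auto simp: dist_norm)
        then show ?thesis by (auto simp: indicator_def intro: ennreal_leI)
      qed
    qed
    also have "\<dots> = (\<integral>\<^sup>+ y. ennreal (norm (x - y) powr - h) * indicator (ball x r) y \<partial>lborel)
        + ennreal (r powr - h) * emeasure lborel E"
      by (simp add: nn_integral_add nn_integral_cmult_indicator)
    also have "\<dots> \<le> ennreal (C * r powr (real DIM('a) - h)) + ennreal (r powr - h) * ennreal (r ^ DIM('a))"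
      using r by (intro add_mono C mult_left_mono EE) auto
    also have "\<dots> = ennreal (C * r powr (real DIM('a) - h) + r powr - h * r ^ DIM('a))"
      using r C by (simp add: ennreal_mult[symmetric] ennreal_plus[symmetric] del: ennreal_plus)
    also have "r powr - h * r ^ DIM('a) = r powr (real DIM('a) - h)"
      using r by (simp add: powr_realpow[symmetric] powr_add[symmetric])
    finally show "(\<integral>\<^sup>+ y. ennreal (norm (x - y) powr - h) * indicator E y \<partial>lborel)
            \<le> ennreal ((C + 1) * r powr (real DIM('a) - h))"
      by (simp add: algebra_simps)
  qed (use C in auto)
qed

text \<open>Three regions: near the origin, near \<open>x\<close>, and the rest. In the rest |x - y|
  >= |x|/2, hence |y| <= |x| + |x - y| <= 3 |x - y|, which is the origin of the constant 3.\<close>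

lemma riesz_kernel_split:
  fixes x y :: "'a::euclidean_space"
  assumes "0 < l" "x \<noteq> 0"
  shows "norm (x - y) powr - l \<le> (norm x / 2) powr - l * indicator (ball 0 (norm x / 2)) y
      + norm (x - y) powr - l * indicator (ball x (norm x / 2)) y
      + 3 powr l * norm y powr - l * indicator (- ball 0 (norm x / 2)) y"
proof -
  show ?thesis
  proof (cases "norm (x - y) < norm x / 2")
    case True
    then show ?thesis by (simp add: indicator_def dist_norm)
  next
    case False
    then have f: "norm x / 2 \<le> norm (x - y)" by simp
    show ?thesis
    proof (cases "norm y < norm x / 2")
      case True
      have "norm (x - y) powr - l \<le> (norm x / 2) powr - l"
        using f assms by (intro powr_mono2') auto
      then show ?thesis using True by (simp add: indicator_def add_increasing2)
    next
      case F2: False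
      have "norm y \<le> 3 * norm (x - y)" 
        using f norm_triangle_ineq[of x "y - x"] by (simp add: norm_minus_commute)
      moreover have "0 < norm y" using F2 assms by auto
      ultimately have "norm (x - y) powr - l \<le> (norm y / 3) powr - l"
        using assms by (intro powr_mono2') auto
      also have "\<dots> = 3 powr l * norm y powr - l"
        by (simp add: powr_divide powr_minus divide_simps)
      finally show ?thesis using F2 by (simp add: indicator_def add_increasing)
    qed
  qed
qed

lemma half_powr: "0 \<le> a \<Longrightarrow> (a / 2) powr e = 2 powr - e * a powr e" for a e :: real
  by (simp add: powr_divide powr_minus field_simps)

lemma divide_two_pow_powr: "0 \<le> a \<Longrightarrow> (a / 2 ^ k) powr e = a powr e * (2 powr - e) ^ k" for a e :: real
  by (simp add: powr_divide powr_minus two_pow_powr power_inverse field_simps)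

text \<open>The inner region enters only through the mass of \<open>f\<close> in
  \<open>ball 0 (norm x / 2)\<close>, seen from a distance of at least |x|/2, and no pointwise bound
  on \<open>f\<close> is assumed there. The other two regions of \<open>riesz_kernel_split\<close>
  are governed by the power bound and scale to |x|^(n - l - h); h > n - l is convergence at
  infinity.\<close>

lemma riesz_upper:
  assumes l: "0 < l" "l < real DIM('a::euclidean_space)" and h: "real DIM('a) - l < h"
  shows "\<exists>C>0. \<forall>f (x::'a) F. f \<in> borel_measurable borel \<longrightarrow> (\<forall>y. 0 \<le> f y) \<longrightarrow> x \<noteq> 0 \<longrightarrow> 0 \<le> F \<longrightarrow>
     (\<forall>y. norm x / 2 \<le> norm y \<longrightarrow> f y \<le> F * norm y powr - h) \<longrightarrow>
     riesz l f x \<le> ennreal (C * norm x powr - l) * (\<integral>\<^sup>+ y. ennreal (f y) * indicator (ball 0 (norm x / 2)) y \<partial>lborel)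
        + ennreal (C * F * norm x powr (real DIM('a) - l - h))"
proof -
  define n where "n = real DIM('a)"
  obtain C1 where C1: "C1 > 0" "\<And>r x::'a. r > 0 \<Longrightarrow> 
     (\<integral>\<^sup>+ y. ennreal (norm (x - y) powr - l) * indicator (ball x r) y \<partial>lborel)
            \<le> ennreal (C1 * r powr (n - l))"
    using nn_integral_norm_powr_ball[OF less_imp_le[OF l(1)] l(2)] unfolding n_def by blast
  have "real DIM('a) < l + h" using h by simp
  from nn_integral_norm_powr_compl_ball[OF this]
  obtain C2 where C2: "C2 > 0" "\<And>r. r > 0 \<Longrightarrow> 
     (\<integral>\<^sup>+ (y::'a). ennreal (norm y powr - (l + h)) * indicator (- ball 0 r) y \<partial>lborel)
            \<le> ennreal (C2 * r powr (n - (l + h)))"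
    unfolding n_def by blast
  define C where "C = 2 powr l + 2 powr h * C1 + 3 powr l * C2 * 2 powr (l + h)"
  have h0: "h > 0" using h l by simp
  have Cge: "2 powr l \<le> C" "2 powr h * C1 + 3 powr l * C2 * 2 powr (l + h) \<le> C"
    unfolding C_def using C1 C2 by auto
  show ?thesis
  proof (intro exI[of _ C] conjI allI impI)
    show "C > 0" unfolding C_def using C1 C2 by (intro add_pos_pos) auto
    fix f :: "'a \<Rightarrow> real" and x :: 'a and F :: real
    assume [measurable]: "f \<in> borel_measurable borel" and f0: "\<forall>y. 0 \<le> f y" and x: "x \<noteq> 0"
      and F: "0 \<le> F" "\<forall>y. norm x / 2 \<le> norm y \<longrightarrow> f y \<le> F * norm y powr - h"
    define \<rho> where "\<rho> = norm x / 2"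
    have \<rho>: "\<rho> > 0" using x by (simp add: \<rho>_def)
    have "riesz l f x \<le> (\<integral>\<^sup>+ y. ennreal (\<rho> powr - l) * (ennreal (f y) * indicator (ball 0 \<rho>) y)
       + ennreal (F * \<rho> powr - h) * (ennreal (norm (x - y) powr - l) * indicator (ball x \<rho>) y)
       + ennreal (F * 3 powr l) * (ennreal (norm y powr - (l + h)) * indicator (- ball 0 \<rho>) y) \<partial>lborel)"
      unfolding riesz_def
    proof (intro nn_integral_mono)
      fix y
      have 1: "f y * (norm (x - y) powr - l * indicator (ball x \<rho>) y)
         \<le> F * \<rho> powr - h * (norm (x - y) powr - l * indicator (ball x \<rho>) y)"
      proof (cases "y \<in> ball x \<rho>")
        case True
        then have "norm (x - y) < norm x / 2" by (simp add: dist_norm \<rho>_def)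
        then have y: "\<rho> \<le> norm y" using norm_triangle_ineq[of "x - y" y] by (simp add: \<rho>_def)
        then have "f y \<le> F * norm y powr - h" using F by (simp add: \<rho>_def)
        also have "\<dots> \<le> F * \<rho> powr - h"
          using y \<rho> h0 F by (intro mult_left_mono powr_mono2') auto
        finally show ?thesis using True by (simp add: mult_right_mono)
      qed auto
      have 2: "f y * (3 powr l * norm y powr - l * indicator (- ball 0 \<rho>) y)
         \<le> F * 3 powr l * (norm y powr - (l + h) * indicator (- ball 0 \<rho>) y)"
      proof (cases "y \<in> - ball 0 \<rho>")
        case True
        then have "f y \<le> F * norm y powr - h" using F by (simp add: \<rho>_def)
        then have "f y * (3 powr l * norm y powr - l) \<le> (F * norm y powr - h) * (3 powr l * norm y powr - l)"
          by (intro mult_right_mono) auto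
        also have "\<dots> = F * 3 powr l * (norm y powr - (l + h))"
          by (simp add: powr_add[symmetric] algebra_simps)
        finally show ?thesis using True by simp
      qed auto
      have "f y * norm (x - y) powr - l \<le> f y * (\<rho> powr - l * indicator (ball 0 \<rho>) y
      + norm (x - y) powr - l * indicator (ball x \<rho>) y
      + 3 powr l * norm y powr - l * indicator (- ball 0 \<rho>) y)"
        using riesz_kernel_split[OF l(1) x, of y] f0 unfolding \<rho>_def by (intro mult_left_mono) auto
      also have "\<dots> \<le> \<rho> powr - l * (f y * indicator (ball 0 \<rho>) y)
       + F * \<rho> powr - h * (norm (x - y) powr - l * indicator (ball x \<rho>) y)
       + F * 3 powr l * (norm y powr - (l + h) * indicator (- ball 0 \<rho>) y)"
        unfolding distrib_left using 1 2 by (intro add_mono) (auto simp: mult_ac)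
      finally have "ennreal (f y * norm (x - y) powr - l) \<le> ennreal (\<rho> powr - l * (f y * indicator (ball 0 \<rho>) y)
       + F * \<rho> powr - h * (norm (x - y) powr - l * indicator (ball x \<rho>) y)
       + F * 3 powr l * (norm y powr - (l + h) * indicator (- ball 0 \<rho>) y))"
        by (rule ennreal_leI)
      also have "\<dots> = ennreal (\<rho> powr - l) * (ennreal (f y) * indicator (ball 0 \<rho>) y)
       + ennreal (F * \<rho> powr - h) * (ennreal (norm (x - y) powr - l) * indicator (ball x \<rho>) y)
       + ennreal (F * 3 powr l) * (ennreal (norm y powr - (l + h)) * indicator (- ball 0 \<rho>) y)"
        using f0 F by (auto simp: indicator_def ennreal_mult)
      finally show "ennreal (f y * norm (x - y) powr - l) \<le> \<dots>" .
    qed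
    also have "\<dots> = ennreal (\<rho> powr - l) * (\<integral>\<^sup>+ y. ennreal (f y) * indicator (ball 0 \<rho>) y \<partial>lborel)
       + ennreal (F * \<rho> powr - h) * (\<integral>\<^sup>+ y. ennreal (norm (x - y) powr - l) * indicator (ball x \<rho>) y \<partial>lborel)
       + ennreal (F * 3 powr l) * (\<integral>\<^sup>+ (y::'a). ennreal (norm y powr - (l + h)) * indicator (- ball 0 \<rho>) y \<partial>lborel)"
      by (simp add: nn_integral_add nn_integral_cmult)
    also have "\<dots> \<le> ennreal (\<rho> powr - l) * (\<integral>\<^sup>+ y. ennreal (f y) * indicator (ball 0 \<rho>) y \<partial>lborel)
       + ennreal (F * \<rho> powr - h) * ennreal (C1 * \<rho> powr (n - l))
       + ennreal (F * 3 powr l) * ennreal (C2 * \<rho> powr (n - (l + h)))"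
      using \<rho> by (intro add_mono mult_left_mono C1 C2) auto
    also have "\<dots> = ennreal (\<rho> powr - l) * (\<integral>\<^sup>+ y. ennreal (f y) * indicator (ball 0 \<rho>) y \<partial>lborel)
       + ennreal (F * \<rho> powr - h * (C1 * \<rho> powr (n - l)) + F * 3 powr l * (C2 * \<rho> powr (n - (l + h))))"
      using F C1 C2 by (simp add: ennreal_mult[symmetric] ennreal_plus[symmetric] add.assoc del: ennreal_plus)
    also have "\<dots> \<le> ennreal (C * norm x powr - l) * (\<integral>\<^sup>+ y. ennreal (f y) * indicator (ball 0 \<rho>) y \<partial>lborel)
       + ennreal (C * F * norm x powr (n - l - h))"
    proof (intro add_mono mult_right_mono ennreal_leI)
      have "\<rho> powr - l = 2 powr l * norm x powr - l"
        by (simp add: \<rho>_def powr_divide powr_minus divide_simps)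
      also have "\<dots> \<le> C * norm x powr - l"
        using Cge by (intro mult_right_mono) auto
      finally show "\<rho> powr - l \<le> C * norm x powr - l" .
      have e1: "\<rho> powr - h * \<rho> powr (n - l) = \<rho> powr (n - l - h)"
        by (simp add: powr_add[symmetric])
      have e2: "\<rho> powr (n - l - h) = 2 powr - (n - l - h) * norm x powr (n - l - h)"
        unfolding \<rho>_def by (rule half_powr) simp
      have e3: "2 powr - (n - l - h) \<le> 2 powr h"
        using l by (intro powr_mono) (auto simp: n_def)
      have e4: "2 powr - (n - l - h) \<le> 2 powr (l + h)"
        using l by (intro powr_mono) (auto simp: n_def)
      have "F * \<rho> powr - h * (C1 * \<rho> powr (n - l)) + F * 3 powr l * (C2 * \<rho> powr (n - (l + h)))
        = (F * norm x powr (n - l - h)) * (C1 * 2 powr - (n - l - h) + 3 powr l * C2 * 2 powr - (n - l - h))"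
      proof -
        have "F * \<rho> powr - h * (C1 * \<rho> powr (n - l)) + F * 3 powr l * (C2 * \<rho> powr (n - (l + h)))
          = F * C1 * (\<rho> powr - h * \<rho> powr (n - l)) + F * 3 powr l * C2 * \<rho> powr (n - l - h)"
          by (simp add: mult_ac diff_diff_eq)
        also have "\<dots> = F * C1 * (2 powr - (n - l - h) * norm x powr (n - l - h))
           + F * 3 powr l * C2 * (2 powr - (n - l - h) * norm x powr (n - l - h))"
          by (simp only: e1 e2)
        finally show ?thesis by (simp only: distrib_left mult_ac)
      qed
      also have "\<dots> \<le> (F * norm x powr (n - l - h)) * (C1 * 2 powr h + 3 powr l * C2 * 2 powr (l + h))"
        using F C1 C2 e3 e4 by (intro mult_left_mono add_mono) auto
      also have "\<dots> \<le> (F * norm x powr (n - l - h)) * C"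
        using F Cge(2) by (intro mult_left_mono) (auto simp: mult.commute)
      finally show "F * \<rho> powr - h * (C1 * \<rho> powr (n - l)) + F * 3 powr l * (C2 * \<rho> powr (n - (l + h)))
         \<le> C * F * norm x powr (n - l - h)" by (simp add: mult_ac)
    qed auto
    finally show "riesz l f x \<le> ennreal (C * norm x powr - l) * (\<integral>\<^sup>+ y. ennreal (f y) * indicator (ball 0 (norm x / 2)) y \<partial>lborel)
        + ennreal (C * F * norm x powr (real DIM('a) - l - h))"
      unfolding n_def \<rho>_def .
  qed
qed

section \<open>Weak-type estimates for the Riesz potential\<close>

lemma riesz_measurable [measurable]:
  assumes [measurable]: "f \<in> borel_measurable borel"
  shows "riesz l f \<in> borel_measurable borel"
proof -
  have "(\<lambda>x. \<integral>\<^sup>+ y. ennreal (f y * norm (x - y) powr - l) \<partial>lborel) \<in> borel_measurable lborel"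
    by measurable
  then show ?thesis unfolding riesz_def[abs_def] by simp
qed

text \<open>Tonelli together with the symmetry of the kernel; used for duality in the weak-type
  bound and for the exact identity behind part (ii).\<close>

lemma riesz_commute:
  fixes f g :: "'a::euclidean_space \<Rightarrow> real"
  assumes [measurable]: "f \<in> borel_measurable borel" "g \<in> borel_measurable borel"
    and "\<And>x. 0 \<le> f x" "\<And>x. 0 \<le> g x"
  shows "(\<integral>\<^sup>+ x. ennreal (g x) * riesz l f x \<partial>lborel) = (\<integral>\<^sup>+ x. ennreal (f x) * riesz l g x \<partial>lborel)"
proof -
  have "(\<integral>\<^sup>+ x. ennreal (g x) * riesz l f x \<partial>lborel)
     = (\<integral>\<^sup>+ x. \<integral>\<^sup>+ y. ennreal (g x) * ennreal (f y * norm (x - y) powr - l) \<partial>lborel \<partial>lborel)"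
    unfolding riesz_def by (subst nn_integral_cmult) auto
  also have "\<dots> = (\<integral>\<^sup>+ y. \<integral>\<^sup>+ x. ennreal (g x) * ennreal (f y * norm (x - y) powr - l) \<partial>lborel \<partial>lborel)"
    by (rule lborel_pair.Fubini'[symmetric]) measurable
  also have "\<dots> = (\<integral>\<^sup>+ y. \<integral>\<^sup>+ x. ennreal (f y) * ennreal (g x * norm (y - x) powr - l) \<partial>lborel \<partial>lborel)"
    using assms by (intro nn_integral_cong) (simp add: ennreal_mult[symmetric] norm_minus_commute mult_ac)
  also have "\<dots> = (\<integral>\<^sup>+ x. ennreal (f x) * riesz l g x \<partial>lborel)"
    unfolding riesz_def by (subst nn_integral_cmult) auto
  finally show ?thesis .
qed

lemma riesz_mono: "(\<And>y. f y \<le> g y) \<Longrightarrow> riesz l f x \<le> riesz l g x"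
  unfolding riesz_def by (intro nn_integral_mono ennreal_leI mult_right_mono) auto

lemma riesz_add:
  assumes [measurable]: "f \<in> borel_measurable borel" "g \<in> borel_measurable borel"
    and "\<And>x. 0 \<le> f x" "\<And>x. 0 \<le> g x"
  shows "riesz l (\<lambda>y. f y + g y) x = riesz l f x + riesz l g x"
  unfolding riesz_def using assms
  by (simp add: distrib_right ennreal_plus nn_integral_add)

lemma riesz_cmult:
  assumes [measurable]: "f \<in> borel_measurable borel" and "0 \<le> c" "\<And>x. 0 \<le> f x"
  shows "riesz l (\<lambda>y. c * f y) x = ennreal c * riesz l f x"
  unfolding riesz_def using assms
  by (simp add: mult.assoc ennreal_mult nn_integral_cmult)

text \<open>Duality: the potential is integrated over its own superlevel set, the kernel is moved
  onto the indicator of that set, and \<open>nn_integral_norm_powr_set\<close> bounds the resulting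
  potential uniformly. A set of volume above r^n would contradict the strict decay of
  \<open>r powr - l\<close>.\<close>

lemma riesz_weak_type_1:
  assumes l: "0 < l" "l < real DIM('a::euclidean_space)"
  shows "\<exists>C>0. \<forall>(g::'a \<Rightarrow> real) A r. g \<in> borel_measurable borel \<longrightarrow> (\<forall>x. 0 \<le> g x) \<longrightarrow> 0 < A \<longrightarrow> 0 < r \<longrightarrow>
     (\<integral>\<^sup>+ x. ennreal (g x) \<partial>lborel) \<le> ennreal A \<longrightarrow>
     superlevel_le (riesz l g) (ennreal (C * A * r powr - l)) r"
proof -
  define n where "n = real DIM('a)"
  from nn_integral_norm_powr_set[OF less_imp_le[OF l(1)] l(2)]
  obtain C where C: "C > 0" and CE: "\<And>r (x::'a) E. r > 0 \<Longrightarrow> E \<in> sets borel \<Longrightarrow>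
       emeasure lborel E \<le> ennreal (r ^ DIM('a)) \<Longrightarrow>
     (\<integral>\<^sup>+ y. ennreal (norm (x - y) powr - l) * indicator E y \<partial>lborel) \<le> ennreal (C * r powr (n - l))"
    unfolding n_def by blast
  show ?thesis
  proof (intro exI[of _ C] conjI allI impI C, rule ccontr)
    fix g :: "'a \<Rightarrow> real" and A r :: real
    assume [measurable]: "g \<in> borel_measurable borel" and g0: "\<forall>x. 0 \<le> g x" and A: "0 < A" and r: "0 < r"
      and gA: "(\<integral>\<^sup>+ x. ennreal (g x) \<partial>lborel) \<le> ennreal A"
    define s where "s = C * A * r powr - l"
    \<comment> \<open>Intersecting with balls makes the measure finite, so that it can be written as
      \<rho>^n with a real radius \<rho>.\<close>
    define F where "F k = {x. ennreal s < riesz l g x} \<inter> ball 0 (real k)" for k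
    have [measurable]: "F k \<in> sets borel" for k unfolding F_def by measurable
    have s: "s > 0" using C A r by (simp add: s_def)
    assume "\<not> superlevel_le (riesz l g) (ennreal (C * A * r powr - l)) r"
    then have "ennreal (r ^ DIM('a)) < emeasure lborel {x. ennreal s < riesz l g x}"
      by (simp add: s_def not_le)
    also have "{x. ennreal s < riesz l g x} = (\<Union>k. F k)"
      unfolding F_def using reals_Archimedean2 by fastforce
    also have "emeasure lborel (\<Union>k. F k) = (SUP k. emeasure lborel (F k))"
      by (rule SUP_emeasure_incseq[symmetric]) (auto simp: F_def incseq_def)
    finally obtain k where k: "ennreal (r ^ DIM('a)) < emeasure lborel (F k)"
      by (auto simp: less_SUP_iff)
    have "emeasure lborel (F k) \<le> emeasure lborel (ball (0::'a) (real k))"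
      by (intro emeasure_mono) (auto simp: F_def)
    then have "emeasure lborel (F k) < \<infinity>" by (simp add: emeasure_ball le_less_trans)
    then obtain m where m: "emeasure lborel (F k) = ennreal m" "0 \<le> m"
      by (cases "emeasure lborel (F k)") auto
    define \<rho> where "\<rho> = m powr (1 / n)"
    have n: "n > 0" by (simp add: n_def)
    have rm: "r ^ DIM('a) < m" using k m r by (simp add: ennreal_less_iff)
    then have m0: "0 < m" using r by (meson less_trans zero_less_power)
    then have \<rho>0: "\<rho> > 0" by (simp add: \<rho>_def)
    have \<rho>n: "\<rho> ^ DIM('a) = m"
      using m0 \<rho>0 n by (simp add: powr_realpow[symmetric] \<rho>_def powr_powr n_def)
    have r\<rho>: "r < \<rho>" using rm \<rho>n \<rho>0 r power_less_imp_less_base[of r "DIM('a)" \<rho>] by simp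
    have "ennreal (s * m) = (\<integral>\<^sup>+ x. ennreal s * indicator (F k) x \<partial>lborel)"
      using s m by (simp add: nn_integral_cmult_indicator ennreal_mult)
    also have "\<dots> \<le> (\<integral>\<^sup>+ x. ennreal (indicator (F k) x) * riesz l g x \<partial>lborel)"
      by (intro nn_integral_mono) (auto simp: indicator_def F_def)
    also have "\<dots> = (\<integral>\<^sup>+ x. ennreal (g x) * riesz l (indicator (F k)) x \<partial>lborel)"
      using g0 by (intro riesz_commute) auto
    also have "\<dots> \<le> (\<integral>\<^sup>+ x. ennreal (g x) * ennreal (C * \<rho> powr (n - l)) \<partial>lborel)"
    proof (intro nn_integral_mono mult_left_mono)
      fix x
      have "riesz l (indicator (F k)) x = (\<integral>\<^sup>+ y. ennreal (norm (x - y) powr - l) * indicator (F k) y \<partial>lborel)"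
        unfolding riesz_def by (intro nn_integral_cong) (auto simp: indicator_def)
      also have "\<dots> \<le> ennreal (C * \<rho> powr (n - l))"
        using \<rho>0 m \<rho>n by (intro CE) auto
      finally show "riesz l (indicator (F k)) x \<le> ennreal (C * \<rho> powr (n - l))" .
    qed auto
    also have "\<dots> = (\<integral>\<^sup>+ x. ennreal (g x) \<partial>lborel) * ennreal (C * \<rho> powr (n - l))"
      by (rule nn_integral_multc) auto
    also have "\<dots> \<le> ennreal A * ennreal (C * \<rho> powr (n - l))"
      by (intro mult_right_mono gA) auto
    also have "\<dots> = ennreal (A * (C * \<rho> powr (n - l)))"
      using A C by (simp add: ennreal_mult[symmetric])
    finally have "s * m \<le> A * (C * \<rho> powr (n - l))"
      using A C by (subst (asm) ennreal_le_iff) auto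
    also have "\<rho> powr (n - l) = \<rho> powr - l * m"
      unfolding \<rho>n[symmetric] using \<rho>0 by (simp add: powr_realpow[symmetric] powr_add[symmetric] n_def)
    finally have "s \<le> A * C * \<rho> powr - l"
      using m0 by (simp add: mult_ac)
    moreover have "\<rho> powr - l < r powr - l"
      using r r\<rho> l by (intro powr_less_mono2_neg) auto
    ultimately show False
      using A C by (simp add: s_def mult_ac)
  qed
qed

text \<open>Levels are taken along the profile: a value between \<open>\<psi> (r / 2^k)\<close> and
  \<open>\<psi> (r / 2^(k+1))\<close> occurs on a set of volume at most (r / 2^k)^n. The
  contributions decrease like 2^(k (b' - n)), and the growth of \<psi> at small radii, forced by
  \<open>b > 0\<close>, ensures that every value is reached.\<close>

lemma nn_integral_large_values:
  fixes f :: "'a::euclidean_space \<Rightarrow> real"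
  assumes b: "0 < b" and b': "b' < real DIM('a)"
    and [measurable]: "f \<in> borel_measurable borel"
    and \<psi>0: "\<And>r. 0 < r \<Longrightarrow> 0 < \<psi> r"
    and \<psi>1: "\<And>r k. 0 < r \<Longrightarrow> \<psi> (2 ^ k * r) \<le> (2 powr - b) ^ k * \<psi> r"
    and \<psi>2: "\<And>r k. 0 < r \<Longrightarrow> \<psi> (r / 2 ^ k) \<le> (2 powr b') ^ k * \<psi> r"
    and f: "\<And>r. 0 < r \<Longrightarrow> superlevel_le f (\<psi> r) r"
    and r: "0 < r"
  shows "(\<integral>\<^sup>+ x. ennreal (f x) * indicator {x. \<psi> r < f x} x \<partial>lborel)
     \<le> ennreal (2 powr b' / (1 - 2 powr (b' - real DIM('a))) * \<psi> r * r ^ DIM('a))"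
proof -
  define n where "n = real DIM('a)"
  have c: "0 \<le> 2 powr (b' - n)" "2 powr (b' - n) < 1"
    using b' by (auto simp: n_def powr_less_one)
  have "(\<integral>\<^sup>+ x. ennreal (f x) * indicator {x. \<psi> r < f x} x \<partial>lborel)
    \<le> ennreal ((2 powr b' * \<psi> r * r ^ DIM('a)) / (1 - 2 powr (b' - n)))"
  proof (rule nn_integral_le_geometric)
    show "(\<lambda>x. ennreal ((2 powr b') ^ Suc k * \<psi> r) * indicator {x. \<psi> (r / 2 ^ k) < f x} x) \<in> borel_measurable lborel" for k
      by measurable
    fix x
    show "ennreal (f x) * indicator {x. \<psi> r < f x} x = 0 \<or>
      (\<exists>k. ennreal (f x) * indicator {x. \<psi> r < f x} x \<le> ennreal ((2 powr b') ^ Suc k * \<psi> r) * indicator {x. \<psi> (r / 2 ^ k) < f x} x)"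
    proof (cases "\<psi> r < f x")
      case True
      have "1 < 2 powr b" using b by simp
      from real_arch_pow[OF this, of "f x / \<psi> r"] obtain k where k: "f x / \<psi> r < (2 powr b) ^ k" ..
      have "\<psi> r \<le> (2 powr - b) ^ k * \<psi> (r / 2 ^ k)"
        using \<psi>1[of "r / 2 ^ k" k] r by simp
      then have "(2 powr b) ^ k * \<psi> r \<le> (2 powr b) ^ k * ((2 powr - b) ^ k * \<psi> (r / 2 ^ k))"
        by (intro mult_left_mono) auto
      also have "\<dots> = \<psi> (r / 2 ^ k)"
        by (simp add: mult.assoc[symmetric] power_mult_distrib[symmetric] powr_add[symmetric])
      finally have "\<not> \<psi> (r / 2 ^ k) < f x"
        using k \<psi>0[OF r] by (simp add: field_simps)
      from nat_switch[of "\<lambda>k. \<psi> (r / 2 ^ k) < f x", OF _ this] True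
      obtain k where k: "\<psi> (r / 2 ^ k) < f x" "f x \<le> \<psi> (r / 2 ^ Suc k)" by (auto simp: not_less)
      have "f x \<le> (2 powr b') ^ Suc k * \<psi> r" using k(2) \<psi>2[OF r, of "Suc k"] by linarith
      then show ?thesis
        using k by (intro disjI2 exI[of _ k] ennreal_mult_indicator_mono) auto
    qed auto
  next
    fix k
    have eq: "(2 powr b') ^ Suc k * \<psi> r * (r / 2 ^ k) ^ DIM('a) = (2 powr b' * \<psi> r * r ^ DIM('a)) * (2 powr (b' - n)) ^ k"
    proof -
      have "(r / 2 ^ k) ^ DIM('a) = r ^ DIM('a) * (2 powr - n) ^ k"
        using divide_two_pow_powr[of r k n] powr_realpow[of "r / 2 ^ k" "DIM('a)"] powr_realpow[of r "DIM('a)"] r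
        by (simp add: n_def)
      then have "(2 powr b') ^ Suc k * \<psi> r * (r / 2 ^ k) ^ DIM('a)
         = (2 powr b' * \<psi> r * r ^ DIM('a)) * ((2 powr b') ^ k * (2 powr - n) ^ k)"
        by simp
      also have "(2 powr b') ^ k * (2 powr - n) ^ k = (2 powr (b' - n)) ^ k"
        by (simp add: power_mult_distrib[symmetric] powr_add[symmetric])
      finally show ?thesis .
    qed
    have "(\<integral>\<^sup>+ x. ennreal ((2 powr b') ^ Suc k * \<psi> r) * indicator {x. \<psi> (r / 2 ^ k) < f x} x \<partial>lborel)
       = ennreal ((2 powr b') ^ Suc k * \<psi> r) * emeasure lborel {x. \<psi> (r / 2 ^ k) < f x}"
      by (intro nn_integral_cmult_indicator) auto
    also have "\<dots> \<le> ennreal ((2 powr b') ^ Suc k * \<psi> r) * ennreal ((r / 2 ^ k) ^ DIM('a))"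
      using r by (intro mult_left_mono f) auto
    also have "\<dots> = ennreal ((2 powr b' * \<psi> r * r ^ DIM('a)) * (2 powr (b' - n)) ^ k)"
      unfolding eq[symmetric] using \<psi>0[OF r] r by (intro ennreal_mult[symmetric]) auto
    finally show "(\<integral>\<^sup>+ x. ennreal ((2 powr b') ^ Suc k * \<psi> r) * indicator {x. \<psi> (r / 2 ^ k) < f x} x \<partial>lborel)
       \<le> ennreal ((2 powr b' * \<psi> r * r ^ DIM('a)) * (2 powr (b' - n)) ^ k)" .
  qed (use c \<psi>0[OF r] r in auto)
  then show ?thesis by (simp add: n_def mult_ac)
qed

text \<open>The mirror image of \<open>nn_integral_large_values\<close>: low levels occupy volumes
  (2^(k+1) r)^n, so level k contributes a multiple of 2^(-b k) 2^(k (n - l)), summable because b > n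
  - l. Here the bound is pointwise, not weak.\<close>

lemma riesz_small_values:
  assumes l: "0 < l" "l < real DIM('a::euclidean_space)" and b: "real DIM('a) - l < b"
  shows "\<exists>C>0. \<forall>(f::'a \<Rightarrow> real) \<psi> r. f \<in> borel_measurable borel \<longrightarrow> (\<forall>x. 0 \<le> f x) \<longrightarrow> 0 < r \<longrightarrow>
     (\<forall>r>0. 0 < \<psi> r) \<longrightarrow> (\<forall>r>0. \<forall>k. \<psi> (2 ^ k * r) \<le> (2 powr - b) ^ k * \<psi> r) \<longrightarrow>
     (\<forall>r>0. superlevel_le f (\<psi> r) r) \<longrightarrow>
     (\<forall>x. riesz l (\<lambda>y. f y * indicator {y. f y \<le> \<psi> r} y) x \<le> ennreal (C * \<psi> r * r powr (real DIM('a) - l)))"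
proof -
  define n where "n = real DIM('a)"
  from nn_integral_norm_powr_set[OF less_imp_le[OF l(1)] l(2)]
  obtain C where C: "C > 0" and CE: "\<And>r (x::'a) E. r > 0 \<Longrightarrow> E \<in> sets borel \<Longrightarrow>
       emeasure lborel E \<le> ennreal (r ^ DIM('a)) \<Longrightarrow>
     (\<integral>\<^sup>+ y. ennreal (norm (x - y) powr - l) * indicator E y \<partial>lborel) \<le> ennreal (C * r powr (n - l))"
    unfolding n_def by blast
  define c where "c = 2 powr (n - l - b)"
  have c: "0 \<le> c" "c < 1" using b by (auto simp: n_def c_def powr_less_one)
  show ?thesis
  proof (intro exI[of _ "C * 2 powr (n - l) / (1 - c)"] conjI allI impI)
    show "C * 2 powr (n - l) / (1 - c) > 0" using C c by simp
    fix f :: "'a \<Rightarrow> real" and \<psi> :: "real \<Rightarrow> real" and r :: real and x :: 'a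
    assume [measurable]: "f \<in> borel_measurable borel" and f0: "\<forall>x. 0 \<le> f x" and r: "0 < r"
      and \<psi>0: "\<forall>r>0. 0 < \<psi> r" and \<psi>1: "\<forall>r>0. \<forall>k. \<psi> (2 ^ k * r) \<le> (2 powr - b) ^ k * \<psi> r"
      and f: "\<forall>r>0. superlevel_le f (\<psi> r) r"
    have "riesz l (\<lambda>y. f y * indicator {y. f y \<le> \<psi> r} y) x \<le> ennreal ((C * 2 powr (n - l) * \<psi> r * r powr (n - l)) / (1 - c))"
      unfolding riesz_def
    proof (rule nn_integral_le_geometric)
      show "(\<lambda>y. ennreal ((2 powr - b) ^ k * \<psi> r) * (ennreal (norm (x - y) powr - l) * indicator {y. \<psi> (2 ^ Suc k * r) < f y} y)) \<in> borel_measurable lborel" for k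
        by measurable
      fix y
      show "ennreal (f y * indicator {y. f y \<le> \<psi> r} y * norm (x - y) powr - l) = 0 \<or>
        (\<exists>k. ennreal (f y * indicator {y. f y \<le> \<psi> r} y * norm (x - y) powr - l)
          \<le> ennreal ((2 powr - b) ^ k * \<psi> r) * (ennreal (norm (x - y) powr - l) * indicator {y. \<psi> (2 ^ Suc k * r) < f y} y))"
      proof (cases "f y \<le> \<psi> r \<and> 0 < f y")
        case True
        have "2 powr - b < 1" using b l by (simp add: powr_less_one)
        then obtain k where k: "(2 powr - b) ^ k < f y / \<psi> r"
          using real_arch_pow_inv[of "f y / \<psi> r" "2 powr - b"] True \<psi>0 r by auto
        then have "(2 powr - b) ^ k * \<psi> r < f y" using \<psi>0 r by (simp add: field_simps)
        then have "\<not> f y \<le> \<psi> (2 ^ k * r)" using \<psi>1 r by (meson le_less_trans not_le)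
        from nat_switch[of "\<lambda>k. f y \<le> \<psi> (2 ^ k * r)", OF _ this] True
        obtain k where k: "f y \<le> \<psi> (2 ^ k * r)" "\<psi> (2 ^ Suc k * r) < f y" by (auto simp: not_le)
        have "f y \<le> (2 powr - b) ^ k * \<psi> r" using k(1) \<psi>1 r by (meson order_trans)
        then have "ennreal (f y) * ennreal (norm (x - y) powr - l)
           \<le> ennreal ((2 powr - b) ^ k * \<psi> r) * ennreal (norm (x - y) powr - l)"
          by (intro mult_right_mono ennreal_leI) auto
        then show ?thesis
          using True k by (intro disjI2 exI[of _ k]) (simp add: ennreal_mult)
      next
        case False
        then show ?thesis using f0[rule_format, of y] by (auto simp: indicator_def)
      qed
    next
      fix k
      have eq: "(2 powr - b) ^ k * \<psi> r * (C * (2 ^ Suc k * r) powr (n - l))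
         = (C * 2 powr (n - l) * \<psi> r * r powr (n - l)) * c ^ k"
      proof -
        have "(2 ^ Suc k * r) powr (n - l) = 2 powr (n - l) * (2 powr (n - l)) ^ k * r powr (n - l)"
          using r by (simp add: powr_mult two_pow_powr)
        then have "(2 powr - b) ^ k * \<psi> r * (C * (2 ^ Suc k * r) powr (n - l))
           = (C * 2 powr (n - l) * \<psi> r * r powr (n - l)) * ((2 powr (n - l)) ^ k * (2 powr - b) ^ k)"
          by simp
        also have "(2 powr (n - l)) ^ k * (2 powr - b) ^ k = c ^ k"
          by (simp add: power_mult_distrib[symmetric] powr_add[symmetric] c_def)
        finally show ?thesis .
      qed
      have "(\<integral>\<^sup>+ y. ennreal ((2 powr - b) ^ k * \<psi> r) * (ennreal (norm (x - y) powr - l) * indicator {y. \<psi> (2 ^ Suc k * r) < f y} y) \<partial>lborel)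
         = ennreal ((2 powr - b) ^ k * \<psi> r) * (\<integral>\<^sup>+ y. ennreal (norm (x - y) powr - l) * indicator {y. \<psi> (2 ^ Suc k * r) < f y} y \<partial>lborel)"
        by (intro nn_integral_cmult) auto
      also have "\<dots> \<le> ennreal ((2 powr - b) ^ k * \<psi> r) * ennreal (C * (2 ^ Suc k * r) powr (n - l))"
        using r f by (intro mult_left_mono CE) auto
      also have "\<dots> = ennreal ((C * 2 powr (n - l) * \<psi> r * r powr (n - l)) * c ^ k)"
        unfolding eq[symmetric] using \<psi>0 r C by (intro ennreal_mult[symmetric]) (auto simp: less_imp_le)
      finally show "(\<integral>\<^sup>+ y. ennreal ((2 powr - b) ^ k * \<psi> r) * (ennreal (norm (x - y) powr - l) * indicator {y. \<psi> (2 ^ Suc k * r) < f y} y) \<partial>lborel)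
         \<le> ennreal ((C * 2 powr (n - l) * \<psi> r * r powr (n - l)) * c ^ k)" .
    qed (use c \<psi>0 r C in \<open>auto simp: less_imp_le\<close>)
    then show "riesz l (\<lambda>y. f y * indicator {y. f y \<le> \<psi> r} y) x
      \<le> ennreal (C * 2 powr (n - l) / (1 - c) * \<psi> r * r powr (real DIM('a) - l))"
      by (simp add: n_def mult_ac)
  qed
qed

text \<open>Splitting \<open>f\<close> at height \<open>\<psi> r\<close> gives an integrable part,
  controlled weakly, and a part with bounded potential; with the same \<open>r\<close> both have
  size \<psi>(r) r^(n - l). The profile need not be a power: decay between the powers -b and -b' is
  enough, so that sums of two powers, as in the barrier, are admissible.\<close>

lemma riesz_weak_type:
  assumes l: "0 < l" "l < real DIM('a::euclidean_space)"
    and b: "real DIM('a) - l < b" and b': "b' < real DIM('a)"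
  shows "\<exists>C>0. \<forall>(f::'a \<Rightarrow> real) \<psi>. f \<in> borel_measurable borel \<longrightarrow> (\<forall>x. 0 \<le> f x) \<longrightarrow>
     (\<forall>r>0. 0 < \<psi> r) \<longrightarrow> (\<forall>r>0. \<forall>k. \<psi> (2 ^ k * r) \<le> (2 powr - b) ^ k * \<psi> r) \<longrightarrow>
     (\<forall>r>0. \<forall>k. \<psi> (r / 2 ^ k) \<le> (2 powr b') ^ k * \<psi> r) \<longrightarrow>
     (\<forall>r>0. superlevel_le f (\<psi> r) r) \<longrightarrow>
     (\<forall>r>0. superlevel_le (riesz l f) (ennreal (C * \<psi> r * r powr (real DIM('a) - l))) r)"
proof -
  define n where "n = real DIM('a)"
  from riesz_weak_type_1[OF l]
  obtain C1 where C1: "C1 > 0" and W1: "\<And>(g::'a \<Rightarrow> real) A r. g \<in> borel_measurable borel \<Longrightarrow> (\<forall>x. 0 \<le> g x) \<Longrightarrow> 0 < A \<Longrightarrow> 0 < r \<Longrightarrow>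
     (\<integral>\<^sup>+ x. ennreal (g x) \<partial>lborel) \<le> ennreal A \<Longrightarrow>
     superlevel_le (riesz l g) (ennreal (C1 * A * r powr - l)) r"
    by blast
  obtain C2 where C2: "C2 > 0" and W2_raw: "\<forall>(f::'a \<Rightarrow> real) \<psi> r. f \<in> borel_measurable borel \<longrightarrow> (\<forall>x. 0 \<le> f x) \<longrightarrow> 0 < r \<longrightarrow>
     (\<forall>r>0. 0 < \<psi> r) \<longrightarrow> (\<forall>r>0. \<forall>k. \<psi> (2 ^ k * r) \<le> (2 powr - b) ^ k * \<psi> r) \<longrightarrow>
     (\<forall>r>0. superlevel_le f (\<psi> r) r) \<longrightarrow>
     (\<forall>x. riesz l (\<lambda>y. f y * indicator {y. f y \<le> \<psi> r} y) x \<le> ennreal (C2 * \<psi> r * r powr (real DIM('a) - l)))"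
    using riesz_small_values[OF l b] by (elim exE conjE) (rule that)
  note W2 = W2_raw[rule_format, folded n_def]
  define C3 where "C3 = 2 powr b' / (1 - 2 powr (b' - n))"
  have C3: "C3 > 0" using b' by (simp add: C3_def n_def powr_less_one)
  show ?thesis
  proof (intro exI[of _ "C1 * C3 + C2"] conjI allI impI)
    show "C1 * C3 + C2 > 0" using C1 C2 C3 by (simp add: add_pos_pos)
    fix f :: "'a \<Rightarrow> real" and \<psi> :: "real \<Rightarrow> real" and r :: real
    assume [measurable]: "f \<in> borel_measurable borel" and f0: "\<forall>x. 0 \<le> f x" and r: "0 < r"
      and \<psi>0: "\<forall>r>0. 0 < \<psi> r" and \<psi>1: "\<forall>r>0. \<forall>k. \<psi> (2 ^ k * r) \<le> (2 powr - b) ^ k * \<psi> r"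
      and \<psi>2: "\<forall>r>0. \<forall>k. \<psi> (r / 2 ^ k) \<le> (2 powr b') ^ k * \<psi> r"
      and f: "\<forall>r>0. superlevel_le f (\<psi> r) r"
    define f1 where "f1 y = f y * indicator {y. \<psi> r < f y} y" for y
    define f2 where "f2 y = f y * indicator {y. f y \<le> \<psi> r} y" for y
    have [measurable]: "f1 \<in> borel_measurable borel" "f2 \<in> borel_measurable borel"
      unfolding f1_def f2_def by measurable
    have f12: "f = (\<lambda>y. f1 y + f2 y)" by (auto simp: f1_def f2_def indicator_def)
    have \<psi>r: "\<psi> r > 0" using \<psi>0 r by simp
    define A where "A = C3 * \<psi> r * r powr n"
    have A: "A > 0" using C3 \<psi>r r by (simp add: A_def)
    have "(\<integral>\<^sup>+ y. ennreal (f1 y) \<partial>lborel) = (\<integral>\<^sup>+ x. ennreal (f x) * indicator {x. \<psi> r < f x} x \<partial>lborel)"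
      by (intro nn_integral_cong) (auto simp: f1_def indicator_def)
    also have "\<dots> \<le> ennreal (C3 * \<psi> r * r ^ DIM('a))"
      unfolding C3_def n_def
      using b l \<psi>0 \<psi>1 \<psi>2 f r b' by (intro nn_integral_large_values[of b]) auto
    also have "\<dots> = ennreal A" using r by (simp add: A_def n_def powr_realpow)
    finally have 1: "(\<integral>\<^sup>+ y. ennreal (f1 y) \<partial>lborel) \<le> ennreal A" .
    have 2: "riesz l f2 x \<le> ennreal (C2 * \<psi> r * r powr (n - l))" for x
      unfolding f2_def using \<psi>0 \<psi>1 f f0 r by (intro W2) auto
    \<comment> \<open>The potential of \<open>f2\<close> never exceeds the second summand of the
      threshold, so that of \<open>f1\<close> alone must exceed the first.\<close>
    have "emeasure lborel {x. ennreal ((C1 * C3 + C2) * \<psi> r * r powr (n - l)) < riesz l f x}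
       \<le> emeasure lborel {x. ennreal (C1 * A * r powr - l) < riesz l f1 x}"
    proof (intro emeasure_mono subsetI)
      fix x assume "x \<in> {x. ennreal ((C1 * C3 + C2) * \<psi> r * r powr (n - l)) < riesz l f x}"
      then have "ennreal ((C1 * C3 + C2) * \<psi> r * r powr (n - l)) < riesz l f x" by simp
      also have "riesz l f x = riesz l f1 x + riesz l f2 x"
        by (subst f12, rule riesz_add) (use f0 in \<open>auto simp: f1_def f2_def\<close>)
      also have "\<dots> \<le> riesz l f1 x + ennreal (C2 * \<psi> r * r powr (n - l))"
        by (intro add_left_mono 2)
      finally have less: "ennreal ((C1 * C3 + C2) * \<psi> r * r powr (n - l)) < riesz l f1 x + ennreal (C2 * \<psi> r * r powr (n - l))" .
      have "r powr (n - l) = r powr n * r powr - l" by (simp add: powr_add[symmetric])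
      then have "(C1 * C3 + C2) * \<psi> r * r powr (n - l) = C1 * A * r powr - l + C2 * \<psi> r * r powr (n - l)"
        by (simp add: A_def algebra_simps)
      then have "ennreal (C1 * A * r powr - l) + ennreal (C2 * \<psi> r * r powr (n - l)) < riesz l f1 x + ennreal (C2 * \<psi> r * r powr (n - l))"
        using less C1 C2 A \<psi>r by simp
      then have "ennreal (C1 * A * r powr - l) < riesz l f1 x"
        by (meson add_right_mono leD not_le_imp_less)
      then show "x \<in> {x. ennreal (C1 * A * r powr - l) < riesz l f1 x}" by simp
    qed measurable
    also have "\<dots> \<le> ennreal (r ^ DIM('a))"
      using f0 A r 1 by (intro W1) (auto simp: f1_def)
    finally show "superlevel_le (riesz l f) (ennreal ((C1 * C3 + C2) * \<psi> r * r powr (real DIM('a) - l))) r"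
      by (simp add: n_def)
  qed
qed

text \<open>The subcritical counterpart: b < n - l makes the high levels summable, and the finite
  volume of the set where f > 0, which is what \<open>superlevel_le f 0 R\<close> expresses,
  replaces summability over low levels.\<close>

lemma riesz_bounded_of_weak:
  fixes f :: "'a::euclidean_space \<Rightarrow> real"
  assumes l: "0 < l" "l < real DIM('a)" and b: "0 < b" "b < real DIM('a) - l"
    and [measurable]: "f \<in> borel_measurable borel" and f0: "\<And>x. 0 \<le> f x" and M: "0 < M" and R: "0 < R"
    and supp: "superlevel_le f 0 R"
    and f: "\<And>r. 0 < r \<Longrightarrow> superlevel_le f (M * r powr - b) r"
  shows "\<exists>B. \<forall>x. riesz l f x \<le> ennreal B"
proof -
  define n where "n = real DIM('a)"
  from nn_integral_norm_powr_set[OF less_imp_le[OF l(1)] l(2)]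
  obtain C where C: "C > 0" and CE: "\<And>r (x::'a) E. r > 0 \<Longrightarrow> E \<in> sets borel \<Longrightarrow>
       emeasure lborel E \<le> ennreal (r ^ DIM('a)) \<Longrightarrow>
     (\<integral>\<^sup>+ y. ennreal (norm (x - y) powr - l) * indicator E y \<partial>lborel) \<le> ennreal (C * r powr (n - l))"
    unfolding n_def by blast
  define c where "c = 2 powr (b + - (n - l))"
  have c: "0 \<le> c" "c < 1" using b by (auto simp: n_def c_def powr_less_one)
  define S where "S k = {y. M * (R / 2 ^ k) powr - b < f y}" for k
  have [measurable]: "S k \<in> sets borel" for k unfolding S_def by measurable
  have MR: "M * (R / 2 ^ k) powr - b = M * R powr - b * (2 powr b) ^ k" for k
  proof -
    have "(R / 2 ^ k) powr - b = R powr - b * (2 ^ k) powr b"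
      using R by (simp add: powr_divide powr_minus divide_simps)
    then show ?thesis by (simp add: two_pow_powr)
  qed
  have small: "ennreal (f y * norm (x - y) powr - l) \<le>
      ennreal (M * R powr - b) * (ennreal (norm (x - y) powr - l) * indicator {y. 0 < f y} y)
      + ennreal (f y * norm (x - y) powr - l) * indicator (S 0) y" for x y
  proof (cases "y \<in> S 0 \<or> f y = 0")
    case False
    then have "0 < f y" "f y \<le> M * R powr - b" using f0[of y] by (auto simp: S_def)
    then have "ennreal (f y * norm (x - y) powr - l) \<le> ennreal (M * R powr - b * norm (x - y) powr - l)"
      by (intro ennreal_leI mult_right_mono) auto
    then show ?thesis using \<open>0 < f y\<close> M by (simp add: ennreal_mult add_increasing2)
  qed (auto simp: add_increasing)
  have large: "(\<integral>\<^sup>+ y. ennreal (f y * norm (x - y) powr - l) * indicator (S 0) y \<partial>lborel)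
    \<le> ennreal ((M * R powr - b * 2 powr b * C * R powr (n - l)) / (1 - c))" for x
  proof (rule nn_integral_le_geometric)
    show "(\<lambda>y. ennreal (M * R powr - b * (2 powr b) ^ Suc k) * (ennreal (norm (x - y) powr - l) * indicator (S k) y)) \<in> borel_measurable lborel" for k
      by measurable
    fix y
    show "ennreal (f y * norm (x - y) powr - l) * indicator (S 0) y = 0 \<or> (\<exists>k. ennreal (f y * norm (x - y) powr - l) * indicator (S 0) y
      \<le> ennreal (M * R powr - b * (2 powr b) ^ Suc k) * (ennreal (norm (x - y) powr - l) * indicator (S k) y))"
    proof (cases "y \<in> S 0")
      case True
      have "1 < 2 powr b" using b by simp
      from real_arch_pow[OF this, of "f y / (M * R powr - b)"] obtain k where k: "f y / (M * R powr - b) < (2 powr b) ^ k" ..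
      then have "f y \<le> M * R powr - b * (2 powr b) ^ k" using M R by (simp add: field_simps)
      then have "y \<notin> S k" by (simp add: S_def MR not_less)
      from nat_switch[of "\<lambda>k. y \<in> S k", OF True this] obtain k where k: "y \<in> S k" "y \<notin> S (Suc k)" by blast
      then have "f y \<le> M * R powr - b * (2 powr b) ^ Suc k" by (simp only: S_def MR mem_Collect_eq not_less)
      then have "ennreal (f y * norm (x - y) powr - l) \<le> ennreal (M * R powr - b * (2 powr b) ^ Suc k * norm (x - y) powr - l)"
        by (intro ennreal_leI mult_right_mono) auto
      also have "\<dots> = ennreal (M * R powr - b * (2 powr b) ^ Suc k) * (ennreal (norm (x - y) powr - l) * indicator (S k) y)"
        using k(1) M R by (subst ennreal_mult) auto
      finally show ?thesis using True by auto
    qed auto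
  next
    fix k
    have eq: "M * R powr - b * (2 powr b) ^ Suc k * (C * (R / 2 ^ k) powr (n - l))
      = (M * R powr - b * 2 powr b * C * R powr (n - l)) * c ^ k"
    proof -
      have "(R / 2 ^ k) powr (n - l) = R powr (n - l) * (2 powr - (n - l)) ^ k"
        using R by (intro divide_two_pow_powr) simp
      then have "M * R powr - b * (2 powr b) ^ Suc k * (C * (R / 2 ^ k) powr (n - l))
         = (M * R powr - b * 2 powr b * C * R powr (n - l)) * ((2 powr b) ^ k * (2 powr - (n - l)) ^ k)"
        by (simp only: power_Suc mult_ac)
      also have "(2 powr b) ^ k * (2 powr - (n - l)) ^ k = c ^ k"
        by (simp only: power_mult_distrib[symmetric] powr_add[symmetric] c_def)
      finally show ?thesis .
    qed
    have "(\<integral>\<^sup>+ y. ennreal (M * R powr - b * (2 powr b) ^ Suc k) * (ennreal (norm (x - y) powr - l) * indicator (S k) y) \<partial>lborel)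
      = ennreal (M * R powr - b * (2 powr b) ^ Suc k) * (\<integral>\<^sup>+ y. ennreal (norm (x - y) powr - l) * indicator (S k) y \<partial>lborel)"
      by (rule nn_integral_cmult) measurable
    also have "\<dots> \<le> ennreal (M * R powr - b * (2 powr b) ^ Suc k) * ennreal (C * (R / 2 ^ k) powr (n - l))"
      using R f by (intro mult_left_mono CE) (auto simp: S_def)
    also have "\<dots> = ennreal ((M * R powr - b * 2 powr b * C * R powr (n - l)) * c ^ k)"
      unfolding eq[symmetric] using M R C by (intro ennreal_mult[symmetric]) auto
    finally show "(\<integral>\<^sup>+ y. ennreal (M * R powr - b * (2 powr b) ^ Suc k) * (ennreal (norm (x - y) powr - l) * indicator (S k) y) \<partial>lborel)
      \<le> ennreal ((M * R powr - b * 2 powr b * C * R powr (n - l)) * c ^ k)" .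
  qed (use c M C in auto)
  have "riesz l f x \<le> ennreal (M * R powr - b * (C * R powr (n - l)) + (M * R powr - b * 2 powr b * C * R powr (n - l)) / (1 - c))" for x
  proof -
    have "riesz l f x \<le> (\<integral>\<^sup>+ y. ennreal (M * R powr - b) * (ennreal (norm (x - y) powr - l) * indicator {y. 0 < f y} y)
      + ennreal (f y * norm (x - y) powr - l) * indicator (S 0) y \<partial>lborel)"
      unfolding riesz_def by (intro nn_integral_mono small)
    also have "\<dots> = ennreal (M * R powr - b) * (\<integral>\<^sup>+ y. ennreal (norm (x - y) powr - l) * indicator {y. 0 < f y} y \<partial>lborel)
      + (\<integral>\<^sup>+ y. ennreal (f y * norm (x - y) powr - l) * indicator (S 0) y \<partial>lborel)"
      by (simp add: nn_integral_add nn_integral_cmult)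
    also have "\<dots> \<le> ennreal (M * R powr - b) * ennreal (C * R powr (n - l))
      + ennreal ((M * R powr - b * 2 powr b * C * R powr (n - l)) / (1 - c))"
      using R supp by (intro add_mono large mult_left_mono CE) auto
    also have "\<dots> = ennreal (M * R powr - b * (C * R powr (n - l)) + (M * R powr - b * 2 powr b * C * R powr (n - l)) / (1 - c))"
      using M C c by (subst ennreal_mult[symmetric], simp, simp, intro ennreal_plus[symmetric]) auto
    finally show ?thesis .
  qed
  then show ?thesis by blast
qed

text \<open>Outside \<open>B(x, r)\<close> the kernels centred at \<open>x\<close> and at any point of \<open>B(x, r/2)\<close> are comparable, so the far part
  of the potential at \<open>x\<close> is controlled by an average of \<open>u\<close> itself.\<close>

lemma riesz_far:
  fixes f u :: "'a::euclidean_space \<Rightarrow> real"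
  assumes l: "0 < l" and a: "0 < a" and [measurable]: "f \<in> borel_measurable borel" "u \<in> borel_measurable borel"
    and f0: "\<And>y. 0 \<le> f y" and u0: "\<And>y. 0 \<le> u y" and u: "\<And>x. ennreal (u x) = riesz l f x" and r: "0 < r" and e: "0 \<le> e"
    and Lp: "(\<integral>\<^sup>+ y. ennreal (u y powr (real DIM('a) / a)) * indicator (ball x (r / 2)) y \<partial>lborel) \<le> ennreal (e powr (real DIM('a) / a))"
  shows "riesz l (\<lambda>y. f y * indicator (- ball x r) y) x
    \<le> ennreal ((3 / 2) powr l * unit_ball_vol (real DIM('a)) powr - (a / real DIM('a)) * 2 powr a * e * r powr - a)"
proof -
  define n where "n = real DIM('a)"
  have n: "n > 0" by (simp add: n_def)
  define w where "w = unit_ball_vol n"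
  have w: "w > 0" using n by (simp add: w_def)
  \<comment> \<open>Finiteness comes from \<open>u x\<close> being a real number; it allows the far
    part to be written as a real \<open>j\<close>.\<close>
  have "riesz l (\<lambda>y. f y * indicator (- ball x r) y) x \<le> riesz l f x"
    using f0 by (intro riesz_mono) (auto simp: indicator_def)
  also have "\<dots> < \<infinity>" unfolding u[symmetric] by simp
  finally obtain j where j: "riesz l (\<lambda>y. f y * indicator (- ball x r) y) x = ennreal j" "0 \<le> j"
    by (cases "riesz l (\<lambda>y. f y * indicator (- ball x r) y) x") auto
  \<comment> \<open>\<open>k\<close> is a lower bound of \<open>u\<close> on
    \<open>ball x (r / 2)\<close>: for |x - y| >= r and |x - z| < r/2 one has |z - y| <= (3/2) |x -
    y|. The norm of \<open>u\<close> on that ball then bounds \<open>k\<close> by Chebyshev's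
    argument.\<close>
  define k where "k = (3 / 2) powr - l * j"
  have k0: "0 \<le> k" using j by (simp add: k_def)
  have ku: "k \<le> u z" if z: "z \<in> ball x (r / 2)" for z
  proof -
    have "ennreal k = ennreal ((3 / 2) powr - l) * riesz l (\<lambda>y. f y * indicator (- ball x r) y) x"
      using j by (simp add: k_def ennreal_mult)
    also have "\<dots> = (\<integral>\<^sup>+ y. ennreal ((3 / 2) powr - l) * ennreal (f y * indicator (- ball x r) y * norm (x - y) powr - l) \<partial>lborel)"
      unfolding riesz_def by (rule nn_integral_cmult[symmetric]) auto
    also have "\<dots> \<le> riesz l f z"
      unfolding riesz_def
    proof (intro nn_integral_mono)
      fix y
      show "ennreal ((3 / 2) powr - l) * ennreal (f y * indicator (- ball x r) y * norm (x - y) powr - l)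
        \<le> ennreal (f y * norm (z - y) powr - l)"
      proof (cases "y \<in> ball x r")
        case False
        then have ry: "r \<le> norm (x - y)" by (simp add: dist_norm)
        have xz: "norm (x - z) < r / 2" using z by (simp add: dist_norm)
        have "norm (z - y) \<le> norm (x - y) + norm (x - z)"
          using norm_triangle_ineq[of "x - y" "z - x"] by (simp add: norm_minus_commute)
        then have 1: "norm (z - y) \<le> 3 / 2 * norm (x - y)" using ry xz by linarith
        have "norm (x - y) \<le> norm (z - y) + norm (x - z)"
          using norm_triangle_ineq[of "z - y" "x - z"] by simp
        then have 2: "0 < norm (z - y)" using ry xz r by linarith
        have "(3 / 2) powr - l * norm (x - y) powr - l = (3 / 2 * norm (x - y)) powr - l"
          by (simp only: powr_mult)
        also have "\<dots> \<le> norm (z - y) powr - l"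
          using 1 2 l by (intro powr_mono2') auto
        finally have "f y * ((3 / 2) powr - l * norm (x - y) powr - l) \<le> f y * norm (z - y) powr - l"
          using f0 by (intro mult_left_mono) auto
        then show ?thesis using False f0 by (simp add: ennreal_mult[symmetric] ennreal_leI mult_ac)
      qed auto
    qed
    finally have "ennreal k \<le> ennreal (u z)" by (simp only: u)
    then show ?thesis using u0[of z] by (simp add: ennreal_le_iff)
  qed
  have "ennreal (k powr (n / a) * (w * (r / 2) ^ DIM('a))) = (\<integral>\<^sup>+ y. ennreal (k powr (n / a)) * indicator (ball x (r / 2)) y \<partial>lborel)"
    using r w by (simp add: nn_integral_cmult_indicator emeasure_ball ennreal_mult w_def n_def)
  also have "\<dots> \<le> (\<integral>\<^sup>+ y. ennreal (u y powr (n / a)) * indicator (ball x (r / 2)) y \<partial>lborel)"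
  proof (intro nn_integral_mono)
    fix y
    show "ennreal (k powr (n / a)) * indicator (ball x (r / 2)) y \<le> ennreal (u y powr (n / a)) * indicator (ball x (r / 2)) y"
      using ku[of y] k0 n a by (auto simp: indicator_def intro!: ennreal_leI powr_mono2)
  qed
  also have "\<dots> \<le> ennreal (e powr (n / a))" using Lp by (simp add: n_def)
  finally have "k powr (n / a) * (w * (r / 2) ^ DIM('a)) \<le> e powr (n / a)"
    by (subst (asm) ennreal_le_iff) auto
  then have "(k powr (n / a) * (w * (r / 2) ^ DIM('a))) powr (a / n) \<le> (e powr (n / a)) powr (a / n)"
    using k0 w r n a by (intro powr_mono2) auto
  also have "(e powr (n / a)) powr (a / n) = e" using n a e by (simp add: powr_powr)
  also have "(k powr (n / a) * (w * (r / 2) ^ DIM('a))) powr (a / n) = k * (w powr (a / n) * (r / 2) powr a)"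
  proof -
    have "((r / 2) ^ DIM('a)) powr (a / n) = (r / 2) powr a"
      using r n by (simp add: powr_realpow[symmetric] powr_powr n_def)
    then show ?thesis using k0 w r n a by (simp add: powr_mult powr_powr)
  qed
  finally have kk: "k * (w powr (a / n) * (r / 2) powr a) \<le> e" .
  have "k = k * (w powr (a / n) * (r / 2) powr a) * (w powr - (a / n) * (r / 2) powr - a)"
    using w r by (simp add: powr_minus field_simps)
  also have "\<dots> \<le> e * (w powr - (a / n) * (r / 2) powr - a)"
    using kk w r by (intro mult_right_mono) auto
  also have "(r / 2) powr - a = 2 powr a * r powr - a"
    using half_powr[of r "- a"] r by simp
  finally have kle: "k \<le> e * (w powr - (a / n) * (2 powr a * r powr - a))" .
  have "j = (3 / 2) powr l * k" by (simp add: k_def powr_minus)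
  also have "\<dots> \<le> (3 / 2) powr l * (e * (w powr - (a / n) * (2 powr a * r powr - a)))"
    using kle by (intro mult_left_mono) auto
  finally show ?thesis unfolding j(1) w_def n_def by (intro ennreal_leI) (simp add: mult_ac)
qed

text \<open>The singularities at \<open>x\<close> and at the origin may be close or even coincide.
  At each point the product is at most the power -(s + l) of the distance to the nearer one, so the
  bound is uniform in \<open>x\<close>.\<close>

lemma riesz_near_bounded:
  assumes l: "0 < l" and s: "0 \<le> s" "s + l < real DIM('a::euclidean_space)"
  shows "\<exists>C. \<forall>x::'a. riesz l (\<lambda>y. norm y powr - s * indicator (ball x 1) y) x \<le> ennreal C"
proof -
  have "0 \<le> s + l" using l s by simp
  from nn_integral_norm_powr_ball[OF this s(2)]
  obtain C where C: "C > 0" "\<And>x::'a. (\<integral>\<^sup>+ y. ennreal (norm (x - y) powr - (s + l)) * indicator (ball x 1) y \<partial>lborel) \<le> ennreal C"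
    by (metis mult.right_neutral powr_one_eq_one zero_less_one)
  have "riesz l (\<lambda>y. norm y powr - s * indicator (ball x 1) y) x \<le> ennreal (C + C)" for x :: 'a
  proof -
    have "riesz l (\<lambda>y. norm y powr - s * indicator (ball x 1) y) x
      \<le> (\<integral>\<^sup>+ y. ennreal (norm (x - y) powr - (s + l)) * indicator (ball x 1) y
          + ennreal (norm (0 - y) powr - (s + l)) * indicator (ball 0 1) y \<partial>lborel)"
      unfolding riesz_def
    proof (intro nn_integral_mono)
      fix y :: 'a
      \<comment> \<open>At \<open>y = 0\<close> and \<open>y = x\<close> the left side is 0, since
        \<open>0 powr\<close> any exponent is 0, even for s = 0.\<close>
      consider "y \<notin> ball x 1 \<or> y = 0 \<or> y = x" | "norm (x - y) \<le> norm y" "y \<in> ball x 1" "y \<noteq> x" | "norm y < norm (x - y)" "y \<in> ball x 1" "y \<noteq> 0"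
        by force
      then show "ennreal (norm y powr - s * indicator (ball x 1) y * norm (x - y) powr - l)
        \<le> ennreal (norm (x - y) powr - (s + l)) * indicator (ball x 1) y
          + ennreal (norm (0 - y) powr - (s + l)) * indicator (ball 0 1) y"
      proof cases
        case 2
        have "norm y powr - s * norm (x - y) powr - l \<le> norm (x - y) powr - s * norm (x - y) powr - l"
          using 2 s by (intro mult_right_mono powr_mono2') auto
        also have "\<dots> = norm (x - y) powr - (s + l)" by (simp add: powr_add[symmetric])
        finally have "ennreal (norm y powr - s * norm (x - y) powr - l) \<le> ennreal (norm (x - y) powr - (s + l))"
          by (rule ennreal_leI)
        then show ?thesis using 2 by (simp add: add_increasing2)
      next
        case 3
        have "norm y powr - s * norm (x - y) powr - l \<le> norm y powr - s * norm y powr - l"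
          using 3 l by (intro mult_left_mono powr_mono2') auto
        also have "\<dots> = norm (0 - y) powr - (s + l)" by (simp add: powr_add[symmetric])
        finally have *: "ennreal (norm y powr - s * norm (x - y) powr - l) \<le> ennreal (norm (0 - y) powr - (s + l))"
          by (rule ennreal_leI)
        have "y \<in> ball 0 1" using 3 by (simp add: dist_norm)
        then show ?thesis using 3 * by (simp add: add_increasing)
      qed auto
    qed
    also have "\<dots> = (\<integral>\<^sup>+ y. ennreal (norm (x - y) powr - (s + l)) * indicator (ball x 1) y \<partial>lborel)
        + (\<integral>\<^sup>+ (y::'a). ennreal (norm (0 - y) powr - (s + l)) * indicator (ball 0 1) y \<partial>lborel)"
      by (rule nn_integral_add) measurable
    also have "\<dots> \<le> ennreal C + ennreal C" by (intro add_mono C)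
    also have "\<dots> = ennreal (C + C)" using C(1) by (intro ennreal_plus[symmetric]) auto
    finally show ?thesis .
  qed
  then show ?thesis by blast
qed

text \<open>Dividing the radius by 3 divides the volume by 3^n >= 3, so three superlevel sets at
  radius \<open>r / 3\<close> fit into the volume r^n.\<close>

lemma emeasure_three_le:
  fixes r :: real
  assumes "S \<subseteq> S1 \<union> S2 \<union> S3" "0 < r" "S1 \<in> sets lborel" "S2 \<in> sets lborel" "S3 \<in> sets lborel"
    and "emeasure lborel (S1 :: 'a::euclidean_space set) \<le> ennreal ((r / 3) ^ DIM('a))"
    "emeasure lborel S2 \<le> ennreal ((r / 3) ^ DIM('a))" "emeasure lborel S3 \<le> ennreal ((r / 3) ^ DIM('a))"
  shows "emeasure lborel S \<le> ennreal (r ^ DIM('a))"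
proof -
  have "emeasure lborel S \<le> emeasure lborel (S1 \<union> S2 \<union> S3)"
    using assms by (intro emeasure_mono) auto
  also have "\<dots> \<le> emeasure lborel (S1 \<union> S2) + emeasure lborel S3"
    using assms by (intro emeasure_subadditive) auto
  also have "\<dots> \<le> (emeasure lborel S1 + emeasure lborel S2) + emeasure lborel S3"
    using assms by (intro add_mono emeasure_subadditive) auto
  also have "\<dots> \<le> ennreal ((r / 3) ^ DIM('a)) + ennreal ((r / 3) ^ DIM('a)) + ennreal ((r / 3) ^ DIM('a))"
    by (intro add_mono assms)
  also have "\<dots> = ennreal (3 * (r / 3) ^ DIM('a))"
    using assms by (simp add: ennreal_plus[symmetric] del: ennreal_plus)
  also have "\<dots> \<le> ennreal (r ^ DIM('a))"
  proof (rule ennreal_leI)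
    have "(3::real) ^ 1 \<le> 3 ^ DIM('a)" by (intro power_increasing) (auto simp: Suc_leI)
    then show "3 * (r / 3) ^ DIM('a) \<le> r ^ DIM('a)"
      using assms(2) by (simp add: power_divide field_simps)
  qed
  finally show ?thesis .
qed

text \<open>\<open>\<kappa>\<close> is the radius of the ball of unit volume, so
  \<open>ball 0 (\<kappa> * r)\<close> has volume r^n, and outside it the weight does not exceed its
  value on the boundary.\<close>

lemma norm_powr_weak:
  fixes r s :: real
  assumes "0 \<le> s" "0 < r"
  defines "\<kappa> \<equiv> unit_ball_vol (real DIM('a::euclidean_space)) powr - (1 / real DIM('a))"
  shows "emeasure lborel {y::'a. (\<kappa> * r) powr - s < norm y powr - s} \<le> ennreal (r ^ DIM('a))"
proof -
  define w where "w = unit_ball_vol (real DIM('a))"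
  have w: "w > 0" by (simp add: w_def)
  then have \<kappa>: "\<kappa> > 0" unfolding \<kappa>_def w_def[symmetric] by simp
  have "\<kappa> ^ DIM('a) = w powr - 1"
    using \<kappa> unfolding powr_realpow[OF \<kappa>, symmetric] by (simp add: \<kappa>_def powr_powr w_def)
  then have \<kappa>w: "w * \<kappa> ^ DIM('a) = 1" using w by (simp add: powr_minus)
  have "{y::'a. (\<kappa> * r) powr - s < norm y powr - s} \<subseteq> ball 0 (\<kappa> * r)"
  proof (rule subsetI, rule ccontr)
    fix y :: 'a assume y: "y \<in> {y. (\<kappa> * r) powr - s < norm y powr - s}" "y \<notin> ball 0 (\<kappa> * r)"
    then have "norm y powr - s \<le> (\<kappa> * r) powr - s"
      using assms(1,2) \<kappa> by (intro powr_mono2') auto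
    with y show False by auto
  qed
  then have "emeasure lborel {y::'a. (\<kappa> * r) powr - s < norm y powr - s} \<le> emeasure lborel (ball (0::'a) (\<kappa> * r))"
    by (intro emeasure_mono) auto
  also have "\<dots> = ennreal (w * \<kappa> ^ DIM('a) * r ^ DIM('a))"
    using assms(2) \<kappa> by (simp add: emeasure_ball w_def power_mult_distrib mult_ac)
  finally show ?thesis by (simp add: \<kappa>w)
qed

text \<open>The nonlinearity is linearised here: in w^q = w^(q - 1) w the first factor gets the
  critical bound with its small constant \<open>e\<close>, the second the barrier. With E = s + (q -
  1) b the source has a profile between the powers -(E + g) and -(E + b), and \<open>lo\<close>,
  \<open>hi\<close> are the conditions of \<open>riesz_weak_type\<close> for these
  exponents.\<close>

lemma riesz_weak_step:
  assumes l: "0 < l" "l < real DIM('a::euclidean_space)"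
    and s: "0 \<le> s" and q: "1 < q" and g: "0 < g" "g \<le> b"
    and lo: "real DIM('a) - l < s + (q - 1) * b + g" and hi: "s + (q - 1) * b + b < real DIM('a)"
  shows "\<exists>C>0. \<forall>(w::'a \<Rightarrow> real) e S c. w \<in> borel_measurable borel \<longrightarrow> (\<forall>x. 0 \<le> w x) \<longrightarrow> 0 < e \<longrightarrow> 0 < S \<longrightarrow> 0 < c \<longrightarrow>
     (\<forall>r>0. superlevel_le w (e * r powr - b) r) \<longrightarrow>
     (\<forall>r>0. superlevel_le w (S * (r powr - g + c * r powr - b)) r) \<longrightarrow>
     (\<forall>r>0. superlevel_le (riesz l (\<lambda>y. w y powr q * norm y powr - s))
         (ennreal (C * e powr (q - 1) * S * (r powr (real DIM('a) - l - s - (q - 1) * b) * (r powr - g + c * r powr - b)))) r)"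
proof -
  define n where "n = real DIM('a)"
  define E where "E = s + (q - 1) * b"
  have lo': "real DIM('a) - l < E + g" and hi': "E + b < real DIM('a)" using lo hi by (auto simp: E_def)
  obtain C where C: "C > 0" and W_raw: "\<forall>(f::'a \<Rightarrow> real) \<psi>. f \<in> borel_measurable borel \<longrightarrow> (\<forall>x. 0 \<le> f x) \<longrightarrow>
     (\<forall>r>0. 0 < \<psi> r) \<longrightarrow> (\<forall>r>0. \<forall>k. \<psi> (2 ^ k * r) \<le> (2 powr - (E + g)) ^ k * \<psi> r) \<longrightarrow>
     (\<forall>r>0. \<forall>k. \<psi> (r / 2 ^ k) \<le> (2 powr (E + b)) ^ k * \<psi> r) \<longrightarrow>
     (\<forall>r>0. superlevel_le f (\<psi> r) r) \<longrightarrow>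
     (\<forall>r>0. superlevel_le (riesz l f) (ennreal (C * \<psi> r * r powr (real DIM('a) - l))) r)"
    using riesz_weak_type[OF l lo' hi'] by (elim exE conjE) (rule that)
  note W = W_raw[rule_format, folded n_def]
  define \<kappa> where "\<kappa> = unit_ball_vol (real DIM('a)) powr - (1 / real DIM('a))"
  have \<kappa>: "\<kappa> > 0"
    unfolding \<kappa>_def powr_gt_zero using unit_ball_vol_pos[OF of_nat_0_le_iff, of "DIM('a)"] by linarith
  define K where "K = C * \<kappa> powr - s * 3 powr (E + b)"
  have K: "K > 0" using C \<kappa> by (simp add: K_def)
  show ?thesis
  proof (intro exI[of _ K] conjI allI impI K)
    fix w :: "'a \<Rightarrow> real" and e S c r :: real
    assume [measurable]: "w \<in> borel_measurable borel" and w0: "\<forall>x. 0 \<le> w x" and e: "0 < e" and S: "0 < S" and c: "0 < c"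
      and w1: "\<forall>r>0. superlevel_le w (e * r powr - b) r"
      and w2: "\<forall>r>0. superlevel_le w (S * (r powr - g + c * r powr - b)) r"
      and r: "0 < r"
    define \<phi> where "\<phi> r = r powr - g + c * r powr - b" for r :: real
    \<comment> \<open>Evaluated at \<open>r / 3\<close>, because exceeding \<psi> forces the
      critical bound, the barrier or the weight to be exceeded at that radius, and
      \<open>emeasure_three_le\<close> adds up the three sets.\<close>
    define \<psi> where "\<psi> r = (\<kappa> powr - s * e powr (q - 1) * S) * ((r / 3) powr - E * \<phi> (r / 3))" for r
    have \<phi>0: "0 < \<phi> r" if "0 < r" for r using that c by (simp add: \<phi>_def add_pos_pos)
    have \<phi>up: "\<phi> (2 ^ k * r) \<le> (2 powr - g) ^ k * \<phi> r" if "0 < r" for r k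
    proof -
      have "(2 powr - b) ^ k \<le> (2 powr - g) ^ k" using g by (intro power_mono powr_mono) auto
      then have "c * ((2 powr - b) ^ k * r powr - b) \<le> c * ((2 powr - g) ^ k * r powr - b)"
        using c by (intro mult_left_mono mult_right_mono) auto
      then show ?thesis using that unfolding \<phi>_def by (simp add: powr_mult two_pow_powr distrib_left mult_ac)
    qed
    have \<phi>dn: "\<phi> (r / 2 ^ k) \<le> (2 powr b) ^ k * \<phi> r" if "0 < r" for r k
    proof -
      have "(2 powr g) ^ k \<le> (2 powr b) ^ k" using g by (intro power_mono powr_mono) auto
      then have "(2 powr g) ^ k * r powr - g \<le> (2 powr b) ^ k * r powr - g"
        by (intro mult_right_mono) auto
      then show ?thesis using that unfolding \<phi>_def by (simp add: divide_two_pow_powr distrib_left mult_ac)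
    qed
    have \<phi>3: "\<phi> (r / 3) \<le> 3 powr b * \<phi> r" if "0 < r" for r
    proof -
      have d: "(r / 3) powr - x = 3 powr x * r powr - x" for x
        using that by (simp add: powr_divide powr_minus field_simps)
      have "3 powr g * r powr - g \<le> 3 powr b * r powr - g"
        using g by (intro mult_right_mono powr_mono) auto
      then show ?thesis using that unfolding \<phi>_def by (simp add: d distrib_left mult_ac)
    qed
    define Q where "Q = \<kappa> powr - s * e powr (q - 1) * S"
    have Q: "Q > 0" using \<kappa> e S by (simp add: Q_def)
    have \<psi>0: "0 < \<psi> r" if "0 < r" for r using Q \<phi>0[of "r / 3"] that unfolding \<psi>_def Q_def[symmetric] by simp
    have \<psi>1: "\<psi> (2 ^ k * r) \<le> (2 powr - (E + g)) ^ k * \<psi> r" if "0 < r" for r k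
    proof -
      have "\<psi> (2 ^ k * r) = Q * ((2 powr - E) ^ k * (r / 3) powr - E * \<phi> (2 ^ k * (r / 3)))"
        using that unfolding \<psi>_def Q_def[symmetric] by (simp add: powr_mult two_pow_powr powr_divide)
      also have "\<dots> \<le> Q * ((2 powr - E) ^ k * (r / 3) powr - E * ((2 powr - g) ^ k * \<phi> (r / 3)))"
        using that Q by (intro mult_left_mono \<phi>up) auto
      also have "\<dots> = ((2 powr - E) ^ k * (2 powr - g) ^ k) * \<psi> r"
        unfolding \<psi>_def Q_def[symmetric] by simp
      also have "(2 powr - E) ^ k * (2 powr - g) ^ k = (2 powr - (E + g)) ^ k"
        unfolding power_mult_distrib[symmetric] powr_add[symmetric] by simp
      finally show ?thesis .
    qed
    have \<psi>2: "\<psi> (r / 2 ^ k) \<le> (2 powr (E + b)) ^ k * \<psi> r" if "0 < r" for r k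
    proof -
      have "r / 2 ^ k / 3 = r / 3 / 2 ^ k" by simp
      then have "\<psi> (r / 2 ^ k) = Q * ((r / 3 / 2 ^ k) powr - E * \<phi> (r / 3 / 2 ^ k))"
        unfolding \<psi>_def Q_def[symmetric] by (simp only:)
      also have "(r / 3 / 2 ^ k) powr - E = (r / 3) powr - E * (2 powr E) ^ k"
        using divide_two_pow_powr[of "r / 3" k "- E"] that by simp
      also have "Q * ((r / 3) powr - E * (2 powr E) ^ k * \<phi> (r / 3 / 2 ^ k))
         \<le> Q * ((r / 3) powr - E * (2 powr E) ^ k * ((2 powr b) ^ k * \<phi> (r / 3)))"
        using that Q by (intro mult_left_mono \<phi>dn) auto
      also have "\<dots> = ((2 powr E) ^ k * (2 powr b) ^ k) * \<psi> r"
        unfolding \<psi>_def Q_def[symmetric] by simp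
      also have "(2 powr E) ^ k * (2 powr b) ^ k = (2 powr (E + b)) ^ k"
        unfolding power_mult_distrib[symmetric] powr_add[symmetric] by simp
      finally show ?thesis .
    qed
    have meas: "emeasure lborel {x. \<psi> r < w x powr q * norm x powr - s} \<le> ennreal (r ^ DIM('a))" if r: "0 < r" for r
    proof (rule emeasure_three_le[where r=r])
      show "{x. \<psi> r < w x powr q * norm x powr - s} \<subseteq> {x. e * (r / 3) powr - b < w x}
         \<union> {x. S * \<phi> (r / 3) < w x} \<union> {x. (\<kappa> * (r / 3)) powr - s < norm x powr - s}"
      proof (rule subsetI, rule ccontr)
        fix x assume x: "x \<in> {x. \<psi> r < w x powr q * norm x powr - s}"
          and "x \<notin> {x. e * (r / 3) powr - b < w x}
         \<union> {x. S * \<phi> (r / 3) < w x} \<union> {x. (\<kappa> * (r / 3)) powr - s < norm x powr - s}"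
        then have x1: "w x \<le> e * (r / 3) powr - b" and x2: "w x \<le> S * \<phi> (r / 3)"
          and x3: "norm x powr - s \<le> (\<kappa> * (r / 3)) powr - s" by auto
        have "w x powr q = w x powr (q - 1) * w x"
          using w0[rule_format, of x] powr_add[of "w x" "q - 1" 1] by (cases "w x = 0") auto
        also have "\<dots> \<le> (e * (r / 3) powr - b) powr (q - 1) * (S * \<phi> (r / 3))"
          using x1 x2 w0 q by (intro mult_mono powr_mono2) auto
        finally have "w x powr q * norm x powr - s \<le> (e * (r / 3) powr - b) powr (q - 1) * (S * \<phi> (r / 3)) * (\<kappa> * (r / 3)) powr - s"
          using x3 S less_imp_le[OF \<phi>0[of "r / 3"]] r by (intro mult_mono) auto
        also have "\<dots> = Q * ((r / 3) powr - s * (r / 3) powr (- b * (q - 1)) * \<phi> (r / 3))"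
          by (simp only: powr_mult powr_powr Q_def mult_ac)
        also have "(r / 3) powr - s * (r / 3) powr (- b * (q - 1)) = (r / 3) powr - E"
          unfolding powr_add[symmetric] by (simp add: E_def algebra_simps)
        finally show False using x by (simp add: \<psi>_def Q_def)
      qed
      show "superlevel_le w (S * \<phi> (r / 3)) (r / 3)"
        using w2 r by (simp add: \<phi>_def)
      show "superlevel_le w (e * (r / 3) powr - b) (r / 3)"
        using w1 r by simp
      show "emeasure lborel {x::'a. (\<kappa> * (r / 3)) powr - s < norm x powr - s} \<le> ennreal ((r / 3) ^ DIM('a))"
        unfolding \<kappa>_def using s r by (intro norm_powr_weak) auto
      show "{x. e * (r / 3) powr - b < w x} \<in> sets lborel" by measurable
      show "{x. S * \<phi> (r / 3) < w x} \<in> sets lborel" by measurable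
      show "{x::'a. (\<kappa> * (r / 3)) powr - s < norm x powr - s} \<in> sets lborel" by measurable
    qed (rule r)
    have "emeasure lborel {x. ennreal (K * e powr (q - 1) * S * (r powr (n - l - E) * \<phi> r))
         < riesz l (\<lambda>y. w y powr q * norm y powr - s) x}
       \<le> emeasure lborel {x. ennreal (C * \<psi> r * r powr (n - l)) < riesz l (\<lambda>y. w y powr q * norm y powr - s) x}"
    proof (intro emeasure_mono subsetI)
      have "C * \<psi> r * r powr (n - l) = C * Q * (3 powr E * r powr - E * \<phi> (r / 3)) * r powr (n - l)"
        using r unfolding \<psi>_def Q_def[symmetric] by (simp add: powr_divide powr_minus field_simps)
      also have "\<dots> \<le> C * Q * (3 powr E * r powr - E * (3 powr b * \<phi> r)) * r powr (n - l)"
        using C Q r by (intro mult_right_mono mult_left_mono \<phi>3) auto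
      also have "\<dots> = C * Q * (3 powr E * 3 powr b) * \<phi> r * (r powr - E * r powr (n - l))"
        by (simp add: mult_ac)
      also have "\<dots> = K * e powr (q - 1) * S * (r powr (n - l - E) * \<phi> r)"
        unfolding powr_add[symmetric] K_def Q_def by (simp add: mult_ac)
      finally have le: "C * \<psi> r * r powr (n - l) \<le> K * e powr (q - 1) * S * (r powr (n - l - E) * \<phi> r)" .
      fix x assume "x \<in> {x. ennreal (K * e powr (q - 1) * S * (r powr (n - l - E) * \<phi> r))
         < riesz l (\<lambda>y. w y powr q * norm y powr - s) x}"
      then show "x \<in> {x. ennreal (C * \<psi> r * r powr (n - l)) < riesz l (\<lambda>y. w y powr q * norm y powr - s) x}"
        using ennreal_leI[OF le] by auto
    qed measurable
    also have "\<dots> \<le> ennreal (r ^ DIM('a))"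
      using w0 \<psi>0 \<psi>1 \<psi>2 meas r by (intro W) auto
    finally show "superlevel_le (riesz l (\<lambda>y. w y powr q * norm y powr - s))
         (ennreal (K * e powr (q - 1) * S * (r powr (real DIM('a) - l - s - (q - 1) * b) * (r powr - g + c * r powr - b)))) r"
      by (simp add: \<phi>_def n_def E_def diff_diff_eq add.assoc)
  qed
qed

section \<open>Local boundedness\<close>

text \<open>Continuity of the integral along a decreasing sequence of sets; it supplies the
  smallness both for high levels and for the exterior of large balls.\<close>

lemma nn_integral_decseq_small:
  fixes E :: "nat \<Rightarrow> 'a::euclidean_space set"
  assumes [measurable]: "g \<in> borel_measurable borel" "\<And>k. E k \<in> sets borel"
    and E: "decseq E" "(\<Inter>k. E k) = {}" and g: "(\<integral>\<^sup>+ x. g x \<partial>lborel) < \<infinity>" and e: "(0::ennreal) < e"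
  shows "\<exists>k. (\<integral>\<^sup>+ x. g x * indicator (E k) x \<partial>lborel) < e"
proof -
  have "(\<integral>\<^sup>+ x. (INF k. g x * indicator (E k) x) \<partial>lborel) = (INF k. \<integral>\<^sup>+ x. g x * indicator (E k) x \<partial>lborel)"
  proof (rule nn_integral_monotone_convergence_INF_decseq)
    show "decseq (\<lambda>k x. g x * indicator (E k) x)"
      using E(1)[THEN antimonoD] by (intro antimonoI le_funI) (fastforce simp: indicator_def)
    have "(\<integral>\<^sup>+ x. g x * indicator (E 0) x \<partial>lborel) \<le> (\<integral>\<^sup>+ x. g x \<partial>lborel)"
      by (intro nn_integral_mono) (auto simp: indicator_def)
    then show "(\<integral>\<^sup>+ x. g x * indicator (E 0) x \<partial>lborel) < \<infinity>" using g by simp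
  qed auto
  also have "(\<integral>\<^sup>+ x. (INF k. g x * indicator (E k) x) \<partial>lborel) = (\<integral>\<^sup>+ (x::'a). 0 \<partial>lborel)"
  proof (intro nn_integral_cong)
    fix x
    obtain k where "x \<notin> E k" using E(2) by blast
    then have "(INF k. g x * indicator (E k) x) \<le> 0" by (intro INF_lower2[of k]) auto
    then show "(INF k. g x * indicator (E k) x) = 0" by simp
  qed
  finally have "(INF k. \<integral>\<^sup>+ x. g x * indicator (E k) x \<partial>lborel) < e" using e by simp
  then show ?thesis by (simp add: INF_less_iff)
qed

text \<open>Chebyshev's inequality; for the exponent n / b the level belonging to volume r^n is
  exactly the critical power r^-b.\<close>

lemma weak_le_of_Lp:
  fixes w :: "'a::euclidean_space \<Rightarrow> real"
  assumes [measurable]: "w \<in> borel_measurable borel" and b: "0 < b" and e: "0 < e" and r: "0 < r"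
    and Lp: "(\<integral>\<^sup>+ x. ennreal (w x powr (real DIM('a) / b)) \<partial>lborel) \<le> ennreal (e powr (real DIM('a) / b))"
  shows "superlevel_le w (e * r powr - b) r"
proof -
  define n where "n = real DIM('a)"
  have n: "n > 0" by (simp add: n_def)
  define K where "K = (e * r powr - b) powr (n / b)"
  have K: "K > 0" using e r by (simp add: K_def)
  have Ke: "K * r ^ DIM('a) = e powr (n / b)"
  proof -
    have "K = e powr (n / b) * r powr - n"
      using e r b by (simp add: K_def powr_mult powr_powr)
    then show ?thesis using r by (simp add: n_def powr_minus powr_realpow)
  qed
  have "ennreal K * emeasure lborel {x. e * r powr - b < w x}
      = (\<integral>\<^sup>+ x. ennreal K * indicator {x. e * r powr - b < w x} x \<partial>lborel)"
    by (rule nn_integral_cmult_indicator[symmetric]) measurable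
  also have "\<dots> \<le> (\<integral>\<^sup>+ x. ennreal (w x powr (n / b)) \<partial>lborel)"
  proof (intro nn_integral_mono)
    fix x
    show "ennreal K * indicator {x. e * r powr - b < w x} x \<le> ennreal (w x powr (n / b))"
    proof (cases "e * r powr - b < w x")
      case True
      then have "K \<le> w x powr (n / b)"
        unfolding K_def using e r n b by (intro powr_mono2) auto
      then show ?thesis using True by (simp add: ennreal_leI)
    qed auto
  qed
  also have "\<dots> \<le> ennreal K * ennreal (r ^ DIM('a))"
    using Lp K r by (simp add: ennreal_mult[symmetric] Ke n_def)
  finally show ?thesis using K by (subst (asm) ennreal_mult_le_mult_iff) auto
qed

text \<open>\<open>qb\<close> and \<open>pa\<close> say that t^a u(tx), t^b v(tx) solve the same
  system. The data (u, s1, q, a) and (v, s2, p, b) enter symmetrically, so each lemma about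
  \<open>u\<close> yields one about \<open>v\<close> by \<open>swap\<close>; for that reason the
  ordering b <= a is kept out of the locale.\<close>

locale hardy_sobolev_system =
  fixes u v :: "'a::euclidean_space \<Rightarrow> real" and l s1 s2 p q a b :: real
  assumes l: "0 < l" "l < real DIM('a)"
    and s1: "0 \<le> s1" "s1 < real DIM('a) - l" and s2: "0 \<le> s2" "s2 < real DIM('a) - l"
    and p: "1 < p" and q: "1 < q" and a: "0 < a" and b: "0 < b" and ab: "a + b \<le> l"
    and qb: "q * b = a + (real DIM('a) - l) - s1" and pa: "p * a = b + (real DIM('a) - l) - s2"
    and u_meas [measurable]: "u \<in> borel_measurable borel" and v_meas [measurable]: "v \<in> borel_measurable borel"
    and u_pos: "\<And>x. 0 < u x" and v_pos: "\<And>x. 0 < v x"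
    and u_eq: "\<And>x. ennreal (u x) = riesz l (\<lambda>y. v y powr q * norm y powr - s1) x"
    and v_eq: "\<And>x. ennreal (v x) = riesz l (\<lambda>y. u y powr p * norm y powr - s2) x"
begin

lemma swap: "hardy_sobolev_system v u l s2 s1 q p b a"
  using l s1 s2 p q a b ab qb pa u_meas v_meas u_pos v_pos u_eq v_eq
  by unfold_locales auto

end

locale integrable_hardy_sobolev_system = hardy_sobolev_system u v l s1 s2 p q a b
  for u v :: "'a::euclidean_space \<Rightarrow> real" and l s1 s2 p q a b :: real +
  assumes u_Lp: "(\<integral>\<^sup>+ x. ennreal (u x powr (real DIM('a) / a)) \<partial>lborel) < \<infinity>"
    and v_Lp: "(\<integral>\<^sup>+ x. ennreal (v x powr (real DIM('a) / b)) \<partial>lborel) < \<infinity>"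
begin

lemma integrable_swap: "integrable_hardy_sobolev_system v u l s2 s1 q p b a"
  using swap u_Lp v_Lp
  unfolding integrable_hardy_sobolev_system_def integrable_hardy_sobolev_system_axioms_def by blast

lemma u_Lp_bound:
  obtains N where "0 < N" "(\<integral>\<^sup>+ x. ennreal (u x powr (real DIM('a) / a)) \<partial>lborel) \<le> ennreal (N powr (real DIM('a) / a))"
proof -
  obtain m where m: "(\<integral>\<^sup>+ x. ennreal (u x powr (real DIM('a) / a)) \<partial>lborel) = ennreal m" "0 \<le> m"
    using u_Lp by (cases "\<integral>\<^sup>+ x. ennreal (u x powr (real DIM('a) / a)) \<partial>lborel") auto
  define N where "N = (m + 1) powr (a / real DIM('a))"
  have "N powr (real DIM('a) / a) = m + 1" using a m by (simp add: N_def powr_powr)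
  then show ?thesis using that[of N] m by (auto simp: N_def intro: ennreal_leI)
qed

lemma u_superlevel_small:
  assumes "0 < e"
  shows "\<exists>A0>0. \<forall>A\<ge>A0. (\<integral>\<^sup>+ x. ennreal ((trunc A u x) powr (real DIM('a) / a)) \<partial>lborel) \<le> ennreal e"
proof -
  have "\<exists>k. (\<integral>\<^sup>+ x. ennreal (u x powr (real DIM('a) / a)) * indicator {x. real k < u x} x \<partial>lborel) < ennreal e"
  proof (intro nn_integral_decseq_small u_Lp)
    show "decseq (\<lambda>k. {x. real k < u x})" by (auto simp: decseq_def)
    show "(\<Inter>k. {x. real k < u x}) = {}"
    proof safe
      fix x assume "x \<in> (\<Inter>k. {x. real k < u x})"
      then have "real k < u x" for k by auto
      then show "x \<in> {}" using real_arch_simple[of "u x"] by (meson leD)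
    qed
  qed (use assms in auto)
  then obtain k where k: "(\<integral>\<^sup>+ x. ennreal (u x powr (real DIM('a) / a)) * indicator {x. real k < u x} x \<partial>lborel) < ennreal e" ..
  show ?thesis
  proof (intro exI[of _ "real k + 1"] conjI allI impI)
    fix A assume A: "real k + 1 \<le> A"
    have "(\<integral>\<^sup>+ x. ennreal ((trunc A u x) powr (real DIM('a) / a)) \<partial>lborel)
       \<le> (\<integral>\<^sup>+ x. ennreal (u x powr (real DIM('a) / a)) * indicator {x. real k < u x} x \<partial>lborel)"
      using A by (intro nn_integral_mono) (auto simp: indicator_def)
    then show "(\<integral>\<^sup>+ x. ennreal ((trunc A u x) powr (real DIM('a) / a)) \<partial>lborel) \<le> ennreal e"
      using k by simp
  qed auto
qed

text \<open>The source is cut into three parts: the set where v > A, which is kept; the set where v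
  <= A near \<open>x\<close>, bounded by \<open>riesz_near_bounded\<close>; and the part far from
  \<open>x\<close>, bounded by \<open>riesz_far\<close> with the norm of \<open>u\<close>.\<close>

lemma u_le_truncated:
  assumes A: "0 < A"
  shows "\<exists>C>0. \<forall>x. ennreal (u x) \<le> riesz l (\<lambda>y. (trunc A v y) powr q * norm y powr - s1) x + ennreal C"
proof -
  obtain N where N: "0 < N" "(\<integral>\<^sup>+ x. ennreal (u x powr (real DIM('a) / a)) \<partial>lborel) \<le> ennreal (N powr (real DIM('a) / a))"
    by (rule u_Lp_bound)
  have "s1 + l < real DIM('a)" using s1 by simp
  from riesz_near_bounded[OF l(1) s1(1) this] obtain C1 where
    C1: "\<And>x::'a. riesz l (\<lambda>y. norm y powr - s1 * indicator (ball x 1) y) x \<le> ennreal C1" by blast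
  define C2 where "C2 = (3 / 2) powr l * unit_ball_vol (real DIM('a)) powr - (a / real DIM('a)) * 2 powr a * N * 1 powr - a"
  define f where "f y = v y powr q * norm y powr - s1" for y
  have [measurable]: "f \<in> borel_measurable borel" unfolding f_def by measurable
  have far: "riesz l (\<lambda>y. f y * indicator (- ball x 1) y) x \<le> ennreal C2" for x
    unfolding C2_def
  proof (rule riesz_far[where u = u])
    have "(\<integral>\<^sup>+ y. ennreal (u y powr (real DIM('a) / a)) * indicator (ball x (1 / 2)) y \<partial>lborel)
      \<le> (\<integral>\<^sup>+ y. ennreal (u y powr (real DIM('a) / a)) \<partial>lborel)"
      by (intro nn_integral_mono) (auto simp: indicator_def)
    then show "(\<integral>\<^sup>+ y. ennreal (u y powr (real DIM('a) / a)) * indicator (ball x (1 / 2)) y \<partial>lborel)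
      \<le> ennreal (N powr (real DIM('a) / a))" using N by simp
  qed (use l a N u_pos u_eq in \<open>auto simp: f_def less_imp_le\<close>)
  define F where "F y = (trunc A v y) powr q * norm y powr - s1" for y
  have [measurable]: "F \<in> borel_measurable borel" unfolding F_def by measurable
  have F0: "0 \<le> F y" and f0: "0 \<le> f y" for y by (auto simp: F_def f_def)
  have main: "ennreal (u x) \<le> riesz l F x + ennreal (\<bar>C1\<bar> * A powr q + \<bar>C2\<bar> + 1)" for x
  proof -
    have "ennreal (u x) = riesz l f x" using u_eq[of x] by (simp add: f_def[abs_def])
    also have "\<dots> \<le> riesz l (\<lambda>y. F y + (A powr q * (norm y powr - s1 * indicator (ball x 1) y) + f y * indicator (- ball x 1) y)) x"
    proof (rule riesz_mono)
      fix y
      show "f y \<le> F y + (A powr q * (norm y powr - s1 * indicator (ball x 1) y) + f y * indicator (- ball x 1) y)"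
      proof (cases "A < v y \<or> y \<notin> ball x 1")
        case True
        then show ?thesis by (auto simp: f_def F_def indicator_def)
      next
        case False
        then have "v y powr q \<le> A powr q" using v_pos[of y] q by (intro powr_mono2) auto
        then show ?thesis using False by (simp add: f_def F_def mult_right_mono)
      qed
    qed
    also have "\<dots> = riesz l F x + (ennreal (A powr q) * riesz l (\<lambda>y. norm y powr - s1 * indicator (ball x 1) y) x
        + riesz l (\<lambda>y. f y * indicator (- ball x 1) y) x)"
      using F0 f0 by (subst riesz_add riesz_cmult[symmetric]; (measurable | simp add: F0 f0))+ 
    also have "\<dots> \<le> riesz l F x + (ennreal (A powr q) * ennreal \<bar>C1\<bar> + ennreal \<bar>C2\<bar>)"
      using C1[of x] far[of x] by (intro add_left_mono add_mono mult_left_mono) (auto elim!: order_trans intro: ennreal_leI)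
    also have "ennreal (A powr q) * ennreal \<bar>C1\<bar> + ennreal \<bar>C2\<bar> = ennreal (\<bar>C1\<bar> * A powr q + \<bar>C2\<bar>)"
      by (simp add: ennreal_mult mult.commute)
    also have "riesz l F x + ennreal (\<bar>C1\<bar> * A powr q + \<bar>C2\<bar>) \<le> riesz l F x + ennreal (\<bar>C1\<bar> * A powr q + \<bar>C2\<bar> + 1)"
      by (intro add_left_mono ennreal_leI) simp
    finally show ?thesis .
  qed
  show ?thesis
  proof (intro exI[of _ "\<bar>C1\<bar> * A powr q + \<bar>C2\<bar> + 1"] conjI allI)
    show "0 < \<bar>C1\<bar> * A powr q + \<bar>C2\<bar> + 1" by (intro add_nonneg_pos add_nonneg_nonneg) auto
    show "ennreal (u x) \<le> riesz l (\<lambda>y. (trunc A v y) powr q * norm y powr - s1) x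
      + ennreal (\<bar>C1\<bar> * A powr q + \<bar>C2\<bar> + 1)" for x
      using main[of x] by (simp only: F_def[abs_def])
  qed
qed

lemma u_superlevel_finite:
  assumes A: "0 < A"
  shows "\<exists>R>0. superlevel_le u A R"
proof -
  obtain N where N: "0 < N" "(\<integral>\<^sup>+ x. ennreal (u x powr (real DIM('a) / a)) \<partial>lborel) \<le> ennreal (N powr (real DIM('a) / a))"
    by (rule u_Lp_bound)
  define R where "R = (A / N) powr (- 1 / a)"
  have R: "R > 0" using A N by (simp add: R_def)
  have "N * R powr - a = A" using A N a by (simp add: R_def powr_powr)
  then show ?thesis using weak_le_of_Lp[OF u_meas a N(1) R N(2)] R by auto
qed

text \<open>The order of quantifiers matters: \<open>C\<close> does not depend on \<open>A\<close>,
  only \<open>K\<close> does. The smallness \<open>e\<close> can thus be fixed from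
  \<open>C\<close>, and a level \<open>A\<close> achieving it is chosen afterwards. The barrier
  exponent is shifted by a - b because kernel, weight and critical factors together contribute r^(b
  - a).\<close>

lemma truncated_step:
  assumes g: "0 < g" "g \<le> b" "0 < g + a - b"
  shows "\<exists>C>0. \<forall>A>0. \<exists>K>0. \<forall>e S c. 0 < e \<longrightarrow> 0 < S \<longrightarrow> 0 < c \<longrightarrow>
     (\<forall>r>0. superlevel_le (trunc A v) (e * r powr - b) r) \<longrightarrow>
     (\<forall>r>0. superlevel_le (trunc A v) (S * (r powr - g + c * r powr - b)) r) \<longrightarrow>
     (\<forall>r>0. superlevel_le (trunc A u) ((C * e powr (q - 1) * S + K) * (r powr - (g + a - b) + c * r powr - a)) r)"
proof -
  define n where "n = real DIM('a)"
  \<comment> \<open>In view of \<open>qb\<close> these read 0 < g + a - b and a < l.\<close>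
  have lo: "real DIM('a) - l < s1 + (q - 1) * b + g" and hi: "s1 + (q - 1) * b + b < real DIM('a)"
    using g qb ab b by (auto simp: algebra_simps)
  have ex: "real DIM('a) - l - s1 - (q - 1) * b = b - a" using qb by (simp add: algebra_simps)
  obtain C where C: "C > 0" and W_raw: "\<forall>(w::'a \<Rightarrow> real) e S c. w \<in> borel_measurable borel \<longrightarrow> (\<forall>x. 0 \<le> w x) \<longrightarrow> 0 < e \<longrightarrow> 0 < S \<longrightarrow> 0 < c \<longrightarrow>
     (\<forall>r>0. superlevel_le w (e * r powr - b) r) \<longrightarrow>
     (\<forall>r>0. superlevel_le w (S * (r powr - g + c * r powr - b)) r) \<longrightarrow>
     (\<forall>r>0. superlevel_le (riesz l (\<lambda>y. w y powr q * norm y powr - s1))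
         (ennreal (C * e powr (q - 1) * S * (r powr (real DIM('a) - l - s1 - (q - 1) * b) * (r powr - g + c * r powr - b)))) r)"
    using riesz_weak_step[OF l s1(1) q g(1,2) lo hi] by (elim exE conjE) (rule that)
  note W = W_raw[rule_format, unfolded ex]
  show ?thesis
  proof (intro exI[of _ C] conjI C, intro allI impI)
    fix A :: real assume A: "0 < A"
    obtain CA where CA: "0 < CA" "\<And>x. ennreal (u x) \<le> riesz l (\<lambda>y. (trunc A v y) powr q * norm y powr - s1) x + ennreal CA"
      using u_le_truncated[OF A] by blast
    obtain R where R: "R > 0" "superlevel_le u A R"
      using u_superlevel_finite[OF A] by blast
    \<comment> \<open>The additive constant \<open>CA\<close> is absorbed into the barrier: for r >=
      R the set where u > A is already small enough, and for r < R the first term of the barrier is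
      at least its value at \<open>R\<close>.\<close>
    define K where "K = CA * R powr (g + a - b)"
    have K: "K > 0" using CA R by (simp add: K_def)
    show "\<exists>K>0. \<forall>e S c. 0 < e \<longrightarrow> 0 < S \<longrightarrow> 0 < c \<longrightarrow>
     (\<forall>r>0. superlevel_le (trunc A v) (e * r powr - b) r) \<longrightarrow>
     (\<forall>r>0. superlevel_le (trunc A v) (S * (r powr - g + c * r powr - b)) r) \<longrightarrow>
     (\<forall>r>0. superlevel_le (trunc A u) ((C * e powr (q - 1) * S + K) * (r powr - (g + a - b) + c * r powr - a)) r)"
    proof (intro exI[of _ K] conjI K, intro allI impI)
      fix e S c r :: real
      assume e: "0 < e" and S: "0 < S" and c: "0 < c" and r: "0 < r"
        and v1: "\<forall>r>0. superlevel_le (trunc A v) (e * r powr - b) r"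
        and v2: "\<forall>r>0. superlevel_le (trunc A v) (S * (r powr - g + c * r powr - b)) r"
      define \<phi> where "\<phi> = r powr - (g + a - b) + c * r powr - a"
      have \<phi>: "\<phi> > 0" using r c by (simp add: \<phi>_def add_pos_pos)
      have \<phi>_eq: "r powr (b - a) * (r powr - g + c * r powr - b) = \<phi>"
        unfolding \<phi>_def distrib_left mult.left_commute[of _ c] powr_add[symmetric] by (simp add: algebra_simps)
      define Q where "Q = C * e powr (q - 1) * S"
      have Q: "Q > 0" using C e S by (simp add: Q_def)
      define T where "T = {x. (Q + K) * \<phi> < trunc A u x}"
      have TA: "T \<subseteq> {x. A < u x}"
      proof (rule subsetI, rule ccontr)
        fix x assume "x \<in> T" "x \<notin> {x. A < u x}"
        then have "(Q + K) * \<phi> < 0" by (simp add: T_def)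
        moreover have "0 < (Q + K) * \<phi>" using Q K \<phi> by simp
        ultimately show False by simp
      qed
      have "emeasure lborel T \<le> ennreal (r ^ DIM('a))"
      proof (cases "R \<le> r")
        case True
        have "emeasure lborel T \<le> emeasure lborel {x. A < u x}" by (intro emeasure_mono TA) measurable
        also have "\<dots> \<le> ennreal (R ^ DIM('a))" by (rule R)
        also have "\<dots> \<le> ennreal (r ^ DIM('a))" using True R by (intro ennreal_leI power_mono) auto
        finally show ?thesis .
      next
        case False
        have "R powr - (g + a - b) \<le> r powr - (g + a - b)"
          using False r g by (intro powr_mono2') auto
        then have "K * R powr - (g + a - b) \<le> K * r powr - (g + a - b)" using K by simp
        moreover have "K * R powr - (g + a - b) = CA"
          using R unfolding K_def mult.assoc powr_add[symmetric] by simp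
        moreover have "K * r powr - (g + a - b) \<le> K * \<phi>" using K c by (simp add: \<phi>_def)
        ultimately have CK: "CA \<le> K * \<phi>" by linarith
        have "T \<subseteq> {x. ennreal (Q * \<phi>) < riesz l (\<lambda>y. (trunc A v y) powr q * norm y powr - s1) x}"
        proof
          fix x assume x: "x \<in> T"
          then have "A < u x" using TA by auto
          with x have "(Q + K) * \<phi> < u x" by (simp add: T_def)
          with CK have "Q * \<phi> + CA < u x" by (simp add: algebra_simps)
          then have "ennreal (Q * \<phi>) + ennreal CA < ennreal (u x)"
            using Q \<phi> CA by (simp add: ennreal_plus[symmetric] ennreal_less_iff del: ennreal_plus)
          also have "\<dots> \<le> riesz l (\<lambda>y. (trunc A v y) powr q * norm y powr - s1) x + ennreal CA"
            by (rule CA)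
          finally show "x \<in> {x. ennreal (Q * \<phi>) < riesz l (\<lambda>y. (trunc A v y) powr q * norm y powr - s1) x}"
            by (auto simp: not_less dest: add_right_mono leD intro!: not_le_imp_less)
        qed
        then have "emeasure lborel T \<le> emeasure lborel {x. ennreal (Q * \<phi>) < riesz l (\<lambda>y. (trunc A v y) powr q * norm y powr - s1) x}"
          by (intro emeasure_mono) measurable
        also have "\<dots> \<le> ennreal (r ^ DIM('a))"
          unfolding Q_def \<phi>_eq[symmetric]
          using v1 v2 e S c r v_pos by (intro W) (auto simp: less_imp_le)
        finally show ?thesis .
      qed
      then show "superlevel_le (trunc A u) ((C * e powr (q - 1) * S + K) * (r powr - (g + a - b) + c * r powr - a)) r"
        unfolding T_def \<phi>_def Q_def .
    qed
  qed
qed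

end

section \<open>Bootstrap from critical integrability to boundedness\<close>

context integrable_hardy_sobolev_system
begin

text \<open>Every exponent below \<open>b\<close> is reached at once, since the bound 3K of
  \<open>halving_iteration\<close> is independent of c. The pair (g, g') with g' = g + a - b is
  preserved by one pass through each equation, and b <= a keeps g' positive.\<close>

lemma weak_gain:
  assumes D: "b \<le> a" and g: "0 < g" "g < b"
  shows "\<exists>A>0. \<exists>S>0. \<forall>r>0. superlevel_le (trunc A v) (S * r powr - g) r"
proof -
  interpret sw: integrable_hardy_sobolev_system v u l s2 s1 q p b a by (rule integrable_swap)
  define n where "n = real DIM('a)"
  have n: "n > 0" by (simp add: n_def)
  define g' where "g' = g + a - b"
  have g': "0 < g'" "g' \<le> a" using D g by (auto simp: g'_def)
  have gg: "g' + b - a = g" by (simp add: g'_def)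
  have g1: "g \<le> b" "0 < g + a - b" "0 < g' + b - a" using g D by (auto simp: g'_def)
  obtain C1 where C1: "C1 > 0" and T1: "\<forall>A>0. \<exists>K>0. \<forall>e S c. 0 < e \<longrightarrow> 0 < S \<longrightarrow> 0 < c \<longrightarrow>
     (\<forall>r>0. superlevel_le (trunc A v) (e * r powr - b) r) \<longrightarrow>
     (\<forall>r>0. superlevel_le (trunc A v) (S * (r powr - g + c * r powr - b)) r) \<longrightarrow>
     (\<forall>r>0. superlevel_le (trunc A u) ((C1 * e powr (q - 1) * S + K) * (r powr - (g + a - b) + c * r powr - a)) r)"
    using truncated_step[OF g(1) g1(1,2)] by (elim exE conjE) (rule that)
  obtain C2 where C2: "C2 > 0" and T2: "\<forall>A>0. \<exists>K>0. \<forall>e S c. 0 < e \<longrightarrow> 0 < S \<longrightarrow> 0 < c \<longrightarrow>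
     (\<forall>r>0. superlevel_le (trunc A u) (e * r powr - a) r) \<longrightarrow>
     (\<forall>r>0. superlevel_le (trunc A u) (S * (r powr - g' + c * r powr - a)) r) \<longrightarrow>
     (\<forall>r>0. superlevel_le (trunc A v) ((C2 * e powr (p - 1) * S + K) * (r powr - (g' + b - a) + c * r powr - b)) r)"
    using sw.truncated_step[OF g'(1,2) g1(3)] by (elim exE conjE) (rule that)
  obtain e where e: "0 < e" and e1: "C1 * e powr (q - 1) \<le> 1 / 2" and e2: "C2 * e powr (p - 1) \<le> 1 / 2"
    using ex_small_powr_coeff[OF C1 C2 p q] by blast
  obtain Au where Au: "Au > 0" "\<forall>A\<ge>Au. (\<integral>\<^sup>+ x. ennreal ((trunc A u x) powr (real DIM('a) / a)) \<partial>lborel) \<le> ennreal (e powr (n / a))"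
    using u_superlevel_small[of "e powr (n / a)"] e by auto
  obtain Av where Av: "Av > 0" "\<forall>A\<ge>Av. (\<integral>\<^sup>+ x. ennreal ((trunc A v x) powr (real DIM('a) / b)) \<partial>lborel) \<le> ennreal (e powr (n / b))"
    using sw.u_superlevel_small[of "e powr (n / b)"] e by auto
  define A where "A = max Au Av"
  have A: "A > 0" "Au \<le> A" "Av \<le> A" using Au by (auto simp: A_def)
  have ue: "superlevel_le (trunc A u) (e * r powr - a) r" if "0 < r" for r
    using Au(2) A that a e by (intro weak_le_of_Lp) (auto simp: n_def)
  have ve: "superlevel_le (trunc A v) (e * r powr - b) r" if "0 < r" for r
    using Av(2) A that b e by (intro weak_le_of_Lp) (auto simp: n_def)
  obtain K1 where K1: "K1 > 0" and T1_raw: "\<forall>e S c. 0 < e \<longrightarrow> 0 < S \<longrightarrow> 0 < c \<longrightarrow>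
     (\<forall>r>0. superlevel_le (trunc A v) (e * r powr - b) r) \<longrightarrow>
     (\<forall>r>0. superlevel_le (trunc A v) (S * (r powr - g + c * r powr - b)) r) \<longrightarrow>
     (\<forall>r>0. superlevel_le (trunc A u) ((C1 * e powr (q - 1) * S + K1) * (r powr - (g + a - b) + c * r powr - a)) r)"
    using T1[THEN spec, THEN mp, OF A(1)] by (elim exE conjE) (rule that)
  note T1' = T1_raw[folded g'_def, THEN spec, THEN spec, THEN spec, THEN mp, THEN mp, THEN mp, THEN mp, THEN mp]
  obtain K2 where K2: "K2 > 0" and T2_raw: "\<forall>e S c. 0 < e \<longrightarrow> 0 < S \<longrightarrow> 0 < c \<longrightarrow>
     (\<forall>r>0. superlevel_le (trunc A u) (e * r powr - a) r) \<longrightarrow>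
     (\<forall>r>0. superlevel_le (trunc A u) (S * (r powr - g' + c * r powr - a)) r) \<longrightarrow>
     (\<forall>r>0. superlevel_le (trunc A v) ((C2 * e powr (p - 1) * S + K2) * (r powr - (g' + b - a) + c * r powr - b)) r)"
    using T2[THEN spec, THEN mp, OF A(1)] by (elim exE conjE) (rule that)
  note T2' = T2_raw[unfolded gg, THEN spec, THEN spec, THEN spec, THEN mp, THEN mp, THEN mp, THEN mp, THEN mp]
  define K where "K = max K1 K2"
  have K: "K > 0" "K1 \<le> K" "K2 \<le> K" using K1 by (auto simp: K_def)
  have mono: "emeasure lborel {x. t' < f x} \<le> m"
    if "emeasure lborel {x. t < f x} \<le> m" "t \<le> t'" "f \<in> borel_measurable borel" for t t' m and f :: "'a \<Rightarrow> real"
  proof -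
    have [measurable]: "f \<in> borel_measurable borel" by fact
    have "emeasure lborel {x. t' < f x} \<le> emeasure lborel {x. t < f x}"
      using that(2) by (intro emeasure_mono) auto
    then show ?thesis using that(1) by simp
  qed
  define P where "P c S \<longleftrightarrow> (\<forall>r>0. superlevel_le (trunc A v) (S * (r powr - g + c * r powr - b)) r)
     \<and> (\<forall>r>0. superlevel_le (trunc A u) (S * (r powr - g' + c * r powr - a)) r)" for c S
  have Pmono: "P c S'" if P: "P c S" and "S \<le> S'" "0 < c" for c S S'
  proof -
    have le: "S * (r powr - x + c * r powr - y) \<le> S' * (r powr - x + c * r powr - y)" for r x y
      using \<open>S \<le> S'\<close> \<open>0 < c\<close> by (intro mult_right_mono add_nonneg_nonneg) auto
    show ?thesis unfolding P_def
    proof (intro conjI allI impI)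
      fix r :: real assume r: "0 < r"
      show "superlevel_le (trunc A v) (S' * (r powr - g + c * r powr - b)) r"
        by (rule mono[OF P[unfolded P_def, THEN conjunct1, rule_format, OF r] le]) measurable
      show "superlevel_le (trunc A u) (S' * (r powr - g' + c * r powr - a)) r"
        by (rule mono[OF P[unfolded P_def, THEN conjunct2, rule_format, OF r] le]) measurable
    qed
  qed
  have Pstep: "P c (S / 2 + K)" if P: "P c S" and S: "0 < S" and c: "0 < c" for c S
    unfolding P_def
  proof (intro conjI allI impI)
    fix r :: real assume r: "0 < r"
    have "C2 * e powr (p - 1) * S \<le> 1 / 2 * S" using e2 S by (intro mult_right_mono) auto
    then have "C2 * e powr (p - 1) * S + K2 \<le> S / 2 + K" using K by simp
    then have le: "(C2 * e powr (p - 1) * S + K2) * (r powr - g + c * r powr - b) \<le> (S / 2 + K) * (r powr - g + c * r powr - b)"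
      using c by (intro mult_right_mono add_nonneg_nonneg) auto
    show "superlevel_le (trunc A v) ((S / 2 + K) * (r powr - g + c * r powr - b)) r"
    proof (rule mono[OF _ le])
      have "\<forall>r>0. superlevel_le (trunc A v) ((C2 * e powr (p - 1) * S + K2) * (r powr - g + c * r powr - b)) r"
        using ue P[unfolded P_def] by (intro T2'[OF e S c]) auto
      then show "superlevel_le (trunc A v) ((C2 * e powr (p - 1) * S + K2) * (r powr - g + c * r powr - b)) r"
        using r by blast
    qed measurable
  next
    fix r :: real assume r: "0 < r"
    have "C1 * e powr (q - 1) * S \<le> 1 / 2 * S" using e1 S by (intro mult_right_mono) auto
    then have "C1 * e powr (q - 1) * S + K1 \<le> S / 2 + K" using K by simp
    then have le: "(C1 * e powr (q - 1) * S + K1) * (r powr - g' + c * r powr - a) \<le> (S / 2 + K) * (r powr - g' + c * r powr - a)"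
      using c by (intro mult_right_mono add_nonneg_nonneg) auto
    show "superlevel_le (trunc A u) ((S / 2 + K) * (r powr - g' + c * r powr - a)) r"
    proof (rule mono[OF _ le])
      have "\<forall>r>0. superlevel_le (trunc A u) ((C1 * e powr (q - 1) * S + K1) * (r powr - g' + c * r powr - a)) r"
        using ve P[unfolded P_def] by (intro T1'[OF e S c]) auto
      then show "superlevel_le (trunc A u) ((C1 * e powr (q - 1) * S + K1) * (r powr - g' + c * r powr - a)) r"
        using r by blast
    qed measurable
  qed
  \<comment> \<open>The starting constant e / c is admissible, because the critical bound e r^-b
    equals e / c times the term c r^-b of the barrier.\<close>
  have P3: "P c (3 * K)" if c: "0 < c" for c
  proof (rule halving_iteration[where P = "P c" and T = "e / c", OF K(1)])
    show "0 < e / c" using e c by simp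
    have "e * r powr - b \<le> (e / c) * (r powr - g + c * r powr - b)"
      "e * r powr - a \<le> (e / c) * (r powr - g' + c * r powr - a)" for r
      using e c by (auto simp: field_simps)
    note le = this
    show "P c (e / c)" unfolding P_def
    proof (intro conjI allI impI)
      fix r :: real assume r: "0 < r"
      show "superlevel_le (trunc A v) (e / c * (r powr - g + c * r powr - b)) r"
        by (rule mono[OF ve[OF r] le(1)]) measurable
      show "superlevel_le (trunc A u) (e / c * (r powr - g' + c * r powr - a)) r"
        by (rule mono[OF ue[OF r] le(2)]) measurable
    qed
  qed (rule Pmono[OF _ _ c], assumption+, rule Pstep[OF _ _ c], assumption+)
  have "superlevel_le (trunc A v) (3 * K * r powr - g) r" if r: "0 < r" for r
  proof -
    \<comment> \<open>Limit c = 1 / (k + 1) -> 0: the strict superlevel set of the limit is the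
      increasing union of those for positive c, so its measure is a supremum.\<close>
    define F where "F k = {x. 3 * K * (r powr - g + inverse (real (Suc k)) * r powr - b) < trunc A v x}" for k
    have [measurable]: "F k \<in> sets borel" for k unfolding F_def by measurable
    have "{x. 3 * K * r powr - g < trunc A v x} = (\<Union>k. F k)"
    proof safe
      fix x assume x: "3 * K * r powr - g < trunc A v x"
      have "(\<lambda>k. 3 * K * (r powr - g + inverse (real (Suc k)) * r powr - b)) \<longlonglongrightarrow> 3 * K * (r powr - g + 0 * r powr - b)"
        by (intro tendsto_intros LIMSEQ_inverse_real_of_nat)
      then have "eventually (\<lambda>k. 3 * K * (r powr - g + inverse (real (Suc k)) * r powr - b) < trunc A v x) sequentially"
        by (rule order_tendstoD(2)) (use x in simp)
      then obtain k where "x \<in> F k" unfolding F_def by (auto simp: eventually_sequentially)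
      then show "x \<in> (\<Union>k. F k)" by blast
    next
      fix x k assume "x \<in> F k"
      moreover have "3 * K * r powr - g \<le> 3 * K * (r powr - g + inverse (real (Suc k)) * r powr - b)"
        using K by (intro mult_left_mono) auto
      ultimately show "3 * K * r powr - g < trunc A v x" unfolding F_def by auto
    qed
    moreover have "emeasure lborel (\<Union>k. F k) = (SUP k. emeasure lborel (F k))"
    proof (rule SUP_emeasure_incseq[symmetric])
      show "incseq F"
      proof (intro incseq_SucI subsetI)
        fix k x assume "x \<in> F k"
        moreover have "3 * K * (r powr - g + inverse (real (Suc (Suc k))) * r powr - b) \<le> 3 * K * (r powr - g + inverse (real (Suc k)) * r powr - b)"
          using K by (intro mult_left_mono add_left_mono mult_right_mono le_imp_inverse_le) auto
        ultimately show "x \<in> F (Suc k)" unfolding F_def by auto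
      qed
    qed auto
    moreover have "(SUP k. emeasure lborel (F k)) \<le> ennreal (r ^ DIM('a))"
      using P3 r unfolding F_def P_def by (intro SUP_least) auto
    ultimately show ?thesis by simp
  qed
  then show ?thesis using A(1) K(1) by (intro exI[of _ A] exI[of _ "3 * K"] conjI) auto
qed

text \<open>Once v has a small enough weak exponent g, the source v^q |y|^-s1 has weak exponent q g
  + s1 < n - l and \<open>riesz_bounded_of_weak\<close> applies; the assumption s1 < n - l leaves
  room for such a g.\<close>

lemma u_bounded:
  assumes D: "b \<le> a"
  shows "\<exists>B>0. \<forall>x. u x \<le> B"
proof -
  \<comment> \<open>Half of each admissible range: g < b for \<open>weak_gain\<close>, and q g < n -
    l - s1 for a bounded potential.\<close>
  define g where "g = min (b / 2) ((real DIM('a) - l - s1) / (2 * q))"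
  have g: "0 < g" "g < b" using b s1 q by (auto simp: g_def)
  have "g * (2 * q) \<le> (real DIM('a) - l - s1) / (2 * q) * (2 * q)"
    using q by (intro mult_right_mono) (auto simp: g_def)
  then have "2 * (q * g) \<le> real DIM('a) - l - s1" using q by (simp add: mult_ac)
  moreover have qg: "0 < q * g" using q g by simp
  ultimately have gq: "q * g + s1 < real DIM('a) - l" by linarith
  have b0: "0 < q * g + s1" using qg s1 by simp
  obtain A S where A: "A > 0" and S: "S > 0"
    and AS: "\<And>r. r > 0 \<Longrightarrow> superlevel_le (trunc A v) (S * r powr - g) r"
    using weak_gain[OF D g] by auto
  interpret sw: integrable_hardy_sobolev_system v u l s2 s1 q p b a by (rule integrable_swap)
  obtain R where R: "R > 0" "superlevel_le v A R"
    using sw.u_superlevel_finite[OF A] by blast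
  obtain CA where CA: "0 < CA" "\<And>x. ennreal (u x) \<le> riesz l (\<lambda>y. (trunc A v y) powr q * norm y powr - s1) x + ennreal CA"
    using u_le_truncated[OF A] by blast
  define \<kappa> where "\<kappa> = unit_ball_vol (real DIM('a)) powr - (1 / real DIM('a))"
  have \<kappa>: "\<kappa> > 0"
    unfolding \<kappa>_def powr_gt_zero using unit_ball_vol_pos[OF of_nat_0_le_iff, of "DIM('a)"] by linarith
  define f where "f y = (trunc A v y) powr q * norm y powr - s1" for y
  have [measurable]: "f \<in> borel_measurable borel" unfolding f_def by measurable
  define M where "M = S powr q * \<kappa> powr - s1 * 3 powr (q * g + s1)"
  have M: "M > 0" using S \<kappa> by (simp add: M_def)
  have "\<exists>B. \<forall>x. riesz l f x \<le> ennreal B"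
  proof (rule riesz_bounded_of_weak[OF l b0 gq _ _ M R(1)])
    have "emeasure lborel {x. 0 < f x} \<le> emeasure lborel {x. A < v x}"
      by (intro emeasure_mono) (auto simp: f_def indicator_def)
    then show "superlevel_le f 0 R" using R by simp
    fix r :: real assume r: "0 < r"
    show "superlevel_le f (M * r powr - (q * g + s1)) r"
    proof (rule emeasure_three_le)
      \<comment> \<open>Only two factors occur here; the empty set fills the third place.\<close>
      show "{x. M * r powr - (q * g + s1) < f x} \<subseteq> {x. S * (r / 3) powr - g < trunc A v x} \<union> {}
          \<union> {x. (\<kappa> * (r / 3)) powr - s1 < norm x powr - s1}"
      proof (rule subsetI, rule ccontr)
        fix x assume x: "x \<in> {x. M * r powr - (q * g + s1) < f x}"
          and "x \<notin> {x. S * (r / 3) powr - g < trunc A v x} \<union> {}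
          \<union> {x. (\<kappa> * (r / 3)) powr - s1 < norm x powr - s1}"
        then have x1: "trunc A v x \<le> S * (r / 3) powr - g" and x3: "norm x powr - s1 \<le> (\<kappa> * (r / 3)) powr - s1" by auto
        have "f x \<le> (S * (r / 3) powr - g) powr q * (\<kappa> * (r / 3)) powr - s1"
          unfolding f_def
        proof (rule mult_mono)
          show "(trunc A v x) powr q \<le> (S * (r / 3) powr - g) powr q"
            using x1 v_pos[of x] q by (intro powr_mono2) (auto simp: indicator_def)
        qed (use x3 in auto)
        also have "\<dots> = S powr q * \<kappa> powr - s1 * ((r / 3) powr (- g * q) * (r / 3) powr - s1)"
          by (simp only: powr_mult powr_powr mult_ac)
        also have "(r / 3) powr (- g * q) * (r / 3) powr - s1 = (r / 3) powr - (q * g + s1)"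
          unfolding powr_add[symmetric] by (simp add: mult.commute)
        also have "(r / 3) powr - (q * g + s1) = 3 powr (q * g + s1) * r powr - (q * g + s1)"
        proof -
          have "(r / 3) powr - z = 3 powr z * r powr - z" for z
            using r by (simp add: powr_divide powr_minus field_simps)
          then show ?thesis .
        qed
        also have "S powr q * \<kappa> powr - s1 * (3 powr (q * g + s1) * r powr - (q * g + s1)) = M * r powr - (q * g + s1)"
          by (simp only: M_def mult.assoc)
        finally show False using x by simp
      qed
      show "{x. S * (r / 3) powr - g < trunc A v x} \<in> sets lborel" by measurable
      show "{x::'a. (\<kappa> * (r / 3)) powr - s1 < norm x powr - s1} \<in> sets lborel" by measurable
      show "superlevel_le (trunc A v) (S * (r / 3) powr - g) (r / 3)"
        using r by (intro AS) auto
      show "emeasure lborel {x::'a. (\<kappa> * (r / 3)) powr - s1 < norm x powr - s1} \<le> ennreal ((r / 3) ^ DIM('a))"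
        unfolding \<kappa>_def using s1 r by (intro norm_powr_weak) auto
    qed (use r in auto)
  qed (auto simp: f_def)
  then obtain B where B: "\<And>x. riesz l f x \<le> ennreal B" by blast
  have "u x \<le> \<bar>B\<bar> + CA" for x
  proof -
    have "ennreal (u x) \<le> riesz l f x + ennreal CA" using CA(2)[of x] by (simp only: f_def[abs_def])
    also have "\<dots> \<le> ennreal \<bar>B\<bar> + ennreal CA"
      using B[of x] by (intro add_right_mono) (auto elim!: order_trans intro: ennreal_leI)
    also have "\<dots> = ennreal (\<bar>B\<bar> + CA)" using CA by (intro ennreal_plus[symmetric]) auto
    finally show ?thesis using CA by (subst (asm) ennreal_le_iff) auto
  qed
  moreover have "0 < \<bar>B\<bar> + CA" using CA by simp
  ultimately show ?thesis by blast
qed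

text \<open>Truncating \<open>u\<close> at a level it never exceeds leaves a source that is
  identically 0, so that only the constant of \<open>u_le_truncated\<close> remains.\<close>

lemma v_bounded_of_u_bounded:
  assumes B: "0 < B" "\<And>x. u x \<le> B"
  shows "\<exists>B>0. \<forall>x. v x \<le> B"
proof -
  interpret sw: integrable_hardy_sobolev_system v u l s2 s1 q p b a by (rule integrable_swap)
  obtain C where C: "0 < C" "\<And>x. ennreal (v x) \<le> riesz l (\<lambda>y. (u y * indicator {y. B < u y} y) powr p * norm y powr - s2) x + ennreal C"
    using sw.u_le_truncated[OF B(1)] by blast
  have "indicator {y. B < u y} y = (0::real)" for y using B(2)[of y] by (simp add: indicator_def)
  then have "ennreal (v x) \<le> ennreal C" for x using C(2)[of x] by (simp add: riesz_def)
  then show ?thesis using C(1) by (intro exI[of _ C]) (simp add: ennreal_le_iff)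
qed

end

section \<open>Decay at infinity\<close>

text \<open>\<open>riesz_upper\<close> with F = 1: h > n - l gives convergence at infinity and h < n
  finite mass at the origin, so that all contributions scale alike.\<close>

lemma riesz_norm_powr:
  assumes l: "0 < l" "l < real DIM('a::euclidean_space)" and h: "real DIM('a) - l < h" "h < real DIM('a)"
  shows "\<exists>C>0. \<forall>x::'a. x \<noteq> 0 \<longrightarrow> riesz l (\<lambda>y. norm y powr - h) x \<le> ennreal (C * norm x powr (real DIM('a) - l - h))"
proof -
  define n where "n = real DIM('a)"
  have h0: "0 \<le> h" using l h by simp
  obtain C1 where C1: "C1 > 0" and U_raw: "\<forall>f (x::'a) F. f \<in> borel_measurable borel \<longrightarrow> (\<forall>y. 0 \<le> f y) \<longrightarrow> x \<noteq> 0 \<longrightarrow> 0 \<le> F \<longrightarrow>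
     (\<forall>y. norm x / 2 \<le> norm y \<longrightarrow> f y \<le> F * norm y powr - h) \<longrightarrow>
     riesz l f x \<le> ennreal (C1 * norm x powr - l) * (\<integral>\<^sup>+ y. ennreal (f y) * indicator (ball 0 (norm x / 2)) y \<partial>lborel)
        + ennreal (C1 * F * norm x powr (real DIM('a) - l - h))"
    using riesz_upper[OF l h(1)] by (elim exE conjE) (rule that)
  obtain C2 where C2: "C2 > 0" and B: "\<forall>r>0. \<forall>x::'a. (\<integral>\<^sup>+ y. ennreal (norm (x - y) powr - h) * indicator (ball x r) y \<partial>lborel)
            \<le> ennreal (C2 * r powr (real DIM('a) - h))"
    using nn_integral_norm_powr_ball[OF h0 h(2)] by blast
  show ?thesis
  proof (intro exI[of _ "C1 * C2 + C1"] conjI allI impI)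
    show "C1 * C2 + C1 > 0" using C1 C2 by (simp add: add_pos_pos)
    fix x :: 'a assume x: "x \<noteq> 0"
    have "riesz l (\<lambda>y. norm y powr - h) x \<le> ennreal (C1 * norm x powr - l) * (\<integral>\<^sup>+ (y::'a). ennreal (norm y powr - h) * indicator (ball 0 (norm x / 2)) y \<partial>lborel)
        + ennreal (C1 * 1 * norm x powr (n - l - h))"
      using x unfolding n_def by (intro U_raw[rule_format]) auto
    also have "(\<integral>\<^sup>+ (y::'a). ennreal (norm y powr - h) * indicator (ball 0 (norm x / 2)) y \<partial>lborel) \<le> ennreal (C2 * (norm x / 2) powr (n - h))"
      using B[rule_format, of "norm x / 2" 0] x by (simp add: n_def)
    also have "\<dots> \<le> ennreal (C2 * norm x powr (n - h))"
      using C2 h by (intro ennreal_leI mult_left_mono powr_mono2) (auto simp: n_def)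
    finally have "riesz l (\<lambda>y. norm y powr - h) x \<le> ennreal (C1 * norm x powr - l) * ennreal (C2 * norm x powr (n - h))
        + ennreal (C1 * 1 * norm x powr (n - l - h))"
      by (simp add: mult_left_mono add_right_mono)
    also have "\<dots> = ennreal (C1 * norm x powr - l * (C2 * norm x powr (n - h)) + C1 * 1 * norm x powr (n - l - h))"
      using C1 C2 by (subst ennreal_mult[symmetric], simp, simp, intro ennreal_plus[symmetric]) auto
    also have "C1 * norm x powr - l * (C2 * norm x powr (n - h)) + C1 * 1 * norm x powr (n - l - h)
       = (C1 * C2 + C1) * norm x powr (n - l - h)"
    proof -
      have "norm x powr - l * norm x powr (n - h) = norm x powr (n - l - h)"
        unfolding powr_add[symmetric] by (simp add: algebra_simps)
      then show ?thesis by (simp add: algebra_simps)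
    qed
    finally show "riesz l (\<lambda>y. norm y powr - h) x \<le> ennreal ((C1 * C2 + C1) * norm x powr (real DIM('a) - l - h))"
      by (simp add: n_def)
  qed
qed

context hardy_sobolev_system
begin

text \<open>Since r <= |x|/2, the ball around \<open>x\<close> stays at distance at least \<rho>
  from the origin, where both the weight and \<open>v\<close> are under control.\<close>

lemma riesz_near_le:
  "\<exists>C>0. \<forall>x \<rho> r M. 0 < \<rho> \<longrightarrow> 0 < r \<longrightarrow> r \<le> \<rho> \<longrightarrow> norm x = 2 * \<rho> \<longrightarrow> 0 \<le> M \<longrightarrow> (\<forall>y. \<rho> \<le> norm y \<longrightarrow> v y \<le> M) \<longrightarrow>
     riesz l (\<lambda>y. v y powr q * norm y powr - s1 * indicator (ball x r) y) x \<le> ennreal (C * M powr q * \<rho> powr - s1 * r powr (real DIM('a) - l))"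
proof -
  obtain C where C: "C > 0" and CB: "\<forall>r>0. \<forall>x::'a. (\<integral>\<^sup>+ y. ennreal (norm (x - y) powr - l) * indicator (ball x r) y \<partial>lborel)
            \<le> ennreal (C * r powr (real DIM('a) - l))"
    using nn_integral_norm_powr_ball[OF less_imp_le[OF l(1)] l(2)] by blast
  show ?thesis
  proof (intro exI[of _ C] conjI allI impI C)
    fix x :: 'a and \<rho> r M :: real
    assume \<rho>: "0 < \<rho>" "norm x = 2 * \<rho>" and r: "0 < r" "r \<le> \<rho>" and M: "0 \<le> M" "\<forall>y. \<rho> \<le> norm y \<longrightarrow> v y \<le> M"
    have "riesz l (\<lambda>y. v y powr q * norm y powr - s1 * indicator (ball x r) y) x
      \<le> (\<integral>\<^sup>+ y. ennreal (M powr q * \<rho> powr - s1) * (ennreal (norm (x - y) powr - l) * indicator (ball x r) y) \<partial>lborel)"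
      unfolding riesz_def
    proof (intro nn_integral_mono)
      fix y
      show "ennreal (v y powr q * norm y powr - s1 * indicator (ball x r) y * norm (x - y) powr - l)
        \<le> ennreal (M powr q * \<rho> powr - s1) * (ennreal (norm (x - y) powr - l) * indicator (ball x r) y)"
      proof (cases "y \<in> ball x r")
        case True
        then have "norm (x - y) < r" by (simp add: dist_norm)
        then have y: "\<rho> \<le> norm y" using norm_triangle_ineq[of "x - y" y] r \<rho> by simp
        have "v y powr q * norm y powr - s1 \<le> M powr q * \<rho> powr - s1"
          using y \<rho> M v_pos[of y] q s1 by (intro mult_mono powr_mono2 powr_mono2') auto
        then have "v y powr q * norm y powr - s1 * norm (x - y) powr - l \<le> M powr q * \<rho> powr - s1 * norm (x - y) powr - l"
          by (intro mult_right_mono) auto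
        then show ?thesis using True by (simp add: ennreal_mult[symmetric] ennreal_leI)
      qed auto
    qed
    also have "\<dots> = ennreal (M powr q * \<rho> powr - s1) * (\<integral>\<^sup>+ y. ennreal (norm (x - y) powr - l) * indicator (ball x r) y \<partial>lborel)"
      by (rule nn_integral_cmult) measurable
    also have "\<dots> \<le> ennreal (M powr q * \<rho> powr - s1) * ennreal (C * r powr (real DIM('a) - l))"
      using CB r by (intro mult_left_mono) auto
    also have "\<dots> = ennreal (C * M powr q * \<rho> powr - s1 * r powr (real DIM('a) - l))"
      using C by (simp add: ennreal_mult[symmetric] mult_ac)
    finally show "riesz l (\<lambda>y. v y powr q * norm y powr - s1 * indicator (ball x r) y) x
      \<le> ennreal (C * M powr q * \<rho> powr - s1 * r powr (real DIM('a) - l))" .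
  qed
qed

lemma weight_ball_finite:
  assumes B: "\<And>x. v x \<le> B" and R: "0 < R"
  shows "\<exists>K\<ge>0. (\<integral>\<^sup>+ y. ennreal (v y powr q * norm y powr - s1) * indicator (ball 0 R) y \<partial>lborel) \<le> ennreal K"
proof -
  have "s1 < real DIM('a)" using s1 l by simp
  from nn_integral_norm_powr_ball[OF s1(1) this]
  obtain C where C: "C > 0" "\<forall>r>0. \<forall>x::'a. (\<integral>\<^sup>+ y. ennreal (norm (x - y) powr - s1) * indicator (ball x r) y \<partial>lborel)
            \<le> ennreal (C * r powr (real DIM('a) - s1))" by blast
  have "(\<integral>\<^sup>+ y. ennreal (v y powr q * norm y powr - s1) * indicator (ball 0 R) y \<partial>lborel)
    \<le> (\<integral>\<^sup>+ (y::'a). ennreal (B powr q) * (ennreal (norm (0 - y) powr - s1) * indicator (ball 0 R) y) \<partial>lborel)"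
  proof (intro nn_integral_mono)
    fix y
    have "v y powr q * norm y powr - s1 \<le> B powr q * norm (0 - y) powr - s1"
      using B[of y] v_pos[of y] q by (auto intro!: mult_right_mono powr_mono2)
    then have "ennreal (v y powr q * norm y powr - s1) \<le> ennreal (B powr q) * ennreal (norm (0 - y) powr - s1)"
      by (simp add: ennreal_mult[symmetric] ennreal_leI)
    then show "ennreal (v y powr q * norm y powr - s1) * indicator (ball 0 R) y \<le> ennreal (B powr q) * (ennreal (norm (0 - y) powr - s1) * indicator (ball 0 R) y)"
      by (auto simp: indicator_def)
  qed
  also have "\<dots> = ennreal (B powr q) * (\<integral>\<^sup>+ (y::'a). ennreal (norm (0 - y) powr - s1) * indicator (ball 0 R) y \<partial>lborel)"
    by (rule nn_integral_cmult) measurable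
  also have "\<dots> \<le> ennreal (B powr q) * ennreal (C * R powr (real DIM('a) - s1))"
    by (intro mult_left_mono C(2)[rule_format, OF R]) auto
  also have "\<dots> = ennreal (B powr q * (C * R powr (real DIM('a) - s1)))" by (simp add: ennreal_mult C(1) less_imp_le)
  finally show ?thesis using C(1) by (intro exI[of _ "B powr q * (C * R powr (real DIM('a) - s1))"]) auto
qed

lemma riesz_inner_decay:
  assumes B: "0 < B" "\<And>x. v x \<le> B" and R: "0 < R"
  shows "\<exists>K>0. \<forall>x. 1 \<le> norm x \<longrightarrow> riesz l (\<lambda>y. v y powr q * norm y powr - s1 * indicator (ball 0 R) y) x \<le> ennreal (K * norm x powr - l)"
proof -
  \<comment> \<open>A compactly supported source satisfies any power bound outside a ball, so no
    case distinction on the position of \<open>x\<close> relative to \<open>ball 0 R\<close> arises.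
    With h = s1 + n the constant is F = B^q R^n, and the outer contribution |x|^(-l - s1) is at most
    |x|^-l for |x| >= 1.\<close>
  define h where "h = s1 + real DIM('a)"
  have h: "real DIM('a) - l < h" using s1 l by (simp add: h_def)
  obtain C1 where C1: "C1 > 0" and U_raw: "\<forall>f (x::'a) F. f \<in> borel_measurable borel \<longrightarrow> (\<forall>y. 0 \<le> f y) \<longrightarrow> x \<noteq> 0 \<longrightarrow> 0 \<le> F \<longrightarrow>
     (\<forall>y. norm x / 2 \<le> norm y \<longrightarrow> f y \<le> F * norm y powr - h) \<longrightarrow>
     riesz l f x \<le> ennreal (C1 * norm x powr - l) * (\<integral>\<^sup>+ y. ennreal (f y) * indicator (ball 0 (norm x / 2)) y \<partial>lborel)
        + ennreal (C1 * F * norm x powr (real DIM('a) - l - h))"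
    using riesz_upper[OF l h(1)] by (elim exE conjE) (rule that)
  obtain K where K: "K \<ge> 0" "(\<integral>\<^sup>+ y. ennreal (v y powr q * norm y powr - s1) * indicator (ball 0 R) y \<partial>lborel) \<le> ennreal K"
    using weight_ball_finite[OF B(2) R] by blast
  define f where "f y = v y powr q * norm y powr - s1 * indicator (ball 0 R) y" for y
  have [measurable]: "f \<in> borel_measurable borel" unfolding f_def by measurable
  define F where "F = B powr q * R powr real DIM('a)"
  have F: "F > 0" using B R by (simp add: F_def)
  have "riesz l f x \<le> ennreal ((C1 * K + C1 * F) * norm x powr - l)" if x: "1 \<le> norm x" for x
  proof -
    have "riesz l f x \<le> ennreal (C1 * norm x powr - l) * (\<integral>\<^sup>+ y. ennreal (f y) * indicator (ball 0 (norm x / 2)) y \<partial>lborel)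
        + ennreal (C1 * F * norm x powr (real DIM('a) - l - h))"
    proof (intro U_raw[rule_format])
      fix y :: 'a assume y: "norm x / 2 \<le> norm y"
      show "f y \<le> F * norm y powr - h"
      proof (cases "y \<in> ball 0 R")
        case True
        then have yR: "norm y \<le> R" by simp
        have "f y = v y powr q * norm y powr - s1" using True by (simp add: f_def)
        also have "\<dots> \<le> B powr q * norm y powr - s1"
          using B v_pos[of y] q by (intro mult_right_mono powr_mono2) auto
        also have "\<dots> = B powr q * (norm y powr real DIM('a) * norm y powr - h)"
          unfolding powr_add[symmetric] by (simp add: h_def)
        also have "\<dots> \<le> B powr q * (R powr real DIM('a) * norm y powr - h)"
          using yR by (intro mult_left_mono mult_right_mono powr_mono2) auto
        finally show ?thesis by (simp add: F_def mult_ac)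
      next
        case False
        then show ?thesis using F by (simp add: f_def)
      qed
    qed (use F x in \<open>auto simp: f_def\<close>)
    also have "\<dots> \<le> ennreal (C1 * norm x powr - l) * ennreal K + ennreal (C1 * F * norm x powr - l)"
    proof (intro add_mono mult_left_mono ennreal_leI)
      have "(\<integral>\<^sup>+ y. ennreal (f y) * indicator (ball 0 (norm x / 2)) y \<partial>lborel)
         \<le> (\<integral>\<^sup>+ y. ennreal (v y powr q * norm y powr - s1) * indicator (ball 0 R) y \<partial>lborel)"
        by (intro nn_integral_mono) (auto simp: f_def indicator_def)
      then show "(\<integral>\<^sup>+ y. ennreal (f y) * indicator (ball 0 (norm x / 2)) y \<partial>lborel) \<le> ennreal K" using K by simp
      show "norm x powr (real DIM('a) - l - h) \<le> norm x powr - l"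
        using x s1 by (intro powr_mono) (auto simp: h_def)
    qed (use C1 F in auto)
    also have "\<dots> = ennreal (C1 * norm x powr - l * K + C1 * F * norm x powr - l)"
      using C1 K F by (subst ennreal_mult[symmetric], simp, simp, intro ennreal_plus[symmetric]) auto
    also have "C1 * norm x powr - l * K + C1 * F * norm x powr - l = (C1 * K + C1 * F) * norm x powr - l"
      by (simp add: algebra_simps)
    finally show ?thesis .
  qed
  moreover have "C1 * K + C1 * F > 0" using C1 K F by (intro add_nonneg_pos) auto
  ultimately show ?thesis unfolding f_def[abs_def] by blast
qed

text \<open>The pointwise analogue of \<open>truncated_step\<close>, with \<open>R\<close> in the
  role of \<open>A\<close>: \<open>C\<close> is independent of \<open>R\<close>, so that the
  smallness can be fixed before the radius. The condition g + a - b < l lets the term K |x|^-l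
  coming from \<open>ball 0 R\<close> be absorbed by the barrier and makes the power source locally
  integrable.\<close>

lemma exterior_step:
  assumes g: "0 < g" "0 < g + a - b" "g + a - b < l"
  shows "\<exists>C>0. \<forall>B>0. (\<forall>x. v x \<le> B) \<longrightarrow> (\<forall>R\<ge>1. \<exists>K>0. \<forall>e S c. 0 < e \<longrightarrow> 0 < S \<longrightarrow> 0 < c \<longrightarrow>
     (\<forall>x. R \<le> norm x \<longrightarrow> v x \<le> e * norm x powr - b) \<longrightarrow>
     (\<forall>x. R \<le> norm x \<longrightarrow> v x \<le> S * (norm x powr - g + c * norm x powr - b)) \<longrightarrow>
     (\<forall>x. R \<le> norm x \<longrightarrow> u x \<le> (C * e powr (q - 1) * S + K) * (norm x powr - (g + a - b) + c * norm x powr - a)))"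
proof -
  define n where "n = real DIM('a)"
  define g' where "g' = g + a - b"
  have g': "0 < g'" "g' < l" using g by (auto simp: g'_def)
  \<comment> \<open>Exponents of the source under the two terms of the barrier; the potential lowers
    them by n - l, to g' and a.\<close>
  define h1 where "h1 = n - l + g'"
  define h2 where "h2 = n - l + a"
  have al: "a < l" using ab b by simp
  have h1: "real DIM('a) - l < h1" "h1 < real DIM('a)" using g' by (auto simp: h1_def n_def)
  have h2: "real DIM('a) - l < h2" "h2 < real DIM('a)" using a al by (auto simp: h2_def n_def)
  obtain C1 where C1: "C1 > 0" "\<forall>x::'a. x \<noteq> 0 \<longrightarrow> riesz l (\<lambda>y. norm y powr - h1) x \<le> ennreal (C1 * norm x powr (real DIM('a) - l - h1))"
    using riesz_norm_powr[OF l h1] by blast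
  obtain C2 where C2: "C2 > 0" "\<forall>x::'a. x \<noteq> 0 \<longrightarrow> riesz l (\<lambda>y. norm y powr - h2) x \<le> ennreal (C2 * norm x powr (real DIM('a) - l - h2))"
    using riesz_norm_powr[OF l h2] by blast
  have "b * (q - 1) = a + (n - l) - s1 - b" using qb by (simp add: n_def algebra_simps)
  then have ex1: "- b * (q - 1) + - g + - s1 = - h1" and ex2: "- b * (q - 1) + - b + - s1 = - h2"
    unfolding h1_def h2_def g'_def by linarith+
  define C where "C = max C1 C2"
  have C: "C > 0" "C1 \<le> C" "C2 \<le> C" using C1 by (auto simp: C_def)
  show ?thesis
  proof (intro exI[of _ C] conjI C, intro allI impI)
    fix B R :: real assume B: "0 < B" "\<forall>x. v x \<le> B" and R: "1 \<le> R"
    have R0: "0 < R" using R by simp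
    obtain K where K: "K > 0" "\<forall>x. 1 \<le> norm x \<longrightarrow> riesz l (\<lambda>y. v y powr q * norm y powr - s1 * indicator (ball 0 R) y) x \<le> ennreal (K * norm x powr - l)"
      using riesz_inner_decay[OF B(1) B(2)[rule_format] R0] by blast
    show "\<exists>K>0. \<forall>e S c. 0 < e \<longrightarrow> 0 < S \<longrightarrow> 0 < c \<longrightarrow>
     (\<forall>x. R \<le> norm x \<longrightarrow> v x \<le> e * norm x powr - b) \<longrightarrow>
     (\<forall>x. R \<le> norm x \<longrightarrow> v x \<le> S * (norm x powr - g + c * norm x powr - b)) \<longrightarrow>
     (\<forall>x. R \<le> norm x \<longrightarrow> u x \<le> (C * e powr (q - 1) * S + K) * (norm x powr - (g + a - b) + c * norm x powr - a))"
    proof (intro exI[of _ K] conjI K, intro allI impI)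
      fix e S c :: real and x :: 'a
      assume e: "0 < e" and S: "0 < S" and c: "0 < c" and x: "R \<le> norm x"
        and v1: "\<forall>x. R \<le> norm x \<longrightarrow> v x \<le> e * norm x powr - b"
        and v2: "\<forall>x. R \<le> norm x \<longrightarrow> v x \<le> S * (norm x powr - g + c * norm x powr - b)"
      define Q where "Q = e powr (q - 1) * S"
      have Q: "Q > 0" using e S by (simp add: Q_def)
      have x0: "x \<noteq> 0" "1 \<le> norm x" using x R by auto
      define f1 where "f1 y = v y powr q * norm y powr - s1 * indicator (ball 0 R) y" for y
      have [measurable]: "f1 \<in> borel_measurable borel" unfolding f1_def by measurable
      have "ennreal (u x) = riesz l (\<lambda>y. v y powr q * norm y powr - s1) x" by (rule u_eq)
      also have "\<dots> \<le> riesz l (\<lambda>y. f1 y + (Q * norm y powr - h1 + Q * c * norm y powr - h2)) x"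
      proof (rule riesz_mono)
        fix y
        show "v y powr q * norm y powr - s1 \<le> f1 y + (Q * norm y powr - h1 + Q * c * norm y powr - h2)"
        proof (cases "y \<in> ball 0 R")
          case True
          then show ?thesis using Q c by (simp add: f1_def)
        next
          case False
          then have y: "R \<le> norm y" by simp
          have "v y powr q = v y powr (q - 1) * v y"
            using v_pos[of y] powr_add[of "v y" "q - 1" 1] by simp
          also have "\<dots> \<le> (e * norm y powr - b) powr (q - 1) * (S * (norm y powr - g + c * norm y powr - b))"
            using v1 v2 y v_pos[of y] q by (intro mult_mono powr_mono2) auto
          also have "\<dots> = Q * (norm y powr (- b * (q - 1)) * (norm y powr - g + c * norm y powr - b))"
            unfolding Q_def by (simp only: powr_mult powr_powr mult_ac)
          finally have "v y powr q * norm y powr - s1 \<le> Q * (norm y powr (- b * (q - 1)) * (norm y powr - g + c * norm y powr - b)) * norm y powr - s1"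
            by (intro mult_right_mono) auto
          also have "\<dots> = Q * (norm y powr (- b * (q - 1)) * norm y powr - g * norm y powr - s1)
             + Q * c * (norm y powr (- b * (q - 1)) * norm y powr - b * norm y powr - s1)"
            by (simp add: algebra_simps)
          also have "norm y powr (- b * (q - 1)) * norm y powr - g * norm y powr - s1 = norm y powr - h1"
            unfolding powr_add[symmetric] ex1 ..
          also have "norm y powr (- b * (q - 1)) * norm y powr - b * norm y powr - s1 = norm y powr - h2"
            unfolding powr_add[symmetric] ex2 ..
          finally show ?thesis using False by (simp add: f1_def)
        qed
      qed
      also have "\<dots> = riesz l f1 x + (ennreal Q * riesz l (\<lambda>y. norm y powr - h1) x + ennreal (Q * c) * riesz l (\<lambda>y. norm y powr - h2) x)"
      proof -
        have "riesz l (\<lambda>y. f1 y + (Q * norm y powr - h1 + Q * c * norm y powr - h2)) x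
          = riesz l f1 x + riesz l (\<lambda>y. Q * norm y powr - h1 + Q * c * norm y powr - h2) x"
          using Q c by (intro riesz_add) (auto simp: f1_def)
        also have "riesz l (\<lambda>y. Q * norm y powr - h1 + Q * c * norm y powr - h2) x
          = riesz l (\<lambda>y. Q * norm y powr - h1) x + riesz l (\<lambda>y. Q * c * norm y powr - h2) x"
          using Q c by (intro riesz_add) auto
        also have "riesz l (\<lambda>y. Q * norm y powr - h1) x = ennreal Q * riesz l (\<lambda>y. norm y powr - h1) x"
          using Q by (intro riesz_cmult) auto
        also have "riesz l (\<lambda>y. Q * c * norm y powr - h2) x = ennreal (Q * c) * riesz l (\<lambda>y. norm y powr - h2) x"
          using Q c by (intro riesz_cmult) auto
        finally show ?thesis .
      qed
      also have "\<dots> \<le> ennreal (K * norm x powr - l) + (ennreal Q * ennreal (C * norm x powr - g') + ennreal (Q * c) * ennreal (C * norm x powr - a))"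
      proof (intro add_mono mult_left_mono)
        show "riesz l f1 x \<le> ennreal (K * norm x powr - l)" using K x0 unfolding f1_def[abs_def] by simp
        have "riesz l (\<lambda>y. norm y powr - h1) x \<le> ennreal (C1 * norm x powr (real DIM('a) - l - h1))" using C1 x0 by simp
        also have "real DIM('a) - l - h1 = - g'" by (simp add: h1_def n_def)
        also have "ennreal (C1 * norm x powr - g') \<le> ennreal (C * norm x powr - g')"
          using C by (intro ennreal_leI mult_right_mono) auto
        finally show "riesz l (\<lambda>y. norm y powr - h1) x \<le> ennreal (C * norm x powr - g')" .
        have "riesz l (\<lambda>y. norm y powr - h2) x \<le> ennreal (C2 * norm x powr (real DIM('a) - l - h2))" using C2 x0 by simp
        also have "real DIM('a) - l - h2 = - a" by (simp add: h2_def n_def)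
        also have "ennreal (C2 * norm x powr - a) \<le> ennreal (C * norm x powr - a)"
          using C by (intro ennreal_leI mult_right_mono) auto
        finally show "riesz l (\<lambda>y. norm y powr - h2) x \<le> ennreal (C * norm x powr - a)" .
      qed auto
      also have "\<dots> = ennreal (K * norm x powr - l + (Q * (C * norm x powr - g') + Q * c * (C * norm x powr - a)))"
        using Q C K c by (simp add: ennreal_mult ennreal_plus)
      finally have "u x \<le> K * norm x powr - l + (Q * (C * norm x powr - g') + Q * c * (C * norm x powr - a))"
        using Q C K c by (subst (asm) ennreal_le_iff) auto
      also have "\<dots> \<le> K * norm x powr - g' + (Q * (C * norm x powr - g') + Q * c * (C * norm x powr - a)) + K * c * norm x powr - a"
        using K x0 g' c by (intro add_increasing2 add_right_mono mult_left_mono powr_mono) auto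
      also have "\<dots> = (C * Q + K) * (norm x powr - g' + c * norm x powr - a)"
        by (simp add: algebra_simps)
      finally show "u x \<le> (C * e powr (q - 1) * S + K) * (norm x powr - (g + a - b) + c * norm x powr - a)"
        by (simp add: Q_def g'_def mult_ac)
    qed
  qed
qed

end

section \<open>From boundedness to decay faster than the critical powers\<close>

context integrable_hardy_sobolev_system
begin

lemma u_tail_small:
  assumes e: "0 < e"
  shows "\<exists>R>0. \<forall>E. E \<subseteq> - ball 0 R \<longrightarrow> (\<integral>\<^sup>+ x. ennreal (u x powr (real DIM('a) / a)) * indicator E x \<partial>lborel) \<le> ennreal e"
proof -
  have "\<exists>k. (\<integral>\<^sup>+ x. ennreal (u x powr (real DIM('a) / a)) * indicator (- ball 0 (real k)) x \<partial>lborel) < ennreal e"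
  proof (intro nn_integral_decseq_small u_Lp)
    show "decseq (\<lambda>k. - ball (0::'a) (real k))" by (auto simp: decseq_def)
    show "(\<Inter>k. - ball (0::'a) (real k)) = {}"
    proof safe
      fix x :: 'a assume x: "x \<in> (\<Inter>k. - ball 0 (real k))"
      obtain k where "norm x < real k" using reals_Archimedean2 by blast
      moreover have "x \<in> - ball 0 (real k)" using x by blast
      ultimately show "x \<in> {}" by simp
    qed
  qed (use e in auto)
  then obtain k where k: "(\<integral>\<^sup>+ x. ennreal (u x powr (real DIM('a) / a)) * indicator (- ball 0 (real k)) x \<partial>lborel) < ennreal e" ..
  show ?thesis
  proof (intro exI[of _ "real k + 1"] conjI allI impI)
    fix E :: "'a set" assume E: "E \<subseteq> - ball 0 (real k + 1)"
    have "E \<subseteq> - ball 0 (real k)" using E by auto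
    then have "(\<integral>\<^sup>+ x. ennreal (u x powr (real DIM('a) / a)) * indicator E x \<partial>lborel)
      \<le> (\<integral>\<^sup>+ x. ennreal (u x powr (real DIM('a) / a)) * indicator (- ball 0 (real k)) x \<partial>lborel)"
      by (intro nn_integral_mono) (auto simp: indicator_def)
    then show "(\<integral>\<^sup>+ x. ennreal (u x powr (real DIM('a) / a)) * indicator E x \<partial>lborel) \<le> ennreal e"
      using k by simp
  qed auto
qed

text \<open>The radius \<open>\<theta> |x| / max 1 (T |x|)\<close> of the splitting balances the two parts of the potential: by criticality of
  \<open>a\<close> and \<open>b\<close> the superlinear dependence of the near part on \<open>T\<close> becomes linear in terms of \<open>u\<^sup>1\<^sup>/\<^sup>a\<close> and \<open>v\<^sup>1\<^sup>/\<^sup>b\<close>.\<close>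

lemma pointwise_step:
  assumes k: "0 < k"
  shows "\<exists>R>0. \<forall>x T. R \<le> norm x \<longrightarrow> 0 \<le> T \<longrightarrow> (\<forall>y. norm x / 2 \<le> norm y \<longrightarrow> v y \<le> T powr b) \<longrightarrow>
     u x \<le> (k * max (1 / norm x) T) powr a"
proof -
  define n where "n = real DIM('a)"
  obtain C1 where C1: "C1 > 0" and near: "\<forall>x \<rho> r M. 0 < \<rho> \<longrightarrow> 0 < r \<longrightarrow> r \<le> \<rho> \<longrightarrow> norm x = 2 * \<rho> \<longrightarrow> 0 \<le> M \<longrightarrow> (\<forall>y. \<rho> \<le> norm y \<longrightarrow> v y \<le> M) \<longrightarrow>
     riesz l (\<lambda>y. v y powr q * norm y powr - s1 * indicator (ball x r) y) x \<le> ennreal (C1 * M powr q * \<rho> powr - s1 * r powr (real DIM('a) - l))"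
    using riesz_near_le by (elim exE conjE) (rule that)
  define C2 where "C2 = (3 / 2) powr l * unit_ball_vol (real DIM('a)) powr - (a / real DIM('a)) * 2 powr a"
  have "unit_ball_vol (real DIM('a)) powr - (a / real DIM('a)) > 0"
    unfolding powr_gt_zero using unit_ball_vol_pos[OF of_nat_0_le_iff, of "DIM('a)"] by linarith
  then have C2: "C2 > 0" unfolding C2_def by (intro mult_pos_pos) auto
  have nl: "n - l > 0" using l by (simp add: n_def)
  \<comment> \<open>\<open>\<theta>\<close> makes the coefficient of the near part at most k^a / 2;
    \<open>e\<close>, which depends on \<open>\<theta>\<close>, then gives the far part the other
    half.\<close>
  define \<theta> where "\<theta> = min (1 / 2) ((k powr a / (2 * C1 * 2 powr s1)) powr (1 / (n - l)))"
  have \<theta>: "0 < \<theta>" "\<theta> \<le> 1 / 2" using k C1 by (auto simp: \<theta>_def)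
  have "\<theta> powr (n - l) \<le> ((k powr a / (2 * C1 * 2 powr s1)) powr (1 / (n - l))) powr (n - l)"
    using nl \<theta> by (intro powr_mono2) (auto simp: \<theta>_def)
  also have "\<dots> = k powr a / (2 * C1 * 2 powr s1)" using nl C1 by (simp add: powr_powr)
  finally have \<theta>1: "C1 * 2 powr s1 * \<theta> powr (n - l) \<le> k powr a / 2" using C1 by (simp add: field_simps)
  define e where "e = k powr a / (2 * C2 * \<theta> powr - a)"
  have e: "e > 0" using k C2 \<theta> by (simp add: e_def)
  have e1: "C2 * e * \<theta> powr - a = k powr a / 2" using C2 \<theta> by (simp add: e_def)
  obtain R where R: "R > 0" "\<forall>E. E \<subseteq> - ball 0 R \<longrightarrow> (\<integral>\<^sup>+ x. ennreal (u x powr (real DIM('a) / a)) * indicator E x \<partial>lborel) \<le> ennreal (e powr (real DIM('a) / a))"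
    using u_tail_small[of "e powr (real DIM('a) / a)"] e by auto
  show ?thesis
  proof (intro exI[of _ "2 * R"] conjI allI impI)
    fix x :: 'a and T :: real
    assume x: "2 * R \<le> norm x" and T: "0 \<le> T" and vT: "\<forall>y. norm x / 2 \<le> norm y \<longrightarrow> v y \<le> T powr b"
    define \<rho> where "\<rho> = norm x"
    have \<rho>: "\<rho> > 0" "2 * R \<le> \<rho>" using x R by (auto simp: \<rho>_def)
    define Y where "Y = max 1 (T * \<rho>)"
    have Y: "Y \<ge> 1" "T * \<rho> \<le> Y" by (auto simp: Y_def)
    define r where "r = \<theta> / Y * \<rho>"
    have r0: "0 < r" using \<theta> Y \<rho> by (simp add: r_def)
    have "\<theta> / Y \<le> \<theta> / 1" using Y \<theta> by (intro divide_left_mono) auto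
    then have "\<theta> / Y \<le> 1 / 2" using \<theta> by linarith
    then have "\<theta> / Y * \<rho> \<le> 1 / 2 * \<rho>" using \<rho> by (intro mult_right_mono) auto
    then have r1: "r \<le> \<rho> / 2" by (simp add: r_def)
    define f where "f y = v y powr q * norm y powr - s1" for y
    have [measurable]: "f \<in> borel_measurable borel" unfolding f_def by measurable
    have f0: "0 \<le> f y" for y by (simp add: f_def)
    have 1: "riesz l (\<lambda>y. f y * indicator (ball x r) y) x \<le> ennreal (C1 * (T powr b) powr q * (\<rho> / 2) powr - s1 * r powr (n - l))"
      unfolding f_def n_def
      using \<rho> r0 r1 vT by (intro near[rule_format]) (auto simp: \<rho>_def)
    have 2: "riesz l (\<lambda>y. f y * indicator (- ball x r) y) x \<le> ennreal (C2 * e * r powr - a)"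
      unfolding C2_def
    proof (rule riesz_far[where u = u])
      have "ball x (r / 2) \<subseteq> - ball 0 R"
      proof
        fix y assume "y \<in> ball x (r / 2)"
        then have "norm (x - y) < \<rho> / 2" using r1 r0 by (simp add: dist_norm)
        then have "\<rho> / 2 \<le> norm y" using norm_triangle_ineq[of "x - y" y] by (simp add: \<rho>_def)
        then show "y \<in> - ball 0 R" using \<rho> by simp
      qed
      then show "(\<integral>\<^sup>+ y. ennreal (u y powr (real DIM('a) / a)) * indicator (ball x (r / 2)) y \<partial>lborel) \<le> ennreal (e powr (real DIM('a) / a))"
        using R(2) by blast
    qed (use l a f0 u_pos r0 e u_eq in \<open>auto simp: f_def less_imp_le\<close>)
    have "ennreal (u x) = riesz l (\<lambda>y. f y * indicator (ball x r) y + f y * indicator (- ball x r) y) x"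
      unfolding u_eq f_def by (intro arg_cong2[of _ _ _ _ "riesz l"] refl ext) (auto simp: indicator_def)
    also have "\<dots> = riesz l (\<lambda>y. f y * indicator (ball x r) y) x + riesz l (\<lambda>y. f y * indicator (- ball x r) y) x"
      using f0 by (intro riesz_add) auto
    also have "\<dots> \<le> ennreal (C1 * (T powr b) powr q * (\<rho> / 2) powr - s1 * r powr (n - l)) + ennreal (C2 * e * r powr - a)"
      by (intro add_mono 1 2)
    also have "\<dots> = ennreal (C1 * (T powr b) powr q * (\<rho> / 2) powr - s1 * r powr (n - l) + C2 * e * r powr - a)"
      using C1 C2 e by (intro ennreal_plus[symmetric]) auto
    finally have le: "u x \<le> C1 * (T powr b) powr q * (\<rho> / 2) powr - s1 * r powr (n - l) + C2 * e * r powr - a"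
      using C1 C2 e by (subst (asm) ennreal_le_iff) auto
    have t2: "C2 * e * r powr - a = k powr a / 2 * (Y / \<rho>) powr a"
    proof -
      have "r powr - a = \<theta> powr - a * (Y / \<rho>) powr a"
        using \<theta> Y \<rho> by (simp add: r_def powr_mult powr_divide powr_minus field_simps)
      then show ?thesis using e1 by simp
    qed
    have t1: "C1 * (T powr b) powr q * (\<rho> / 2) powr - s1 * r powr (n - l) \<le> k powr a / 2 * (Y / \<rho>) powr a"
    proof -
      \<comment> \<open>By \<open>qb\<close> this is q b. The powers of \<rho> then add up to -a, as
        scaling demands, and the remaining exponent a - s1 of \<open>Y\<close> may be raised to a
        because Y >= 1.\<close>
      define m where "m = a + (n - l) - s1"
      have m: "m > 0" using s1 a by (simp add: m_def n_def)
      have "(T powr b) powr q = T powr m" using qb by (simp add: powr_powr m_def n_def mult.commute)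
      also have "\<dots> = (T * \<rho>) powr m * \<rho> powr - m" using \<rho> T by (simp add: powr_mult mult.assoc powr_add[symmetric])
      also have "\<dots> \<le> Y powr m * \<rho> powr - m" using Y T \<rho> m by (intro mult_right_mono powr_mono2) auto
      finally have Tm: "(T powr b) powr q \<le> Y powr m * \<rho> powr - m" .
      have h: "(\<rho> / 2) powr - s1 = 2 powr s1 * \<rho> powr - s1" using half_powr[of \<rho> "- s1"] \<rho> by simp
      have rr: "r powr (n - l) = \<theta> powr (n - l) * (Y powr - (n - l) * \<rho> powr (n - l))"
      proof -
        have "r powr z = \<theta> powr z * (Y powr - z * \<rho> powr z)" for z
          using \<theta> Y \<rho> by (simp add: r_def powr_mult powr_divide powr_minus field_simps)
        then show ?thesis .
      qed
      have "C1 * (T powr b) powr q * (\<rho> / 2) powr - s1 * r powr (n - l)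
        \<le> C1 * (Y powr m * \<rho> powr - m) * (2 powr s1 * \<rho> powr - s1) * (\<theta> powr (n - l) * (Y powr - (n - l) * \<rho> powr (n - l)))"
        unfolding h rr using Tm C1 by (intro mult_right_mono mult_left_mono) auto
      also have "\<dots> = C1 * 2 powr s1 * \<theta> powr (n - l) * ((Y powr m * Y powr - (n - l)) * (\<rho> powr - m * \<rho> powr - s1 * \<rho> powr (n - l)))"
        by (simp only: mult_ac)
      also have "\<rho> powr - m * \<rho> powr - s1 * \<rho> powr (n - l) = \<rho> powr - a"
        unfolding powr_add[symmetric] by (simp add: m_def)
      also have "Y powr m * Y powr - (n - l) = Y powr (a - s1)"
        unfolding powr_add[symmetric] by (simp add: m_def)
      also have "C1 * 2 powr s1 * \<theta> powr (n - l) * (Y powr (a - s1) * \<rho> powr - a) \<le> k powr a / 2 * (Y powr a * \<rho> powr - a)"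
      proof (rule mult_mono[OF \<theta>1])
        show "Y powr (a - s1) * \<rho> powr - a \<le> Y powr a * \<rho> powr - a"
          using Y s1 by (intro mult_right_mono powr_mono) auto
      qed auto
      also have "Y powr a * \<rho> powr - a = (Y / \<rho>) powr a"
        using Y \<rho> by (simp add: powr_divide powr_minus field_simps)
      finally show ?thesis .
    qed
    have "u x \<le> k powr a * (Y / \<rho>) powr a" using le t1 t2 by simp
    also have "Y / \<rho> = max (1 / norm x) T"
      using \<rho> by (auto simp: Y_def \<rho>_def max_def field_simps)
    also have "k powr a * max (1 / norm x) T powr a = (k * max (1 / norm x) T) powr a"
      by (simp only: powr_mult)
    finally show "u x \<le> (k * max (1 / norm x) T) powr a" .
  qed (use R in auto)
qed

text \<open>Doubling |x| costs a factor 2 in 1 / |x| but gains a factor \<kappa> <= 1/4 in the a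
  priori bound. After about log2 |x| steps the latter is of order |x|^-2, negligible against
  \<kappa> / |x|.\<close>

lemma slow_decay_small:
  assumes Bu: "\<And>x. u x \<le> B" and Bv: "\<And>x. v x \<le> B" and k: "0 < k"
  shows "\<exists>R\<ge>1. \<forall>x. R \<le> norm x \<longrightarrow> u x \<le> (k / norm x) powr a \<and> v x \<le> (k / norm x) powr b"
proof -
  interpret sw: integrable_hardy_sobolev_system v u l s2 s1 q p b a by (rule integrable_swap)
  define \<kappa> where "\<kappa> = min k (1 / 4)"
  have \<kappa>: "0 < \<kappa>" "\<kappa> \<le> k" "\<kappa> \<le> 1 / 4" using k by (auto simp: \<kappa>_def)
  obtain R1 where R1: "R1 > 0" "\<forall>x T. R1 \<le> norm x \<longrightarrow> 0 \<le> T \<longrightarrow> (\<forall>y. norm x / 2 \<le> norm y \<longrightarrow> v y \<le> T powr b) \<longrightarrow>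
     u x \<le> (\<kappa> * max (1 / norm x) T) powr a" using pointwise_step[OF \<kappa>(1)] by (elim exE conjE) (rule that)
  obtain R2 where R2: "R2 > 0" "\<forall>x T. R2 \<le> norm x \<longrightarrow> 0 \<le> T \<longrightarrow> (\<forall>y. norm x / 2 \<le> norm y \<longrightarrow> u y \<le> T powr a) \<longrightarrow>
     v x \<le> (\<kappa> * max (1 / norm x) T) powr b" using sw.pointwise_step[OF \<kappa>(1)] by (elim exE conjE) (rule that)
  define R where "R = max R1 R2"
  have R: "R > 0" "R1 \<le> R" "R2 \<le> R" using R1 by (auto simp: R_def)
  have B: "B > 0" using Bu[of 0] u_pos[of 0] by linarith
  define M where "M = max (B powr (1 / a)) (B powr (1 / b))"
  have M: "M > 0" using B by (simp add: M_def less_max_iff_disj)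
  have "B = (B powr (1 / a)) powr a" using a B by (simp add: powr_powr)
  also have "\<dots> \<le> M powr a" using a B by (intro powr_mono2) (auto simp: M_def)
  finally have Ma: "B \<le> M powr a" .
  have "B = (B powr (1 / b)) powr b" using b B by (simp add: powr_powr)
  also have "\<dots> \<le> M powr b" using b B by (intro powr_mono2) (auto simp: M_def)
  finally have Mb: "B \<le> M powr b" .
  have claim: "u x \<le> (max (\<kappa> / norm x) (M * \<kappa> ^ j)) powr a \<and> v x \<le> (max (\<kappa> / norm x) (M * \<kappa> ^ j)) powr b"
    if "2 ^ j * R \<le> norm x" for j x
    using that
  proof (induction j arbitrary: x)
    case 0
    have "M powr a \<le> (max (\<kappa> / norm x) M) powr a" "M powr b \<le> (max (\<kappa> / norm x) M) powr b"
      using a b M by (auto intro!: powr_mono2)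
    then show ?case using Bu[of x] Bv[of x] Ma Mb by auto
  next
    case (Suc j)
    have Rle: "1 * R \<le> 2 ^ Suc j * R" using R by (intro mult_right_mono one_le_power) auto
    have x0: "0 < norm x" "R \<le> norm x" using Suc.prems Rle R by linarith+
    define T where "T = max (2 * \<kappa> / norm x) (M * \<kappa> ^ j)"
    have T0: "0 \<le> T" using M \<kappa> by (simp add: T_def le_max_iff_disj)
    have y: "max (\<kappa> / norm y) (M * \<kappa> ^ j) \<le> T" "2 ^ j * R \<le> norm y" if "norm x / 2 \<le> norm y" for y :: 'a
    proof -
      have "\<kappa> / norm y \<le> \<kappa> / (norm x / 2)" using that x0 \<kappa> by (intro divide_left_mono mult_pos_pos) auto
      then have "\<kappa> / norm y \<le> 2 * \<kappa> / norm x" by (simp add: mult.commute)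
      then show "max (\<kappa> / norm y) (M * \<kappa> ^ j) \<le> T" unfolding T_def by auto
      show "2 ^ j * R \<le> norm y" using that Suc.prems by simp
    qed
    have y0: "0 \<le> max (\<kappa> / norm y) (M * \<kappa> ^ j)" for y :: 'a using \<kappa> by (simp add: le_max_iff_disj)
    have vT: "\<forall>y. norm x / 2 \<le> norm y \<longrightarrow> v y \<le> T powr b"
    proof (intro allI impI)
      fix y :: 'a assume ny: "norm x / 2 \<le> norm y"
      have "v y \<le> (max (\<kappa> / norm y) (M * \<kappa> ^ j)) powr b" using Suc.IH[OF y(2)[OF ny]] by simp
      also have "\<dots> \<le> T powr b" using y(1)[OF ny] y0 b by (intro powr_mono2) auto
      finally show "v y \<le> T powr b" .
    qed
    have uT: "\<forall>y. norm x / 2 \<le> norm y \<longrightarrow> u y \<le> T powr a"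
    proof (intro allI impI)
      fix y :: 'a assume ny: "norm x / 2 \<le> norm y"
      have "u y \<le> (max (\<kappa> / norm y) (M * \<kappa> ^ j)) powr a" using Suc.IH[OF y(2)[OF ny]] by simp
      also have "\<dots> \<le> T powr a" using y(1)[OF ny] y0 a by (intro powr_mono2) auto
      finally show "u y \<le> T powr a" .
    qed
    have "\<kappa> * max (1 / norm x) T \<le> max (\<kappa> / norm x) (M * \<kappa> ^ Suc j)"
    proof -
      \<comment> \<open>The doubling of \<kappa> / |x| in \<open>T\<close>, due to points y with |y|
        >= |x|/2, is absorbed by 1 / |x| because \<kappa> <= 1/2.\<close>
      have "2 * \<kappa> / norm x \<le> 1 / norm x" using \<kappa> x0 by (intro divide_right_mono) auto
      then have "max (1 / norm x) T = max (1 / norm x) (M * \<kappa> ^ j)" by (auto simp: T_def max_def)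
      then show ?thesis using \<kappa> by (simp add: max_mult_distrib_left mult_ac)
    qed
    moreover have "0 \<le> \<kappa> * max (1 / norm x) T" using \<kappa> T0 by (simp add: le_max_iff_disj)
    ultimately have "(\<kappa> * max (1 / norm x) T) powr a \<le> (max (\<kappa> / norm x) (M * \<kappa> ^ Suc j)) powr a"
      "(\<kappa> * max (1 / norm x) T) powr b \<le> (max (\<kappa> / norm x) (M * \<kappa> ^ Suc j)) powr b"
      using a b by (auto intro!: powr_mono2)
    moreover have "u x \<le> (\<kappa> * max (1 / norm x) T) powr a"
      using R1(2) vT T0 x0 R by (meson order_trans)
    moreover have "v x \<le> (\<kappa> * max (1 / norm x) T) powr b"
      using R2(2) uT T0 x0 R by (meson order_trans)
    ultimately show ?case by linarith
  qed
  \<comment> \<open>With |x| < 2^(j+1) R one has M \<kappa>^j <= 4 M R^2 / |x|^2; the threshold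
    makes this at most \<kappa> / |x|.\<close>
  define R' where "R' = max (max 1 R) (4 * M * R\<^sup>2 / \<kappa>)"
  have "u x \<le> (k / norm x) powr a \<and> v x \<le> (k / norm x) powr b" if x: "R' \<le> norm x" for x
  proof -
    have x1: "R \<le> norm x" "4 * M * R\<^sup>2 / \<kappa> \<le> norm x" "1 \<le> norm x" using x by (auto simp: R'_def)
    obtain j where j: "R * 2 ^ j \<le> norm x" "norm x < R * 2 ^ Suc j"
      using dyadic_above[OF R(1) x1(1)] by blast
    have "\<kappa> ^ j \<le> (1 / 4) ^ j" using \<kappa> by (intro power_mono) auto
    also have "(1 / 4 :: real) ^ j = ((1 / 2) ^ j)\<^sup>2" by (simp add: power2_eq_square power_mult_distrib[symmetric])
    also have "(1 / 2) ^ j \<le> 2 * R / norm x"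
    proof -
      have "0 < norm x" using x1 by linarith
      then show ?thesis using j(2) by (simp add: power_one_over field_simps)
    qed
    then have "((1 / 2) ^ j)\<^sup>2 \<le> (2 * R / norm x)\<^sup>2" by (intro power_mono) auto
    finally have "M * \<kappa> ^ j \<le> M * (2 * R / norm x)\<^sup>2" using M by (intro mult_left_mono) auto
    also have "\<dots> = (4 * M * R\<^sup>2 / \<kappa>) * \<kappa> / (norm x * norm x)"
      using \<kappa> by (simp add: power2_eq_square)
    also have "\<dots> \<le> norm x * \<kappa> / (norm x * norm x)"
      using x1 \<kappa> by (intro divide_right_mono mult_right_mono) auto
    also have "\<dots> = \<kappa> / norm x" using x1 by simp
    finally have m: "max (\<kappa> / norm x) (M * \<kappa> ^ j) = \<kappa> / norm x" by simp
    have "2 ^ j * R \<le> norm x" using j(1) by (simp add: mult.commute)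
    from claim[OF this] have "u x \<le> (\<kappa> / norm x) powr a" "v x \<le> (\<kappa> / norm x) powr b" unfolding m by auto
    moreover have "\<kappa> / norm x \<le> k / norm x" "0 \<le> \<kappa> / norm x" using \<kappa> by (auto intro: divide_right_mono)
    ultimately show ?thesis using a b by (meson order_trans powr_mono2 less_imp_le)
  qed
  moreover have "1 \<le> R'" by (simp add: R'_def)
  ultimately show ?thesis by blast
qed

text \<open>The contraction of \<open>weak_gain\<close>, now above the critical exponents and
  pointwise on |x| >= R; the a priori smallness is supplied by \<open>slow_decay_small\<close>,
  which relies on the boundedness of both functions.\<close>

lemma v_fast_decay_aux:
  assumes D: "b \<le> a" and Bu: "\<And>x. u x \<le> B" and Bv: "\<And>x. v x \<le> B" and g: "b < g" "g + a - b < l"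
  shows "\<exists>K>0. \<exists>R\<ge>1. \<forall>x. R \<le> norm x \<longrightarrow> v x \<le> K * norm x powr - g"
proof -
  interpret sw: integrable_hardy_sobolev_system v u l s2 s1 q p b a by (rule integrable_swap)
  define g' where "g' = g + a - b"
  have g0: "0 < g" "0 < g + a - b" using b g a by auto
  have g': "0 < g'" "0 < g' + b - a" "g' + b - a < l" "g' + b - a = g" using g D b a by (auto simp: g'_def)
  have B: "B > 0" using Bu[of 0] u_pos[of 0] by linarith
  obtain C1 where C1: "C1 > 0" and T1: "\<forall>B>0. (\<forall>x. v x \<le> B) \<longrightarrow> (\<forall>R\<ge>1. \<exists>K>0. \<forall>e S c. 0 < e \<longrightarrow> 0 < S \<longrightarrow> 0 < c \<longrightarrow>
     (\<forall>x. R \<le> norm x \<longrightarrow> v x \<le> e * norm x powr - b) \<longrightarrow>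
     (\<forall>x. R \<le> norm x \<longrightarrow> v x \<le> S * (norm x powr - g + c * norm x powr - b)) \<longrightarrow>
     (\<forall>x. R \<le> norm x \<longrightarrow> u x \<le> (C1 * e powr (q - 1) * S + K) * (norm x powr - (g + a - b) + c * norm x powr - a)))"
    using exterior_step[OF g0 g(2)] by (elim exE conjE) (rule that)
  obtain C2 where C2: "C2 > 0" and T2: "\<forall>B>0. (\<forall>x. u x \<le> B) \<longrightarrow> (\<forall>R\<ge>1. \<exists>K>0. \<forall>e S c. 0 < e \<longrightarrow> 0 < S \<longrightarrow> 0 < c \<longrightarrow>
     (\<forall>x. R \<le> norm x \<longrightarrow> u x \<le> e * norm x powr - a) \<longrightarrow>
     (\<forall>x. R \<le> norm x \<longrightarrow> u x \<le> S * (norm x powr - g' + c * norm x powr - a)) \<longrightarrow>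
     (\<forall>x. R \<le> norm x \<longrightarrow> v x \<le> (C2 * e powr (p - 1) * S + K) * (norm x powr - (g' + b - a) + c * norm x powr - b)))"
    using sw.exterior_step[OF g'(1-3)] by (elim exE conjE) (rule that)
  obtain e where e: "0 < e" and e1: "C1 * e powr (q - 1) \<le> 1 / 2" and e2: "C2 * e powr (p - 1) \<le> 1 / 2"
    using ex_small_powr_coeff[OF C1 C2 p q] by blast
  define k where "k = min (e powr (1 / a)) (e powr (1 / b))"
  have k: "k > 0" using e by (simp add: k_def)
  have "k powr a \<le> (e powr (1 / a)) powr a" using a k by (intro powr_mono2) (auto simp: k_def)
  then have ka: "k powr a \<le> e" using a e by (simp add: powr_powr)
  have "k powr b \<le> (e powr (1 / b)) powr b" using b k by (intro powr_mono2) (auto simp: k_def)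
  then have kb: "k powr b \<le> e" using b e by (simp add: powr_powr)
  obtain R where R: "R \<ge> 1" "\<forall>x. R \<le> norm x \<longrightarrow> u x \<le> (k / norm x) powr a \<and> v x \<le> (k / norm x) powr b"
    using slow_decay_small[OF Bu Bv k] by blast
  have ue: "\<forall>x. R \<le> norm x \<longrightarrow> u x \<le> e * norm x powr - a"
  proof (intro allI impI)
    fix x :: 'a assume x: "R \<le> norm x"
    then have "u x \<le> k powr a * norm x powr - a" using R k by (simp add: powr_divide powr_minus_divide)
    also have "\<dots> \<le> e * norm x powr - a" by (intro mult_right_mono ka) auto
    finally show "u x \<le> e * norm x powr - a" .
  qed
  have ve: "\<forall>x. R \<le> norm x \<longrightarrow> v x \<le> e * norm x powr - b"
  proof (intro allI impI)
    fix x :: 'a assume x: "R \<le> norm x"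
    then have "v x \<le> k powr b * norm x powr - b" using R k by (simp add: powr_divide powr_minus_divide)
    also have "\<dots> \<le> e * norm x powr - b" by (intro mult_right_mono kb) auto
    finally show "v x \<le> e * norm x powr - b" .
  qed
  obtain K1 where K1: "K1 > 0" and T1_raw: "\<forall>e S c. 0 < e \<longrightarrow> 0 < S \<longrightarrow> 0 < c \<longrightarrow>
     (\<forall>x. R \<le> norm x \<longrightarrow> v x \<le> e * norm x powr - b) \<longrightarrow>
     (\<forall>x. R \<le> norm x \<longrightarrow> v x \<le> S * (norm x powr - g + c * norm x powr - b)) \<longrightarrow>
     (\<forall>x. R \<le> norm x \<longrightarrow> u x \<le> (C1 * e powr (q - 1) * S + K1) * (norm x powr - (g + a - b) + c * norm x powr - a))"
    using T1[THEN spec, THEN mp, OF B, THEN mp, OF allI, OF Bv, THEN spec, THEN mp, OF R(1)] by (elim exE conjE) (rule that)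
  note T1' = T1_raw[folded g'_def, THEN spec, THEN spec, THEN spec, THEN mp, THEN mp, THEN mp, THEN mp, THEN mp]
  obtain K2 where K2: "K2 > 0" and T2_raw: "\<forall>e S c. 0 < e \<longrightarrow> 0 < S \<longrightarrow> 0 < c \<longrightarrow>
     (\<forall>x. R \<le> norm x \<longrightarrow> u x \<le> e * norm x powr - a) \<longrightarrow>
     (\<forall>x. R \<le> norm x \<longrightarrow> u x \<le> S * (norm x powr - g' + c * norm x powr - a)) \<longrightarrow>
     (\<forall>x. R \<le> norm x \<longrightarrow> v x \<le> (C2 * e powr (p - 1) * S + K2) * (norm x powr - (g' + b - a) + c * norm x powr - b))"
    using T2[THEN spec, THEN mp, OF B, THEN mp, OF allI, OF Bu, THEN spec, THEN mp, OF R(1)] by (elim exE conjE) (rule that)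
  note T2' = T2_raw[unfolded g'(4), THEN spec, THEN spec, THEN spec, THEN mp, THEN mp, THEN mp, THEN mp, THEN mp]
  define K where "K = max K1 K2"
  have K: "K > 0" "K1 \<le> K" "K2 \<le> K" using K1 by (auto simp: K_def)
  define P where "P c S \<longleftrightarrow> (\<forall>x. R \<le> norm x \<longrightarrow> v x \<le> S * (norm x powr - g + c * norm x powr - b))
     \<and> (\<forall>x. R \<le> norm x \<longrightarrow> u x \<le> S * (norm x powr - g' + c * norm x powr - a))" for c S
  have Pmono: "P c S'" if P: "P c S" and "S \<le> S'" "0 < c" for c S S'
  proof -
    have le: "S * (t powr - x + c * t powr - y) \<le> S' * (t powr - x + c * t powr - y)" for t x y :: real
      using \<open>S \<le> S'\<close> \<open>0 < c\<close> by (intro mult_right_mono add_nonneg_nonneg) auto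
    show ?thesis using P unfolding P_def by (meson le order_trans)
  qed
  have Pstep: "P c (S / 2 + K)" if P: "P c S" and S: "0 < S" and c: "0 < c" for c S
  proof -
    have "C2 * e powr (p - 1) * S \<le> 1 / 2 * S" using e2 S by (intro mult_right_mono) auto
    then have "C2 * e powr (p - 1) * S + K2 \<le> S / 2 + K" using K by simp
    then have le2: "(C2 * e powr (p - 1) * S + K2) * (t powr - g + c * t powr - b) \<le> (S / 2 + K) * (t powr - g + c * t powr - b)" for t
      using c by (intro mult_right_mono add_nonneg_nonneg) auto
    have "C1 * e powr (q - 1) * S \<le> 1 / 2 * S" using e1 S by (intro mult_right_mono) auto
    then have "C1 * e powr (q - 1) * S + K1 \<le> S / 2 + K" using K by simp
    then have le1: "(C1 * e powr (q - 1) * S + K1) * (t powr - g' + c * t powr - a) \<le> (S / 2 + K) * (t powr - g' + c * t powr - a)" for t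
      using c by (intro mult_right_mono add_nonneg_nonneg) auto
    note v' = T2'[OF e S c ue conjunct2[OF P[unfolded P_def]]]
    note u' = T1'[OF e S c ve conjunct1[OF P[unfolded P_def]]]
    show ?thesis unfolding P_def using u' v' le1 le2 by (meson order_trans)
  qed
  have P3: "P c (3 * K)" if c: "0 < c" for c
  proof (rule halving_iteration[where P = "P c" and T = "e / c", OF K(1)])
    show "0 < e / c" using e c by simp
    have le: "e * t powr - y \<le> (e / c) * (t powr - x + c * t powr - y)" for t x y :: real
      using e c by (auto simp: field_simps)
    show "P c (e / c)" unfolding P_def using ue ve le by (meson order_trans)
  qed (rule Pmono[OF _ _ c], assumption+, rule Pstep[OF _ _ c], assumption+)
  have "v x \<le> 3 * K * norm x powr - g" if x: "R \<le> norm x" for x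
  proof (rule field_le_epsilon)
    fix d :: real assume d: "0 < d"
    \<comment> \<open>For fixed \<open>x\<close> this makes the contribution of the second barrier
      term exactly \<open>d\<close>.\<close>
    define c where "c = d / (3 * K * norm x powr - b)"
    have x0: "0 < norm x" using x R by linarith
    have c: "0 < c" using d K x0 by (simp add: c_def)
    have "v x \<le> 3 * K * (norm x powr - g + c * norm x powr - b)" using P3[OF c] x unfolding P_def by blast
    also have "\<dots> = 3 * K * norm x powr - g + d" using K x0 by (simp add: c_def field_simps)
    finally show "v x \<le> 3 * K * norm x powr - g + d" .
  qed
  then show ?thesis using K R by (intro exI[of _ "3 * K"] exI[of _ R] conjI) auto
qed

text \<open>By \<open>qb\<close>, q (l - a + b) - (n - s1) = (q - 1)(l - a) > 0: the exponents
  allowed by \<open>v_fast_decay_aux\<close> reach beyond the one at which the source of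
  \<open>u\<close> becomes integrable at infinity.\<close>

lemma v_fast_decay:
  assumes D: "b \<le> a" and Bu: "\<And>x. u x \<le> B" and Bv: "\<And>x. v x \<le> B"
  shows "\<exists>g K R. real DIM('a) < q * g + s1 \<and> 0 < g \<and> 0 < K \<and> 1 \<le> R \<and> (\<forall>x. R \<le> norm x \<longrightarrow> v x \<le> K * norm x powr - g)"
proof -
  \<comment> \<open>\<open>m\<close> is the larger of the two lower bounds on the exponent, and
    \<open>g\<close> is the midpoint between \<open>m\<close> and the upper bound l - a + b.\<close>
  define m where "m = max b ((real DIM('a) - s1) / q)"
  define g where "g = (m + (l - a + b)) / 2"
  have al: "a < l" using ab b by simp
  have "(q - 1) * (l - a) > 0" using q al by simp
  then have "real DIM('a) - s1 < q * (l - a + b)" using qb by (simp add: algebra_simps)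
  then have "(real DIM('a) - s1) / q < l - a + b" using q by (simp add: field_simps)
  then have m: "m < l - a + b" using al by (simp add: m_def)
  then have g: "m < g" "g < l - a + b" by (auto simp: g_def)
  then have "b < g" "g + a - b < l" "(real DIM('a) - s1) / q < g" by (auto simp: m_def)
  moreover from this have "real DIM('a) < q * g + s1" using q by (simp add: field_simps)
  moreover have "0 < g" using b \<open>b < g\<close> by simp
  ultimately show ?thesis using v_fast_decay_aux[OF D Bu Bv, of g] by blast
qed

end

section \<open>Sharp asymptotics\<close>

text \<open>For the critical power -n all dyadic shells have comparable mass, so the integral counts
  shells.\<close>

lemma nn_integral_norm_powr_shell_log_upper:
  "(\<integral>\<^sup>+ (y::'a::euclidean_space). ennreal (norm y powr - real DIM('a)) * indicator (ball 0 (2 ^ N) - ball 0 1) y \<partial>lborel)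
     \<le> ennreal (real N * (unit_ball_vol (real DIM('a)) * 2 ^ DIM('a)))"
proof (induction N)
  case (Suc N)
  define w where "w = unit_ball_vol (real DIM('a))"
  have w: "w > 0" unfolding w_def by simp
  have "(\<integral>\<^sup>+ (y::'a). ennreal (norm y powr - real DIM('a)) * indicator (ball 0 (2 ^ Suc N) - ball 0 1) y \<partial>lborel)
    \<le> (\<integral>\<^sup>+ (y::'a). ennreal (norm y powr - real DIM('a)) * indicator (ball 0 (2 ^ N) - ball 0 1) y
       + ennreal ((2 ^ N) powr - real DIM('a)) * indicator (ball 0 (2 ^ Suc N)) y \<partial>lborel)"
  proof (intro nn_integral_mono)
    fix y :: 'a
    have "norm y powr - real DIM('a) \<le> (2 ^ N) powr - real DIM('a)" if "y \<notin> ball 0 (2 ^ N)"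
      using that by (intro powr_mono2') auto
    then show "ennreal (norm y powr - real DIM('a)) * indicator (ball 0 (2 ^ Suc N) - ball 0 1) y
      \<le> ennreal (norm y powr - real DIM('a)) * indicator (ball 0 (2 ^ N) - ball 0 1) y
       + ennreal ((2 ^ N) powr - real DIM('a)) * indicator (ball 0 (2 ^ Suc N)) y"
      by (cases "y \<in> ball 0 (2 ^ N)") (auto simp: indicator_def intro: ennreal_leI)
  qed
  also have "\<dots> = (\<integral>\<^sup>+ (y::'a). ennreal (norm y powr - real DIM('a)) * indicator (ball 0 (2 ^ N) - ball 0 1) y \<partial>lborel)
       + ennreal ((2 ^ N) powr - real DIM('a)) * ennreal (w * (2 ^ Suc N) ^ DIM('a))"
    by (subst nn_integral_add) (auto simp: nn_integral_cmult_indicator emeasure_ball w_def)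
  also have "ennreal ((2 ^ N) powr - real DIM('a)) * ennreal (w * (2 ^ Suc N) ^ DIM('a)) = ennreal (w * 2 ^ DIM('a))"
    using w by (simp add: ennreal_mult[symmetric] powr_minus powr_realpow power_mult_distrib field_simps)
  also have "(\<integral>\<^sup>+ (y::'a). ennreal (norm y powr - real DIM('a)) * indicator (ball 0 (2 ^ N) - ball 0 1) y \<partial>lborel) + ennreal (w * 2 ^ DIM('a))
     \<le> ennreal (real N * (w * 2 ^ DIM('a))) + ennreal (w * 2 ^ DIM('a))"
    using Suc by (intro add_right_mono) (simp add: w_def)
  also have "\<dots> = ennreal (real N * (w * 2 ^ DIM('a)) + w * 2 ^ DIM('a))"
    using w by (intro ennreal_plus[symmetric]) auto
  finally show ?case by (simp add: w_def algebra_simps)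
qed simp

text \<open>A shell has at least half the volume of its outer ball, because 2^n >= 2, and on it the
  integrand is at least its value at the outer radius; each shell therefore contributes at least
  half of \<open>unit_ball_vol\<close>.\<close>

lemma nn_integral_norm_powr_shell_log_lower:
  "ennreal (real N * (unit_ball_vol (real DIM('a)) / 2))
    \<le> (\<integral>\<^sup>+ (y::'a::euclidean_space). ennreal (norm y powr - real DIM('a)) * indicator (ball 0 (2 ^ N) - ball 0 1) y \<partial>lborel)"
proof (induction N)
  case (Suc N)
  define w where "w = unit_ball_vol (real DIM('a))"
  have w: "w > 0" unfolding w_def by simp
  have em: "emeasure lborel (ball (0::'a) (2 ^ Suc N) - ball 0 (2 ^ N)) = ennreal (w * (2 ^ Suc N) ^ DIM('a) - w * (2 ^ N) ^ DIM('a))"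
  proof -
    have "emeasure lborel (ball (0::'a) (2 ^ Suc N) - ball 0 (2 ^ N)) = emeasure lborel (ball (0::'a) (2 ^ Suc N)) - emeasure lborel (ball (0::'a) (2 ^ N))"
      by (rule emeasure_Diff) (auto simp: emeasure_ball intro!: subset_ball)
    also have "\<dots> = ennreal (w * (2 ^ Suc N) ^ DIM('a)) - ennreal (w * (2 ^ N) ^ DIM('a))"
      by (simp add: emeasure_ball w_def)
    finally show ?thesis using w by (simp add: ennreal_minus)
  qed
  have "(2::real) ^ 1 \<le> 2 ^ DIM('a)" by (intro power_increasing) (auto simp: Suc_leI)
  then have two: "2 \<le> (2::real) ^ DIM('a)" by simp
  have "ennreal (w / 2) \<le> ennreal ((2 ^ Suc N) powr - real DIM('a)) * ennreal (w * (2 ^ Suc N) ^ DIM('a) - w * (2 ^ N) ^ DIM('a))"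
  proof -
    have "(2 ^ Suc N) ^ DIM('a) = 2 ^ DIM('a) * ((2::real) ^ N) ^ DIM('a)" by (simp add: power_mult_distrib)
    moreover have "2 * ((2::real) ^ N) ^ DIM('a) \<le> 2 ^ DIM('a) * (2 ^ N) ^ DIM('a)" using two by (intro mult_right_mono) auto
    ultimately have "2 * ((2::real) ^ N) ^ DIM('a) \<le> (2 ^ Suc N) ^ DIM('a)" by simp
    then have "w * (2 * ((2::real) ^ N) ^ DIM('a)) \<le> w * (2 ^ Suc N) ^ DIM('a)" using w by (intro mult_left_mono) auto
    then have "w / 2 * (2 ^ Suc N) ^ DIM('a) \<le> w * (2 ^ Suc N) ^ DIM('a) - w * (2 ^ N) ^ DIM('a)" by linarith
    then have "(2 ^ Suc N) powr - real DIM('a) * (w / 2 * (2 ^ Suc N) ^ DIM('a)) \<le> (2 ^ Suc N) powr - real DIM('a) * (w * (2 ^ Suc N) ^ DIM('a) - w * (2 ^ N) ^ DIM('a))"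
      by (intro mult_left_mono) auto
    moreover have "(2 ^ Suc N) powr - real DIM('a) * (2 ^ Suc N) ^ DIM('a) = (1::real)"
      using powr_realpow[of "2 ^ Suc N" "DIM('a)"] by (simp add: powr_minus del: power_Suc)
    ultimately have "w / 2 \<le> (2 ^ Suc N) powr - real DIM('a) * (w * (2 ^ Suc N) ^ DIM('a) - w * (2 ^ N) ^ DIM('a))"
      by (simp only: mult.left_commute mult_1_right)
    then show ?thesis using w by (subst ennreal_mult'[symmetric]) (auto intro: ennreal_leI simp del: power_Suc)
  qed
  also have "\<dots> = (\<integral>\<^sup>+ (y::'a). ennreal ((2 ^ Suc N) powr - real DIM('a)) * indicator (ball 0 (2 ^ Suc N) - ball 0 (2 ^ N)) y \<partial>lborel)"
    by (subst nn_integral_cmult_indicator) (simp_all only: em, measurable)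
  finally have step: "ennreal (w / 2) \<le> \<dots>" .
  have "ennreal (real (Suc N) * (w / 2)) = ennreal (real N * (w / 2)) + ennreal (w / 2)"
  proof -
    have "real (Suc N) * (w / 2) = real N * (w / 2) + w / 2" by (simp add: algebra_simps add_divide_distrib)
    then show ?thesis using w by (simp only:) (intro ennreal_plus; simp)
  qed
  also have "\<dots> \<le> (\<integral>\<^sup>+ (y::'a). ennreal (norm y powr - real DIM('a)) * indicator (ball 0 (2 ^ N) - ball 0 1) y \<partial>lborel)
    + (\<integral>\<^sup>+ (y::'a). ennreal ((2 ^ Suc N) powr - real DIM('a)) * indicator (ball 0 (2 ^ Suc N) - ball 0 (2 ^ N)) y \<partial>lborel)"
    using Suc step by (intro add_mono) (simp_all add: w_def)
  also have "\<dots> = (\<integral>\<^sup>+ (y::'a). ennreal (norm y powr - real DIM('a)) * indicator (ball 0 (2 ^ N) - ball 0 1) y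
       + ennreal ((2 ^ Suc N) powr - real DIM('a)) * indicator (ball 0 (2 ^ Suc N) - ball 0 (2 ^ N)) y \<partial>lborel)"
    by (rule nn_integral_add[symmetric]) measurable
  also have "\<dots> \<le> (\<integral>\<^sup>+ (y::'a). ennreal (norm y powr - real DIM('a)) * indicator (ball 0 (2 ^ Suc N) - ball 0 1) y \<partial>lborel)"
  proof (intro nn_integral_mono)
    fix y :: 'a
    have sub: "ball (0::'a) 1 \<subseteq> ball 0 (2 ^ N)" "ball (0::'a) (2 ^ N) \<subseteq> ball 0 (2 ^ Suc N)"
      by (auto intro!: subset_ball)
    have "(2 ^ Suc N) powr - real DIM('a) \<le> norm y powr - real DIM('a)" if "y \<in> ball 0 (2 ^ Suc N)" "y \<notin> ball 0 (2 ^ N)"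
    proof -
      have "(2::real) ^ N \<le> norm y" using that by simp
      moreover have "(0::real) < 2 ^ N" by simp
      ultimately have "0 < norm y" by linarith
      then show ?thesis using that by (intro powr_mono2') auto
    qed
    then show "ennreal (norm y powr - real DIM('a)) * indicator (ball 0 (2 ^ N) - ball 0 1) y
       + ennreal ((2 ^ Suc N) powr - real DIM('a)) * indicator (ball 0 (2 ^ Suc N) - ball 0 (2 ^ N)) y
      \<le> ennreal (norm y powr - real DIM('a)) * indicator (ball 0 (2 ^ Suc N) - ball 0 1) y"
      using sub by (cases "y \<in> ball 0 (2 ^ N)"; cases "y \<in> ball 0 (2 ^ Suc N)")
        (auto simp: indicator_def simp del: power_Suc mem_ball_0 mem_ball intro!: ennreal_leI)
  qed
  finally show ?case by (simp add: w_def)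
qed simp

text \<open>Boundedness handles \<open>ball 0 R\<close>; outside, m > a turns into an exponent m n /
  a > n.\<close>

lemma powr_integrable_of_decay:
  fixes w :: "'a::euclidean_space \<Rightarrow> real"
  assumes [measurable]: "w \<in> borel_measurable borel" and w0: "\<And>x. 0 \<le> w x" and B: "\<And>x. w x \<le> B"
    and a: "0 < a" "a < m" and R: "0 < R" and dec: "\<And>x. R \<le> norm x \<Longrightarrow> w x \<le> C * norm x powr - m"
  shows "(\<integral>\<^sup>+ x. ennreal (w x powr (real DIM('a) / a)) \<partial>lborel) < \<infinity>"
proof -
  define z where "z = real DIM('a) / a"
  have z: "z > 0" using a by (simp add: z_def)
  have "1 * real DIM('a) < m / a * real DIM('a)" using a by (intro mult_strict_right_mono) auto
  then have mz: "real DIM('a) < m * z" by (simp add: z_def)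
  obtain K where K: "K > 0" "\<forall>r>0. (\<integral>\<^sup>+ (y::'a). ennreal (norm y powr - (m * z)) * indicator (- ball 0 r) y \<partial>lborel)
            \<le> ennreal (K * r powr (real DIM('a) - m * z))"
    using nn_integral_norm_powr_compl_ball[OF mz] by blast
  have "(\<integral>\<^sup>+ x. ennreal (w x powr z) \<partial>lborel) \<le> (\<integral>\<^sup>+ (x::'a). ennreal (B powr z) * indicator (ball 0 R) x
      + ennreal (\<bar>C\<bar> powr z) * (ennreal (norm x powr - (m * z)) * indicator (- ball 0 R) x) \<partial>lborel)"
  proof (intro nn_integral_mono)
    fix x
    show "ennreal (w x powr z) \<le> ennreal (B powr z) * indicator (ball 0 R) x
      + ennreal (\<bar>C\<bar> powr z) * (ennreal (norm x powr - (m * z)) * indicator (- ball 0 R) x)"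
    proof (cases "x \<in> ball 0 R")
      case True
      then show ?thesis using B[of x] w0[of x] z by (auto intro!: ennreal_leI powr_mono2)
    next
      case False
      then have "w x \<le> C * norm x powr - m" by (intro dec) auto
      also have "\<dots> \<le> \<bar>C\<bar> * norm x powr - m" by (intro mult_right_mono) auto
      finally have "w x powr z \<le> (\<bar>C\<bar> * norm x powr - m) powr z" using w0[of x] z by (intro powr_mono2) auto
      also have "\<dots> = \<bar>C\<bar> powr z * norm x powr - (m * z)" by (simp add: powr_mult powr_powr)
      finally show ?thesis using False by (simp add: ennreal_mult[symmetric] ennreal_leI)
    qed
  qed
  also have "\<dots> = ennreal (B powr z) * emeasure lborel (ball (0::'a) R)
      + ennreal (\<bar>C\<bar> powr z) * (\<integral>\<^sup>+ (x::'a). ennreal (norm x powr - (m * z)) * indicator (- ball 0 R) x \<partial>lborel)"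
    by (simp add: nn_integral_add nn_integral_cmult nn_integral_cmult_indicator)
  also have "\<dots> \<le> ennreal (B powr z) * emeasure lborel (ball (0::'a) R) + ennreal (\<bar>C\<bar> powr z) * ennreal (K * R powr (real DIM('a) - m * z))"
    using K R by (intro add_left_mono mult_left_mono) auto
  also have "\<dots> < \<infinity>" using R by (simp add: emeasure_ball ennreal_mult_less_top)
  finally show ?thesis by (simp add: z_def)
qed

section \<open>Mass of the source in balls: lower and upper bounds for solutions\<close>

context hardy_sobolev_system
begin

text \<open>Points of the unit ball are at distance at most 1 + |x| from \<open>x\<close>, so the
  source there acts at least like its mass \<open>I\<close> placed at that distance.
  \<open>I\<close> is finite because the inequality at x = 0 bounds it by \<open>u 0\<close>, and
  positive because the source vanishes only at the origin.\<close>

lemma u_lower: "\<exists>c>0. \<forall>x. c * (1 + norm x) powr - l \<le> u x"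
proof -
  define f where "f y = v y powr q * norm y powr - s1" for y
  have [measurable]: "f \<in> borel_measurable borel" unfolding f_def by measurable
  define I where "I = (\<integral>\<^sup>+ y. ennreal (f y) * indicator (ball 0 1) y \<partial>lborel)"
  have le: "ennreal ((1 + norm x) powr - l) * I \<le> ennreal (u x)" for x
  proof -
    have "ennreal ((1 + norm x) powr - l) * I = (\<integral>\<^sup>+ y. ennreal ((1 + norm x) powr - l) * (ennreal (f y) * indicator (ball 0 1) y) \<partial>lborel)"
      unfolding I_def by (rule nn_integral_cmult[symmetric]) measurable
    also have "\<dots> \<le> riesz l f x"
      unfolding riesz_def
    proof (intro nn_integral_mono_AE)
      \<comment> \<open>The point \<open>y = x\<close> must be excluded: there
        \<open>norm (x - y) powr - l\<close> is 0 and the lower bound fails.\<close>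
      have "AE y in lborel. y \<noteq> x" by (rule AE_lborel_singleton)
      then show "AE y in lborel. ennreal ((1 + norm x) powr - l) * (ennreal (f y) * indicator (ball 0 1) y) \<le> ennreal (f y * norm (x - y) powr - l)"
      proof eventually_elim
        case (elim y)
        show ?case
        proof (cases "y \<in> ball 0 1")
          case True
          then have "norm (x - y) \<le> 1 + norm x" using norm_triangle_ineq4[of x y] by simp
          then have "(1 + norm x) powr - l \<le> norm (x - y) powr - l" using elim l by (intro powr_mono2') auto
          then have "f y * (1 + norm x) powr - l \<le> f y * norm (x - y) powr - l" by (intro mult_left_mono) (auto simp: f_def)
          then show ?thesis using True by (simp add: ennreal_mult'[symmetric] f_def mult.commute ennreal_leI)
        qed auto
      qed
    qed
    also have "\<dots> = ennreal (u x)" using u_eq[of x] by (simp add: f_def[abs_def])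
    finally show ?thesis .
  qed
  have "I \<le> ennreal (u 0)" using le[of 0] by simp
  then have "I < \<infinity>" by (simp add: le_less_trans)
  then obtain i where i: "I = ennreal i" "0 \<le> i" by (cases I) auto
  have "I \<noteq> 0"
  proof
    assume "I = 0"
    then have "emeasure lborel {y \<in> space lborel. ennreal (f y) * indicator (ball 0 1) y \<noteq> 0} = 0"
      unfolding I_def by (subst (asm) nn_integral_0_iff) measurable
    also have "{y \<in> space lborel. ennreal (f y) * indicator (ball 0 1) y \<noteq> 0} = ball 0 1 - {0}"
      using v_pos by (auto simp: f_def indicator_def less_le)
    also have "emeasure lborel (ball 0 1 - {0::'a}) = emeasure lborel (ball (0::'a) 1)"
      by (rule emeasure_Diff_null_set) auto
    finally show False using unit_ball_vol_pos[OF of_nat_0_le_iff, of "DIM('a)"] by (simp add: emeasure_ball)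
  qed
  then have i0: "0 < i" using i by (cases "i = 0") auto
  have "i * (1 + norm x) powr - l \<le> u x" for x
  proof -
    have "ennreal (i * (1 + norm x) powr - l) \<le> ennreal (u x)"
      using le[of x] i by (simp add: ennreal_mult mult.commute)
    then show ?thesis using u_pos[of x] by (subst (asm) ennreal_le_iff) auto
  qed
  then show ?thesis using i0 by blast
qed

lemma u_lower_powr: "\<exists>c>0. \<forall>x. 1 \<le> norm x \<longrightarrow> c * norm x powr - l \<le> u x"
proof -
  obtain c where c: "c > 0" "\<forall>x. c * (1 + norm x) powr - l \<le> u x" using u_lower by blast
  have "c * 2 powr - l * norm x powr - l \<le> u x" if x: "1 \<le> norm x" for x
  proof -
    have "2 powr - l * norm x powr - l = (2 * norm x) powr - l" by (simp only: powr_mult)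
    also have "\<dots> \<le> (1 + norm x) powr - l" using x l by (intro powr_mono2') auto
    finally have "c * (2 powr - l * norm x powr - l) \<le> c * (1 + norm x) powr - l" using c by (intro mult_left_mono) auto
    then show ?thesis using c(2)[rule_format, of x] by (simp add: mult.assoc)
  qed
  then show ?thesis using c by (intro exI[of _ "c * 2 powr - l"]) auto
qed

text \<open>The bound \<open>M\<close> on the mass in balls is left abstract: taken constant,
  logarithmic or as a power, it produces each of the decay regimes.\<close>

lemma u_upper:
  assumes B: "\<And>x. v x \<le> B" and R: "1 \<le> R" and K: "0 < K" and dec: "\<And>x. R \<le> norm x \<Longrightarrow> v x \<le> K * norm x powr - g"
    and h: "real DIM('a) - l < q * g + s1"
    and M: "\<And>r. 1 \<le> r \<Longrightarrow> (\<integral>\<^sup>+ y. ennreal (v y powr q * norm y powr - s1) * indicator (ball 0 r) y \<partial>lborel) \<le> ennreal (M r)" "\<And>r. 0 \<le> M r"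
  shows "\<exists>C>0. \<forall>x. 2 * R \<le> norm x \<longrightarrow> u x \<le> C * (norm x powr - l * M (norm x) + norm x powr (real DIM('a) - l - (q * g + s1)))"
proof -
  define h where "h = q * g + s1"
  have h': "real DIM('a) - l < h" using h by (simp add: h_def)
  obtain C1 where C1: "C1 > 0" and U_raw: "\<forall>f (x::'a) F. f \<in> borel_measurable borel \<longrightarrow> (\<forall>y. 0 \<le> f y) \<longrightarrow> x \<noteq> 0 \<longrightarrow> 0 \<le> F \<longrightarrow>
     (\<forall>y. norm x / 2 \<le> norm y \<longrightarrow> f y \<le> F * norm y powr - h) \<longrightarrow>
     riesz l f x \<le> ennreal (C1 * norm x powr - l) * (\<integral>\<^sup>+ y. ennreal (f y) * indicator (ball 0 (norm x / 2)) y \<partial>lborel)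
        + ennreal (C1 * F * norm x powr (real DIM('a) - l - h))"
    using riesz_upper[OF l h'] by (elim exE conjE) (rule that)
  define f where "f y = v y powr q * norm y powr - s1" for y
  have [measurable]: "f \<in> borel_measurable borel" unfolding f_def by measurable
  define C where "C = max C1 (C1 * K powr q)"
  have C: "C > 0" "C1 \<le> C" "C1 * K powr q \<le> C" using C1 by (auto simp: C_def less_max_iff_disj)
  have "u x \<le> C * (norm x powr - l * M (norm x) + norm x powr (real DIM('a) - l - h))" if x: "2 * R \<le> norm x" for x
  proof -
    have x0: "x \<noteq> 0" "1 \<le> norm x" using x R by auto
    have "ennreal (u x) = riesz l f x" using u_eq[of x] by (simp add: f_def[abs_def])
    also have "\<dots> \<le> ennreal (C1 * norm x powr - l) * (\<integral>\<^sup>+ y. ennreal (f y) * indicator (ball 0 (norm x / 2)) y \<partial>lborel)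
        + ennreal (C1 * K powr q * norm x powr (real DIM('a) - l - h))"
    proof (intro U_raw[rule_format])
      fix y :: 'a assume y: "norm x / 2 \<le> norm y"
      then have "v y \<le> K * norm y powr - g" using x by (intro dec) auto
      then have "f y \<le> (K * norm y powr - g) powr q * norm y powr - s1"
        unfolding f_def using v_pos[of y] q by (intro mult_right_mono powr_mono2) auto
      also have "\<dots> = K powr q * (norm y powr (- g * q) * norm y powr - s1)"
        by (simp only: powr_mult powr_powr mult.assoc)
      also have "norm y powr (- g * q) * norm y powr - s1 = norm y powr - h"
        unfolding powr_add[symmetric] h_def by (simp add: mult.commute)
      finally show "f y \<le> K powr q * norm y powr - h" .
    qed (use x0 in \<open>auto simp: f_def\<close>)
    also have "(\<integral>\<^sup>+ y. ennreal (f y) * indicator (ball 0 (norm x / 2)) y \<partial>lborel) \<le> ennreal (M (norm x))"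
    proof -
      have "(\<integral>\<^sup>+ y. ennreal (f y) * indicator (ball 0 (norm x / 2)) y \<partial>lborel) \<le> (\<integral>\<^sup>+ y. ennreal (f y) * indicator (ball 0 (norm x)) y \<partial>lborel)"
        using x0 by (intro nn_integral_mono) (auto simp: indicator_def)
      also have "\<dots> \<le> ennreal (M (norm x))" unfolding f_def using x0 by (intro M) auto
      finally show ?thesis .
    qed
    finally have "ennreal (u x) \<le> ennreal (C1 * norm x powr - l) * ennreal (M (norm x)) + ennreal (C1 * K powr q * norm x powr (real DIM('a) - l - h))"
      by (simp add: mult_left_mono add_right_mono)
    also have "\<dots> = ennreal (C1 * norm x powr - l * M (norm x) + C1 * K powr q * norm x powr (real DIM('a) - l - h))"
      using C1 M(2)[of "norm x"] by (subst ennreal_mult[symmetric], simp, simp, intro ennreal_plus[symmetric]) auto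
    finally have "u x \<le> C1 * (norm x powr - l * M (norm x)) + C1 * K powr q * norm x powr (real DIM('a) - l - h)"
      using C1 M(2)[of "norm x"] by (subst (asm) ennreal_le_iff) (auto simp: mult.assoc)
    also have "\<dots> \<le> C * (norm x powr - l * M (norm x)) + C * norm x powr (real DIM('a) - l - h)"
      using C M(2)[of "norm x"] by (intro add_mono mult_right_mono) auto
    finally show ?thesis by (simp add: distrib_left)
  qed
  then show ?thesis using C(1) unfolding h_def by blast
qed

end

section \<open>The three decay regimes\<close>

context hardy_sobolev_system
begin

text \<open>Decay controls the source outside \<open>ball 0 R\<close>, boundedness of
  \<open>v\<close> inside. As \<open>K0\<close> does not depend on \<open>E\<close>, the mass in
  every ball reduces to that of a pure power.\<close>

lemma weight_split:
  assumes B: "\<And>x. v x \<le> B" and R: "0 < R" and dec: "\<And>x. R \<le> norm x \<Longrightarrow> v x \<le> K * norm x powr - g"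
  shows "\<exists>K0\<ge>0. \<forall>E\<in>sets borel. (\<integral>\<^sup>+ y. ennreal (v y powr q * norm y powr - s1) * indicator E y \<partial>lborel)
    \<le> ennreal K0 + ennreal (K powr q) * (\<integral>\<^sup>+ (y::'a). ennreal (norm y powr - (q * g + s1)) * indicator (E - ball 0 R) y \<partial>lborel)"
proof -
  obtain K0 where K0: "K0 \<ge> 0" "(\<integral>\<^sup>+ y. ennreal (v y powr q * norm y powr - s1) * indicator (ball 0 R) y \<partial>lborel) \<le> ennreal K0"
    using weight_ball_finite[OF B R] by blast
  show ?thesis
  proof (intro exI[of _ K0] conjI ballI K0(1))
    fix E :: "'a set" assume E [measurable]: "E \<in> sets borel"
    have "(\<integral>\<^sup>+ y. ennreal (v y powr q * norm y powr - s1) * indicator E y \<partial>lborel)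
      \<le> (\<integral>\<^sup>+ y. ennreal (v y powr q * norm y powr - s1) * indicator (ball 0 R) y
         + ennreal (K powr q) * (ennreal (norm y powr - (q * g + s1)) * indicator (E - ball 0 R) y) \<partial>lborel)"
    proof (intro nn_integral_mono)
      fix y
      show "ennreal (v y powr q * norm y powr - s1) * indicator E y \<le> ennreal (v y powr q * norm y powr - s1) * indicator (ball 0 R) y
         + ennreal (K powr q) * (ennreal (norm y powr - (q * g + s1)) * indicator (E - ball 0 R) y)"
      proof (cases "y \<in> E \<and> y \<notin> ball 0 R")
        case True
        then have "v y \<le> K * norm y powr - g" by (intro dec) auto
        then have "v y powr q * norm y powr - s1 \<le> (K * norm y powr - g) powr q * norm y powr - s1"
          using v_pos[of y] q by (intro mult_right_mono powr_mono2) auto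
        also have "\<dots> = K powr q * (norm y powr (- g * q) * norm y powr - s1)"
          by (simp only: powr_mult powr_powr mult.assoc)
        also have "norm y powr (- g * q) * norm y powr - s1 = norm y powr - (q * g + s1)"
          unfolding powr_add[symmetric] by (simp add: mult.commute)
        finally have "ennreal (v y powr q * norm y powr - s1) \<le> ennreal (K powr q) * ennreal (norm y powr - (q * g + s1))"
          by (simp add: ennreal_mult[symmetric] ennreal_leI)
        then show ?thesis using True by simp
      qed (auto simp: indicator_def)
    qed
    also have "\<dots> = (\<integral>\<^sup>+ y. ennreal (v y powr q * norm y powr - s1) * indicator (ball 0 R) y \<partial>lborel)
       + ennreal (K powr q) * (\<integral>\<^sup>+ (y::'a). ennreal (norm y powr - (q * g + s1)) * indicator (E - ball 0 R) y \<partial>lborel)"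
      by (simp add: nn_integral_add nn_integral_cmult)
    also have "\<dots> \<le> ennreal K0 + ennreal (K powr q) * (\<integral>\<^sup>+ (y::'a). ennreal (norm y powr - (q * g + s1)) * indicator (E - ball 0 R) y \<partial>lborel)"
      by (intro add_right_mono K0)
    finally show "(\<integral>\<^sup>+ y. ennreal (v y powr q * norm y powr - s1) * indicator E y \<partial>lborel) \<le> \<dots>" .
  qed
qed

text \<open>Since q g + s1 > n, the source has finite total mass, and the second term of
  \<open>u_upper\<close> is at most |x|^-l.\<close>

lemma u_fast:
  assumes B: "\<And>x. v x \<le> B" and R: "1 \<le> R" and K: "0 < K" and dec: "\<And>x. R \<le> norm x \<Longrightarrow> v x \<le> K * norm x powr - g"
    and h: "real DIM('a) < q * g + s1"
  shows "\<exists>C>0. \<forall>x. 2 * R \<le> norm x \<longrightarrow> u x \<le> C * norm x powr - l"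
proof -
  define h where "h = q * g + s1"
  have R0: "0 < R" using R by simp
  have hn: "real DIM('a) < h" using assms by (simp add: h_def)
  obtain K0 where K0: "K0 \<ge> 0" "\<forall>E\<in>sets borel. (\<integral>\<^sup>+ y. ennreal (v y powr q * norm y powr - s1) * indicator E y \<partial>lborel)
    \<le> ennreal K0 + ennreal (K powr q) * (\<integral>\<^sup>+ (y::'a). ennreal (norm y powr - (q * g + s1)) * indicator (E - ball 0 R) y \<partial>lborel)"
    using weight_split[OF B R0 dec] by blast
  obtain C1 where C1: "C1 > 0" "\<forall>r>0. (\<integral>\<^sup>+ (y::'a). ennreal (norm y powr - h) * indicator (- ball 0 r) y \<partial>lborel)
            \<le> ennreal (C1 * r powr (real DIM('a) - h))"
    using nn_integral_norm_powr_compl_ball[OF hn] by blast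
  define M where "M = K0 + K powr q * (C1 * R powr (real DIM('a) - h))"
  have M: "M \<ge> 0" using K0 C1 by (simp add: M_def)
  have MM: "(\<integral>\<^sup>+ y. ennreal (v y powr q * norm y powr - s1) * indicator (ball 0 r) y \<partial>lborel) \<le> ennreal M" for r
  proof -
    have "(\<integral>\<^sup>+ (y::'a). ennreal (norm y powr - h) * indicator (ball 0 r - ball 0 R) y \<partial>lborel)
      \<le> (\<integral>\<^sup>+ (y::'a). ennreal (norm y powr - h) * indicator (- ball 0 R) y \<partial>lborel)"
      by (intro nn_integral_mono) (auto simp: indicator_def)
    also have "\<dots> \<le> ennreal (C1 * R powr (real DIM('a) - h))" using C1 R0 by blast
    finally have le: "(\<integral>\<^sup>+ (y::'a). ennreal (norm y powr - h) * indicator (ball 0 r - ball 0 R) y \<partial>lborel) \<le> ennreal (C1 * R powr (real DIM('a) - h))" .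
    have "(\<integral>\<^sup>+ y. ennreal (v y powr q * norm y powr - s1) * indicator (ball 0 r) y \<partial>lborel)
      \<le> ennreal K0 + ennreal (K powr q) * (\<integral>\<^sup>+ (y::'a). ennreal (norm y powr - h) * indicator (ball 0 r - ball 0 R) y \<partial>lborel)"
      unfolding h_def by (intro K0(2)[rule_format]) simp
    also have "\<dots> \<le> ennreal K0 + ennreal (K powr q) * ennreal (C1 * R powr (real DIM('a) - h))"
      by (intro add_left_mono mult_left_mono le) auto
    also have "\<dots> = ennreal M" using K0 C1 by (simp add: M_def ennreal_mult ennreal_plus)
    finally show ?thesis .
  qed
  have h': "real DIM('a) - l < q * g + s1" using h l by simp
  obtain C where C: "C > 0" "\<forall>x. 2 * R \<le> norm x \<longrightarrow> u x \<le> C * (norm x powr - l * M + norm x powr (real DIM('a) - l - (q * g + s1)))"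
    using u_upper[OF B R K dec h', of "\<lambda>_. M"] MM M by blast
  have "u x \<le> C * (M + 1) * norm x powr - l" if x: "2 * R \<le> norm x" for x
  proof -
    have "norm x powr (real DIM('a) - l - (q * g + s1)) \<le> norm x powr - l"
      using x R h by (intro powr_mono) auto
    then have "C * (norm x powr - l * M + norm x powr (real DIM('a) - l - (q * g + s1))) \<le> C * (norm x powr - l * M + norm x powr - l)"
      using C by (intro mult_left_mono add_left_mono) auto
    then show ?thesis using C(2)[rule_format, OF x] by (simp add: algebra_simps)
  qed
  then show ?thesis using C M by (intro exI[of _ "C * (M + 1)"]) auto
qed

lemma u_asymp_fast:
  assumes B: "\<And>x. v x \<le> B" and R: "1 \<le> R" and K: "0 < K" and dec: "\<And>x. R \<le> norm x \<Longrightarrow> v x \<le> K * norm x powr - g"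
    and h: "real DIM('a) < q * g + s1"
  shows "asymp_sim u (\<lambda>x. norm x powr - l)"
proof -
  obtain C where C: "C > 0" "\<forall>x. 2 * R \<le> norm x \<longrightarrow> u x \<le> C * norm x powr - l" using u_fast[OF assms] by blast
  obtain c where c: "c > 0" "\<forall>x. 1 \<le> norm x \<longrightarrow> c * norm x powr - l \<le> u x" using u_lower_powr by blast
  show ?thesis unfolding asymp_sim_def
    using C c R by (intro exI[of _ c] exI[of _ C] exI[of _ "2 * R"]) auto
qed

text \<open>From above, the mass in balls grows like r^(n - h) with h = q l + s1, and both terms of
  \<open>u_upper\<close> are of the same order. From below, the source in
  \<open>ball x (norm x / 2)\<close> alone already gives this order. In the application the roles of
  \<open>u\<close> and \<open>v\<close> are exchanged.\<close>

lemma u_asymp_slow: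
  assumes B: "\<And>x. v x \<le> B" and R: "1 \<le> R" and K: "0 < K" and dec: "\<And>x. R \<le> norm x \<Longrightarrow> v x \<le> K * norm x powr - l"
    and c: "0 < c" and low: "\<And>x. 1 \<le> norm x \<Longrightarrow> c * norm x powr - l \<le> v x"
    and h: "real DIM('a) - l < q * l + s1" "q * l + s1 < real DIM('a)"
  shows "asymp_sim u (\<lambda>x. norm x powr (real DIM('a) - l - (q * l + s1)))"
proof -
  define h where "h = q * l + s1"
  have R0: "0 < R" using R by simp
  have h0: "0 \<le> h" "h < real DIM('a)" using h q l s1 by (auto simp: h_def)
  obtain K0 where K0: "K0 \<ge> 0" "\<forall>E\<in>sets borel. (\<integral>\<^sup>+ y. ennreal (v y powr q * norm y powr - s1) * indicator E y \<partial>lborel)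
    \<le> ennreal K0 + ennreal (K powr q) * (\<integral>\<^sup>+ (y::'a). ennreal (norm y powr - (q * l + s1)) * indicator (E - ball 0 R) y \<partial>lborel)"
    using weight_split[OF B R0 dec] by blast
  obtain C1 where C1: "C1 > 0" "\<forall>r>0. \<forall>x::'a. (\<integral>\<^sup>+ y. ennreal (norm (x - y) powr - h) * indicator (ball x r) y \<partial>lborel)
            \<le> ennreal (C1 * r powr (real DIM('a) - h))"
    using nn_integral_norm_powr_ball[OF h0] by blast
  define M where "M r = K0 + K powr q * (C1 * r powr (real DIM('a) - h))" for r
  have M: "M r \<ge> 0" for r using K0 C1 by (simp add: M_def)
  have MM: "(\<integral>\<^sup>+ y. ennreal (v y powr q * norm y powr - s1) * indicator (ball 0 r) y \<partial>lborel) \<le> ennreal (M r)" if r: "1 \<le> r" for r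
  proof -
    have "(\<integral>\<^sup>+ (y::'a). ennreal (norm y powr - h) * indicator (ball 0 r - ball 0 R) y \<partial>lborel)
      \<le> (\<integral>\<^sup>+ (y::'a). ennreal (norm (0 - y) powr - h) * indicator (ball 0 r) y \<partial>lborel)"
      by (intro nn_integral_mono) (auto simp: indicator_def)
    also have "\<dots> \<le> ennreal (C1 * r powr (real DIM('a) - h))" by (rule C1(2)[rule_format]) (use r in simp)
    finally have le: "(\<integral>\<^sup>+ (y::'a). ennreal (norm y powr - h) * indicator (ball 0 r - ball 0 R) y \<partial>lborel) \<le> ennreal (C1 * r powr (real DIM('a) - h))" .
    have "(\<integral>\<^sup>+ y. ennreal (v y powr q * norm y powr - s1) * indicator (ball 0 r) y \<partial>lborel)
      \<le> ennreal K0 + ennreal (K powr q) * (\<integral>\<^sup>+ (y::'a). ennreal (norm y powr - h) * indicator (ball 0 r - ball 0 R) y \<partial>lborel)"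
      unfolding h_def by (intro K0(2)[rule_format]) simp
    also have "\<dots> \<le> ennreal K0 + ennreal (K powr q) * ennreal (C1 * r powr (real DIM('a) - h))"
      by (intro add_left_mono mult_left_mono le) auto
    also have "\<dots> = ennreal (M r)" using K0 C1 by (simp add: M_def ennreal_mult ennreal_plus)
    finally show ?thesis .
  qed
  obtain C where C: "C > 0" "\<forall>x. 2 * R \<le> norm x \<longrightarrow> u x \<le> C * (norm x powr - l * M (norm x) + norm x powr (real DIM('a) - l - (q * l + s1)))"
    using u_upper[OF B R K dec h(1) MM M] by blast
  have up: "u x \<le> C * (K0 + K powr q * C1 + 1) * norm x powr (real DIM('a) - l - h)" if x: "2 * R \<le> norm x" for x
  proof -
    have "norm x powr - l * M (norm x) = K0 * norm x powr - l + K powr q * C1 * (norm x powr - l * norm x powr (real DIM('a) - h))"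
      by (simp add: M_def algebra_simps)
    also have "norm x powr - l * norm x powr (real DIM('a) - h) = norm x powr (real DIM('a) - l - h)"
      unfolding powr_add[symmetric] by (simp add: algebra_simps)
    also have "K0 * norm x powr - l \<le> K0 * norm x powr (real DIM('a) - l - h)"
      using x R h0 K0 by (intro mult_left_mono powr_mono) auto
    finally have "norm x powr - l * M (norm x) + norm x powr (real DIM('a) - l - h) \<le> (K0 + K powr q * C1 + 1) * norm x powr (real DIM('a) - l - h)"
      by (simp add: algebra_simps)
    then have "C * (norm x powr - l * M (norm x) + norm x powr (real DIM('a) - l - h)) \<le> C * ((K0 + K powr q * C1 + 1) * norm x powr (real DIM('a) - l - h))"
      using C by (intro mult_left_mono) auto
    then show ?thesis using C(2)[rule_format, OF x] by (simp add: h_def mult.assoc)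
  qed
  define w where "w = unit_ball_vol (real DIM('a))"
  have w: "w > 0" unfolding w_def by simp
  define c' where "c' = c powr q * 2 powr - h * (w * (1 / 2) ^ DIM('a))"
  have c': "c' > 0" using c w by (simp add: c'_def)
  have lo: "c' * norm x powr (real DIM('a) - l - h) \<le> u x" if x: "2 \<le> norm x" for x
  proof -
    define Q where "Q = c powr q * (2 * norm x) powr - h * norm x powr - l"
    have Q: "Q \<ge> 0" by (simp add: Q_def)
    have "ennreal (Q * (w * (norm x / 2) ^ DIM('a))) = (\<integral>\<^sup>+ y. ennreal Q * indicator (ball x (norm x / 2)) y \<partial>lborel)"
      using Q w by (simp add: nn_integral_cmult_indicator emeasure_ball w_def ennreal_mult)
    also have "\<dots> \<le> riesz l (\<lambda>y. v y powr q * norm y powr - s1) x"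
      unfolding riesz_def
    proof (intro nn_integral_mono_AE)
      have "AE y in lborel. y \<noteq> x" by (rule AE_lborel_singleton)
      then show "AE y in lborel. ennreal Q * indicator (ball x (norm x / 2)) y \<le> ennreal (v y powr q * norm y powr - s1 * norm (x - y) powr - l)"
      proof eventually_elim
        case (elim y)
        show ?case
        proof (cases "y \<in> ball x (norm x / 2)")
          case True
          then have d: "norm (x - y) < norm x / 2" by (simp add: dist_norm)
          have y1: "norm x / 2 \<le> norm y" using d norm_triangle_ineq[of "x - y" y] by simp
          have y2: "norm y \<le> 2 * norm x" 
          proof -
            have "norm y \<le> norm x + norm (x - y)" using norm_triangle_ineq[of x "y - x"] by (simp add: norm_minus_commute)
            then show ?thesis using d norm_ge_zero[of "x - y"] by linarith
          qed
          have y3: "1 \<le> norm y" "0 < norm y" using x y1 by auto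
          have "c powr q * (2 * norm x) powr - h \<le> c powr q * norm y powr - h"
            using y2 y3 h0 c by (intro mult_left_mono powr_mono2') auto
          also have "norm y powr - h = norm y powr (- l * q) * norm y powr - s1"
            unfolding powr_add[symmetric] h_def by (simp add: mult.commute)
          also have "c powr q * (norm y powr (- l * q) * norm y powr - s1) = (c * norm y powr - l) powr q * norm y powr - s1"
            by (simp only: powr_mult powr_powr mult.assoc)
          also have "\<dots> \<le> v y powr q * norm y powr - s1"
            using low[OF y3(1)] c q by (intro mult_right_mono powr_mono2) auto
          finally have 1: "c powr q * (2 * norm x) powr - h \<le> v y powr q * norm y powr - s1" .
          have "norm (x - y) \<le> norm x" using d norm_ge_zero[of "x - y"] by linarith
          then have 2: "norm x powr - l \<le> norm (x - y) powr - l"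
            using elim l by (intro powr_mono2') auto
          have "Q \<le> v y powr q * norm y powr - s1 * norm (x - y) powr - l"
            unfolding Q_def by (rule mult_mono[OF 1 2]) auto
          then show ?thesis using True by (simp add: ennreal_leI)
        qed auto
      qed
    qed
    also have "\<dots> = ennreal (u x)" by (rule u_eq[symmetric])
    finally have "Q * (w * (norm x / 2) ^ DIM('a)) \<le> u x" using u_pos[of x] by (subst (asm) ennreal_le_iff) auto
    also have "Q * (w * (norm x / 2) ^ DIM('a)) = c' * norm x powr (real DIM('a) - l - h)"
    proof -
      have x0: "0 < norm x" using x by linarith
      have "(norm x / 2) ^ DIM('a) = (1 / 2) ^ DIM('a) * norm x powr real DIM('a)"
        using x0 by (simp add: power_divide powr_realpow power_one_over)
      moreover have "(2 * norm x) powr - h = 2 powr - h * norm x powr - h" by (simp only: powr_mult)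
      ultimately have "Q * (w * (norm x / 2) ^ DIM('a)) = c' * (norm x powr - h * norm x powr - l * norm x powr real DIM('a))"
        unfolding Q_def c'_def by (simp only: mult_ac)
      also have "norm x powr - h * norm x powr - l * norm x powr real DIM('a) = norm x powr (real DIM('a) - l - h)"
        unfolding powr_add[symmetric] by (simp add: algebra_simps)
      finally show ?thesis .
    qed
    finally show ?thesis .
  qed
  have "C * (K0 + K powr q * C1 + 1) > 0" using C K0 C1 by (intro mult_pos_pos add_nonneg_pos) auto
  then show ?thesis unfolding asymp_sim_def h_def[symmetric] using c' up lo R
    by (intro exI[of _ c'] exI[of _ "C * (K0 + K powr q * C1 + 1)"] exI[of _ "2 * R"]) auto
qed

text \<open>Here the source behaves like |y|^-n, so its mass in \<open>ball 0 r\<close> is of order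
  ln r. For the lower bound, all shells between 1 and |x| are seen from a distance of at most 2
  |x|.\<close>

lemma u_asymp_log:
  assumes B: "\<And>x. v x \<le> B" and R: "1 \<le> R" and K: "0 < K" and dec: "\<And>x. R \<le> norm x \<Longrightarrow> v x \<le> K * norm x powr - l"
    and c: "0 < c" and low: "\<And>x. 1 \<le> norm x \<Longrightarrow> c * norm x powr - l \<le> v x"
    and h: "q * l + s1 = real DIM('a)"
  shows "asymp_sim u (\<lambda>x. norm x powr - l * ln (norm x))"
proof -
  have R0: "0 < R" using R by simp
  define w where "w = unit_ball_vol (real DIM('a))"
  have w: "w > 0" unfolding w_def by simp
  define W where "W = w * 2 ^ DIM('a)"
  have W: "W > 0" using w by (simp add: W_def)
  obtain K0 where K0: "K0 \<ge> 0" "\<forall>E\<in>sets borel. (\<integral>\<^sup>+ y. ennreal (v y powr q * norm y powr - s1) * indicator E y \<partial>lborel)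
    \<le> ennreal K0 + ennreal (K powr q) * (\<integral>\<^sup>+ (y::'a). ennreal (norm y powr - (q * l + s1)) * indicator (E - ball 0 R) y \<partial>lborel)"
    using weight_split[OF B R0 dec] by blast
  define M where "M r = K0 + K powr q * ((2 * \<bar>ln r\<bar> + 1) * W)" for r
  have M: "M r \<ge> 0" for r using K0 W by (simp add: M_def)
  have MM: "(\<integral>\<^sup>+ y. ennreal (v y powr q * norm y powr - s1) * indicator (ball 0 r) y \<partial>lborel) \<le> ennreal (M r)" if r: "1 \<le> r" for r
  proof -
    obtain N where N: "1 * 2 ^ N \<le> r" "r < 1 * 2 ^ Suc N" using dyadic_above[of 1 r] r by auto
    have "real N * ln 2 = ln (2 ^ N)" by (simp add: ln_realpow)
    also have "\<dots> \<le> ln r" using N(1) by (subst ln_le_cancel_iff) (use r in auto)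
    finally have "real N * ln 2 \<le> ln r" .
    \<comment> \<open>ln 2 >= 1/2 converts the number of shells into a multiple of ln r; the added 1
      below covers the incomplete last shell.\<close>
    moreover have "real N * (1 / 2) \<le> real N * ln 2" using ln2_ge_two_thirds by (intro mult_left_mono) auto
    ultimately have NL: "real (Suc N) \<le> 2 * \<bar>ln r\<bar> + 1" by simp
    have sub: "ball 0 r - ball 0 R \<subseteq> ball (0::'a) (2 ^ Suc N) - ball 0 1" using N(2) R by auto
    have "(\<integral>\<^sup>+ (y::'a). ennreal (norm y powr - real DIM('a)) * indicator (ball 0 r - ball 0 R) y \<partial>lborel)
      \<le> (\<integral>\<^sup>+ (y::'a). ennreal (norm y powr - real DIM('a)) * indicator (ball 0 (2 ^ Suc N) - ball 0 1) y \<partial>lborel)"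
      using sub by (intro nn_integral_mono) (auto simp: indicator_def simp del: power_Suc)
    also have "\<dots> \<le> ennreal (real (Suc N) * W)" unfolding W_def w_def by (rule nn_integral_norm_powr_shell_log_upper)
    also have "\<dots> \<le> ennreal ((2 * \<bar>ln r\<bar> + 1) * W)" using NL W by (intro ennreal_leI mult_right_mono) auto
    finally have le: "(\<integral>\<^sup>+ (y::'a). ennreal (norm y powr - real DIM('a)) * indicator (ball 0 r - ball 0 R) y \<partial>lborel) \<le> ennreal ((2 * \<bar>ln r\<bar> + 1) * W)" .
    have "(\<integral>\<^sup>+ y. ennreal (v y powr q * norm y powr - s1) * indicator (ball 0 r) y \<partial>lborel)
      \<le> ennreal K0 + ennreal (K powr q) * (\<integral>\<^sup>+ (y::'a). ennreal (norm y powr - real DIM('a)) * indicator (ball 0 r - ball 0 R) y \<partial>lborel)"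
      using K0(2)[rule_format, of "ball 0 r"] unfolding h by simp
    also have "\<dots> \<le> ennreal K0 + ennreal (K powr q) * ennreal ((2 * \<bar>ln r\<bar> + 1) * W)"
      by (intro add_left_mono mult_left_mono le) auto
    also have "\<dots> = ennreal K0 + ennreal (K powr q * ((2 * \<bar>ln r\<bar> + 1) * W))"
      using W by (simp add: ennreal_mult)
    also have "\<dots> = ennreal (M r)" unfolding M_def using K0 W by (intro ennreal_plus[symmetric]) auto
    finally show ?thesis .
  qed
  have h': "real DIM('a) - l < q * l + s1" using h l by simp
  obtain C where C: "C > 0" "\<forall>x. 2 * R \<le> norm x \<longrightarrow> u x \<le> C * (norm x powr - l * M (norm x) + norm x powr (real DIM('a) - l - (q * l + s1)))"
    using u_upper[OF B R K dec h' MM M] by blast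
  \<comment> \<open>Beyond 4 > e the logarithm is at least 1, so that it absorbs additive
    constants.\<close>
  have ln4: "1 \<le> ln (norm x)" if "4 \<le> norm x" for x :: 'a
  proof -
    have "exp (1::real) \<le> 3" by (rule exp_le)
    then have "exp 1 \<le> norm x" using that by linarith
    then show ?thesis using that by (subst ln_ge_iff) auto
  qed
  have up: "u x \<le> C * (K0 + 3 * K powr q * W + 1) * (norm x powr - l * ln (norm x))" if x: "2 * R \<le> norm x" "4 \<le> norm x" for x
  proof -
    have L: "1 \<le> ln (norm x)" using ln4 x by simp
    have "M (norm x) + 1 \<le> (K0 + 3 * K powr q * W + 1) * ln (norm x)"
    proof -
      have "K0 * 1 \<le> K0 * ln (norm x)" using K0 L by (intro mult_left_mono) auto
      moreover have "K powr q * W * (2 * ln (norm x) + 1) \<le> K powr q * W * (3 * ln (norm x))"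
        using L W by (intro mult_left_mono) auto
      ultimately show ?thesis using L by (simp add: M_def algebra_simps)
    qed
    then have "norm x powr - l * (M (norm x) + 1) \<le> norm x powr - l * ((K0 + 3 * K powr q * W + 1) * ln (norm x))"
      by (intro mult_left_mono) auto
    then have "C * (norm x powr - l * M (norm x) + norm x powr - l) \<le> C * (norm x powr - l * ((K0 + 3 * K powr q * W + 1) * ln (norm x)))"
      using C by (intro mult_left_mono) (auto simp: algebra_simps)
    moreover have e: "real DIM('a) - l - (q * l + s1) = - l" using h by simp
    ultimately have "u x \<le> C * (norm x powr - l * ((K0 + 3 * K powr q * W + 1) * ln (norm x)))"
      using C(2)[rule_format, OF x(1)] unfolding e by linarith
    also have "\<dots> = C * (K0 + 3 * K powr q * W + 1) * (norm x powr - l * ln (norm x))" by (simp only: mult_ac)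
    finally show ?thesis .
  qed
  define c' where "c' = c powr q * 2 powr - l * (w / 4)"
  have c': "c' > 0" using c w by (simp add: c'_def)
  have lo: "c' * (norm x powr - l * ln (norm x)) \<le> u x" if x: "4 \<le> norm x" for x
  proof -
    obtain N where N: "1 * 2 ^ N \<le> norm x" "norm x < 1 * 2 ^ Suc N" using dyadic_above[of 1 "norm x"] x by auto
    have N1: "1 \<le> N" using N(2) x by (cases N) auto
    have "ln (norm x) \<le> ln (2 ^ Suc N)" using N(2) x by (subst ln_le_cancel_iff) auto
    also have "\<dots> = real (Suc N) * ln 2" by (simp only: ln_realpow zero_less_numeral)
    also have "\<dots> \<le> real (Suc N) * 1" using ln_2_less_1 by (intro mult_left_mono) auto
    finally have NL: "ln (norm x) \<le> 2 * real N" using N1 by simp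
    define Q where "Q = c powr q * (2 * norm x) powr - l"
    have Q: "Q \<ge> 0" by (simp add: Q_def)
    have "ennreal (Q * (real N * (w / 2))) = ennreal Q * ennreal (real N * (w / 2))"
      using Q w by (intro ennreal_mult) auto
    also have "\<dots> \<le> ennreal Q * (\<integral>\<^sup>+ (y::'a). ennreal (norm y powr - real DIM('a)) * indicator (ball 0 (2 ^ N) - ball 0 1) y \<partial>lborel)"
      unfolding w_def by (intro mult_left_mono nn_integral_norm_powr_shell_log_lower) auto
    also have "\<dots> = (\<integral>\<^sup>+ (y::'a). ennreal Q * (ennreal (norm y powr - real DIM('a)) * indicator (ball 0 (2 ^ N) - ball 0 1) y) \<partial>lborel)"
      by (rule nn_integral_cmult[symmetric]) measurable
    also have "\<dots> \<le> riesz l (\<lambda>y. v y powr q * norm y powr - s1) x"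
      unfolding riesz_def
    proof (intro nn_integral_mono_AE)
      have "AE y in lborel. y \<noteq> x" by (rule AE_lborel_singleton)
      then show "AE y in lborel. ennreal Q * (ennreal (norm y powr - real DIM('a)) * indicator (ball 0 (2 ^ N) - ball 0 1) y)
         \<le> ennreal (v y powr q * norm y powr - s1 * norm (x - y) powr - l)"
      proof eventually_elim
        case (elim y)
        show ?case
        proof (cases "y \<in> ball 0 (2 ^ N) - ball 0 1")
          case True
          then have y: "1 \<le> norm y" "norm y \<le> norm x" using N by auto
          have "c powr q * norm y powr - real DIM('a) = c powr q * (norm y powr (- l * q) * norm y powr - s1)"
            unfolding powr_add[symmetric] h[symmetric] by (simp add: mult.commute)
          also have "\<dots> = (c * norm y powr - l) powr q * norm y powr - s1"
            by (simp only: powr_mult powr_powr mult.assoc)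
          also have "\<dots> \<le> v y powr q * norm y powr - s1"
            using low[OF y(1)] c q by (intro mult_right_mono powr_mono2) auto
          finally have 1: "c powr q * norm y powr - real DIM('a) \<le> v y powr q * norm y powr - s1" .
          have "norm (x - y) \<le> 2 * norm x" using y norm_triangle_ineq4[of x y] by linarith
          then have 2: "(2 * norm x) powr - l \<le> norm (x - y) powr - l"
            using elim l by (intro powr_mono2') auto
          have "c powr q * norm y powr - real DIM('a) * (2 * norm x) powr - l \<le> v y powr q * norm y powr - s1 * norm (x - y) powr - l"
            by (rule mult_mono[OF 1 2]) auto
          then have "Q * norm y powr - real DIM('a) \<le> v y powr q * norm y powr - s1 * norm (x - y) powr - l"
            by (simp add: Q_def mult_ac)
          then show ?thesis using True Q by (simp add: ennreal_mult[symmetric] ennreal_leI)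
        qed auto
      qed
    qed
    also have "\<dots> = ennreal (u x)" by (rule u_eq[symmetric])
    finally have le: "Q * (real N * (w / 2)) \<le> u x" using u_pos[of x] by (subst (asm) ennreal_le_iff) auto
    have "c' * (norm x powr - l * ln (norm x)) = Q * (w / 4) * ln (norm x)"
    proof -
      have "(2 * norm x) powr - l = 2 powr - l * norm x powr - l" by (simp only: powr_mult)
      then show ?thesis unfolding c'_def Q_def by (simp only: mult_ac)
    qed
    also have "\<dots> \<le> Q * (w / 4) * (2 * real N)" using Q w NL by (intro mult_left_mono) auto
    also have "\<dots> = Q * (real N * (w / 2))" by simp
    finally show ?thesis using le by simp
  qed
  have "C * (K0 + 3 * K powr q * W + 1) > 0" using C K0 W by (intro mult_pos_pos add_nonneg_pos add_nonneg_nonneg) auto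
  then show ?thesis unfolding asymp_sim_def using c' up lo R
    by (intro exI[of _ c'] exI[of _ "C * (K0 + 3 * K powr q * W + 1)"] exI[of _ "max 4 (2 * R)"]) auto
qed

end

section \<open>The dilation identity\<close>

text \<open>A one-sided second order bound, in the direction opposite to convexity. \<open>A\<close>
  dominates the second derivative because t <= 2 and z >= 2 make \<open>t powr (z - 2)\<close> at
  most \<open>2 powr (z - 2)\<close>.\<close>

lemma powr_le_taylor2:
  fixes z :: real
  assumes z: "2 \<le> z"
  shows "\<exists>A>0. \<forall>s. \<bar>s - 1\<bar> \<le> 1 / 2 \<longrightarrow> s powr z \<le> 1 + z * (s - 1) + A * (s - 1)\<^sup>2"
proof -
  define A where "A = z * (z - 1) * 2 powr (z - 2)"
  have A: "A > 0" using z by (simp add: A_def)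
  define df where "df m t = (if m = 0 then t powr z else if m = 1 then z * t powr (z - 1) else z * ((z - 1) * t powr (z - 1 - 1)))" for m :: nat and t :: real
  have "s powr z \<le> 1 + z * (s - 1) + A * (s - 1)\<^sup>2" if s: "\<bar>s - 1\<bar> \<le> 1 / 2" for s
  proof (cases "s = 1")
    case False
    have "\<exists>t. (if s < 1 then s < t \<and> t < 1 else 1 < t \<and> t < s) \<and>
      s powr z = (\<Sum>m<2. (df m 1 / fact m) * (s - 1)^m) + (df 2 t / fact 2) * (s - 1)^2"
    proof (rule Taylor[where a = "1/2" and b = "3/2"])
      show "\<forall>m t. m < 2 \<and> 1 / 2 \<le> t \<and> t \<le> 3 / 2 \<longrightarrow> DERIV (df m) t :> df (Suc m) t"
      proof (intro allI impI)
        fix m :: nat and t :: real assume m: "m < 2 \<and> 1 / 2 \<le> t \<and> t \<le> 3 / 2"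
        then have t: "t > 0" by simp
        from m consider "m = 0" | "m = 1" by linarith
        then show "DERIV (df m) t :> df (Suc m) t"
        proof cases
          case 1
          then have "df m = (\<lambda>t. t powr z)" by (auto simp: df_def)
          then show ?thesis using has_real_derivative_powr[OF t, of z] 1 by (simp add: df_def)
        next
          case 2
          then have "df m = (\<lambda>t. z * t powr (z - 1))" by (auto simp: df_def)
          then show ?thesis using DERIV_cmult[OF has_real_derivative_powr[OF t, of "z - 1"], of z] 2 by (simp add: df_def)
        qed
      qed
      show "1 / 2 \<le> s" "s \<le> 3 / 2" using s by linarith+
    qed (use False in \<open>auto simp: df_def\<close>)
    then obtain t where t: "if s < 1 then s < t \<and> t < 1 else 1 < t \<and> t < s"
      and eq: "s powr z = (\<Sum>m<2. (df m 1 / fact m) * (s - 1)^m) + (df 2 t / fact 2) * (s - 1)^2" by blast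
    have t2: "0 \<le> t" "t \<le> 2" using t s by (auto split: if_splits)
    have "(\<Sum>m<2. (df m 1 / fact m) * (s - 1)^m) = 1 + z * (s - 1)"
      by (simp add: numeral_2_eq_2 df_def)
    moreover have "(df 2 t / fact 2) * (s - 1)^2 \<le> A * (s - 1)^2"
    proof (rule mult_right_mono)
      have "t powr (z - 2) \<le> 2 powr (z - 2)" using t2 z by (intro powr_mono2) auto
      then have "z * (z - 1) * t powr (z - 2) \<le> A" unfolding A_def using z by (intro mult_left_mono) auto
      moreover have "0 \<le> z * (z - 1) * t powr (z - 2)" using z by auto
      moreover have "df 2 t / fact 2 = z * (z - 1) * t powr (z - 2) / 2" by (simp add: df_def)
      ultimately show "df 2 t / fact 2 \<le> A" by linarith
    qed auto
    ultimately show ?thesis using eq by linarith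
  qed simp
  then show ?thesis using A by blast
qed

text \<open>Convexity of the power -l: its graph lies above the tangent at \<alpha>. This is
  obtained from ln x <= x - 1 and 1 + y <= exp y for the ratio x = \<beta> / \<alpha>.\<close>

lemma powr_neg_tangent:
  fixes \<alpha> \<beta> l :: real
  assumes l: "0 < l" and \<alpha>: "0 < \<alpha>" and \<beta>: "0 < \<beta>"
  shows "\<alpha> powr - l \<le> \<beta> powr - l + l * \<bar>\<alpha> - \<beta>\<bar> * \<alpha> powr - (l + 1)"
proof -
  define x where "x = \<beta> / \<alpha>"
  have x: "x > 0" using \<alpha> \<beta> by (simp add: x_def)
  have "l * ln x \<le> l * (x - 1)" using ln_le_minus_one[OF x] l by (intro mult_left_mono) auto
  moreover have "1 + - l * ln x \<le> exp (- l * ln x)" by (rule exp_ge_add_one_self)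
  moreover have "exp (- l * ln x) = x powr - l" using x by (simp add: powr_def)
  ultimately have "1 - l * (x - 1) \<le> x powr - l" by linarith
  then have "\<alpha> powr - l * (1 - l * (x - 1)) \<le> \<alpha> powr - l * x powr - l" by (intro mult_left_mono) auto
  also have "\<alpha> powr - l * x powr - l = (\<alpha> * x) powr - l" by (simp only: powr_mult)
  also have "\<alpha> * x = \<beta>" using \<alpha> by (simp add: x_def)
  finally have le: "\<alpha> powr - l \<le> \<beta> powr - l + l * (\<alpha> powr - l * (x - 1))" by (simp add: algebra_simps)
  have "\<alpha> powr - l = \<alpha> powr - (l + 1) * \<alpha>"
    using \<alpha> powr_add[of \<alpha> "- (l + 1)" 1] by simp
  then have "\<alpha> powr - l * (x - 1) = \<alpha> powr - (l + 1) * (\<beta> - \<alpha>)"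
    using \<alpha> by (simp add: x_def field_simps)
  also have "\<dots> \<le> \<alpha> powr - (l + 1) * \<bar>\<alpha> - \<beta>\<bar>" by (intro mult_left_mono) auto
  finally have "l * (\<alpha> powr - l * (x - 1)) \<le> l * (\<alpha> powr - (l + 1) * \<bar>\<alpha> - \<beta>\<bar>)" using l by (intro mult_left_mono) auto
  then show ?thesis using le by (simp add: mult_ac)
qed

lemma nn_integral_scale:
  fixes g :: "'a::euclidean_space \<Rightarrow> ennreal"
  assumes [measurable]: "g \<in> borel_measurable borel" and t: "0 < t"
  shows "(\<integral>\<^sup>+ x. g x \<partial>lborel) = ennreal (t ^ DIM('a)) * (\<integral>\<^sup>+ x. g (t *\<^sub>R x) \<partial>lborel)"
proof -
  have "t \<noteq> 0" using t by simp
  then show ?thesis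
    by (subst lborel_affine[of t 0]) (use t in \<open>simp_all add: nn_integral_density nn_integral_distr nn_integral_cmult\<close>)
qed

lemma nn_integral_dilate_weight:
  fixes w :: "'a::euclidean_space \<Rightarrow> real"
  assumes [measurable]: "w \<in> borel_measurable borel" and w: "\<And>x. 0 \<le> w x" and t: "0 < t"
  shows "(\<integral>\<^sup>+ x. ennreal (w (t *\<^sub>R x) * norm x powr - s) \<partial>lborel)
    = ennreal (t powr (s - real DIM('a))) * (\<integral>\<^sup>+ x. ennreal (w x * norm x powr - s) \<partial>lborel)" (is "?L = _ * ?R")
proof -
  have "?R = ennreal (t ^ DIM('a)) * (\<integral>\<^sup>+ x. ennreal (w (t *\<^sub>R x) * norm (t *\<^sub>R x) powr - s) \<partial>lborel)"
    by (rule nn_integral_scale[OF _ t]) measurable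
  also have "(\<integral>\<^sup>+ x. ennreal (w (t *\<^sub>R x) * norm (t *\<^sub>R x) powr - s) \<partial>lborel)
     = (\<integral>\<^sup>+ x. ennreal (t powr - s) * ennreal (w (t *\<^sub>R x) * norm x powr - s) \<partial>lborel)"
  proof (intro nn_integral_cong)
    fix x :: 'a
    have "norm (t *\<^sub>R x) = t * norm x" using t by simp
    then have "norm (t *\<^sub>R x) powr - s = t powr - s * norm x powr - s" by (simp only: powr_mult)
    then show "ennreal (w (t *\<^sub>R x) * norm (t *\<^sub>R x) powr - s) = ennreal (t powr - s) * ennreal (w (t *\<^sub>R x) * norm x powr - s)"
      using w by (simp add: ennreal_mult[symmetric] mult_ac)
  qed
  also have "\<dots> = ennreal (t powr - s) * ?L" by (rule nn_integral_cmult) measurable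
  finally have "ennreal (t powr (s - real DIM('a))) * ?R
    = (ennreal (t powr (s - real DIM('a))) * ennreal (t ^ DIM('a)) * ennreal (t powr - s)) * ?L"
    by (simp only: mult.assoc)
  also have "ennreal (t powr (s - real DIM('a))) * ennreal (t ^ DIM('a)) * ennreal (t powr - s)
    = ennreal (t powr (s - real DIM('a)) * t powr real DIM('a) * t powr - s)"
    using t by (simp add: ennreal_mult powr_realpow)
  also have "t powr (s - real DIM('a)) * t powr real DIM('a) * t powr - s = 1"
    using t unfolding powr_add[symmetric] by simp
  finally show ?thesis by simp
qed

lemma riesz_scale:
  fixes f :: "'a::euclidean_space \<Rightarrow> real"
  assumes [measurable]: "f \<in> borel_measurable borel" and f0: "\<And>y. 0 \<le> f y" and t: "0 < t"
  shows "riesz l f (t *\<^sub>R x) = ennreal (t powr (real DIM('a) - l)) * riesz l (\<lambda>z. f (t *\<^sub>R z)) x"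
proof -
  have "riesz l f (t *\<^sub>R x) = ennreal (t ^ DIM('a)) * (\<integral>\<^sup>+ z. ennreal (f (t *\<^sub>R z) * norm (t *\<^sub>R x - t *\<^sub>R z) powr - l) \<partial>lborel)"
    unfolding riesz_def by (rule nn_integral_scale[OF _ t]) measurable
  also have "(\<integral>\<^sup>+ z. ennreal (f (t *\<^sub>R z) * norm (t *\<^sub>R x - t *\<^sub>R z) powr - l) \<partial>lborel)
    = (\<integral>\<^sup>+ z. ennreal (t powr - l) * ennreal (f (t *\<^sub>R z) * norm (x - z) powr - l) \<partial>lborel)"
  proof (intro nn_integral_cong)
    fix z :: 'a
    have "norm (t *\<^sub>R x - t *\<^sub>R z) = t * norm (x - z)" using t by (simp add: scaleR_diff_right[symmetric])
    then have "norm (t *\<^sub>R x - t *\<^sub>R z) powr - l = t powr - l * norm (x - z) powr - l" by (simp only: powr_mult)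
    then show "ennreal (f (t *\<^sub>R z) * norm (t *\<^sub>R x - t *\<^sub>R z) powr - l) = ennreal (t powr - l) * ennreal (f (t *\<^sub>R z) * norm (x - z) powr - l)"
      using f0 by (simp add: ennreal_mult[symmetric] mult_ac)
  qed
  also have "\<dots> = ennreal (t powr - l) * riesz l (\<lambda>z. f (t *\<^sub>R z)) x"
    unfolding riesz_def by (rule nn_integral_cmult) measurable
  finally have "riesz l f (t *\<^sub>R x) = (ennreal (t ^ DIM('a)) * ennreal (t powr - l)) * riesz l (\<lambda>z. f (t *\<^sub>R z)) x"
    by (simp only: mult.assoc)
  also have "ennreal (t ^ DIM('a)) * ennreal (t powr - l) = ennreal (t powr (real DIM('a) - l))"
    using t by (simp add: ennreal_mult[symmetric] powr_realpow[symmetric] powr_add[symmetric])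
  finally show ?thesis .
qed

section \<open>Estimates along dilations\<close>

context hardy_sobolev_system
begin

text \<open>An integral form of |x| |grad u| <= C u. Away from \<open>x\<close>, |x| <= 2 |x - y|
  trades one power of the kernel and leaves 2 u; near \<open>x\<close> the source is bounded and the
  kernel of order l + 1 is integrable because l + 1 < n. The near part is then compared with the
  lower bounds of \<open>u\<close>.\<close>

lemma gradient_potential_le:
  assumes l1: "l + 1 < real DIM('a)"
    and B: "\<And>x. v x \<le> B" and R: "1 \<le> R" and K: "0 < K" and dec: "\<And>x. R \<le> norm x \<Longrightarrow> v x \<le> K * norm x powr - g"
    and h: "real DIM('a) < q * g + s1" and g: "0 < g"
  shows "\<exists>C>0. \<forall>x. ennreal (norm x) * riesz (l + 1) (\<lambda>y. v y powr q * norm y powr - s1) x \<le> ennreal (C * u x)"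
proof -
  define n where "n = real DIM('a)"
  define h where "h = q * g + s1"
  have hn: "n < h" using h by (simp add: h_def n_def)
  then have h0: "0 \<le> h" using of_nat_0_le_iff[of "DIM('a)"] unfolding n_def by linarith
  define f where "f y = v y powr q * norm y powr - s1" for y
  have [measurable]: "f \<in> borel_measurable borel" unfolding f_def by measurable
  have f0: "0 \<le> f y" for y by (simp add: f_def)
  have l0: "0 \<le> l + 1" using l by simp
  obtain C1 where C1: "C1 > 0" "\<forall>r>0. \<forall>x::'a. (\<integral>\<^sup>+ y. ennreal (norm (x - y) powr - (l + 1)) * indicator (ball x r) y \<partial>lborel)
            \<le> ennreal (C1 * r powr (real DIM('a) - (l + 1)))"
    using nn_integral_norm_powr_ball[OF l0 l1] by blast
  have general: "ennreal (norm x) * riesz (l + 1) f x \<le> ennreal (2 * u x + 2 * m * C1 * (norm x / 2) powr (n - l))"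
    if x: "x \<noteq> 0" and m: "0 \<le> m" and fm: "\<And>y. norm x / 2 \<le> norm y \<Longrightarrow> f y \<le> m" for x m
  proof -
    define \<rho> where "\<rho> = norm x / 2"
    have \<rho>: "\<rho> > 0" using x by (simp add: \<rho>_def)
    have "ennreal (norm x) * riesz (l + 1) f x = (\<integral>\<^sup>+ y. ennreal (norm x) * ennreal (f y * norm (x - y) powr - (l + 1)) \<partial>lborel)"
      unfolding riesz_def by (rule nn_integral_cmult[symmetric]) measurable
    also have "\<dots> \<le> (\<integral>\<^sup>+ y. ennreal 2 * ennreal (f y * norm (x - y) powr - l)
       + ennreal (2 * \<rho> * m) * (ennreal (norm (x - y) powr - (l + 1)) * indicator (ball x \<rho>) y) \<partial>lborel)"
    proof (intro nn_integral_mono)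
      fix y
      show "ennreal (norm x) * ennreal (f y * norm (x - y) powr - (l + 1)) \<le> ennreal 2 * ennreal (f y * norm (x - y) powr - l)
       + ennreal (2 * \<rho> * m) * (ennreal (norm (x - y) powr - (l + 1)) * indicator (ball x \<rho>) y)"
      proof (cases "y \<in> ball x \<rho>")
        case True
        then have "norm (x - y) < \<rho>" by (simp add: dist_norm)
        then have "\<rho> \<le> norm y" using norm_triangle_ineq[of "x - y" y] by (simp add: \<rho>_def)
        then have "f y \<le> m" by (intro fm) (simp add: \<rho>_def)
        then have "norm x * (f y * norm (x - y) powr - (l + 1)) \<le> norm x * (m * norm (x - y) powr - (l + 1))"
          by (intro mult_left_mono mult_right_mono) auto
        also have "\<dots> = 2 * \<rho> * m * norm (x - y) powr - (l + 1)" by (simp add: \<rho>_def)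
        finally have "ennreal (norm x) * ennreal (f y * norm (x - y) powr - (l + 1)) \<le> ennreal (2 * \<rho> * m) * ennreal (norm (x - y) powr - (l + 1))"
          using f0 m \<rho> by (simp add: ennreal_mult[symmetric] ennreal_leI)
        then show ?thesis using True by (simp add: add_increasing)
      next
        case False
        then have r: "\<rho> \<le> norm (x - y)" by (simp add: dist_norm)
        then have xy: "0 < norm (x - y)" using \<rho> by linarith
        have "norm x * norm (x - y) powr - (l + 1) \<le> 2 * norm (x - y) * norm (x - y) powr - (l + 1)"
          using r by (intro mult_right_mono) (auto simp: \<rho>_def)
        also have "\<dots> = 2 * norm (x - y) powr - l"
          using xy powr_add[of "norm (x - y)" 1 "- (l + 1)"] by simp
        finally have "f y * (norm x * norm (x - y) powr - (l + 1)) \<le> f y * (2 * norm (x - y) powr - l)"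
          using f0 by (intro mult_left_mono) auto
        then have "ennreal (norm x) * ennreal (f y * norm (x - y) powr - (l + 1)) \<le> ennreal 2 * ennreal (f y * norm (x - y) powr - l)"
          unfolding ennreal_mult[OF norm_ge_zero mult_nonneg_nonneg[OF f0 powr_ge_zero], symmetric]
            ennreal_mult[OF zero_le_numeral mult_nonneg_nonneg[OF f0 powr_ge_zero], symmetric]
          by (intro ennreal_leI) (simp add: mult_ac)
        then show ?thesis by (simp add: add_increasing2)
      qed
    qed
    also have "\<dots> = (\<integral>\<^sup>+ y. ennreal 2 * ennreal (f y * norm (x - y) powr - l) \<partial>lborel)
       + (\<integral>\<^sup>+ y. ennreal (2 * \<rho> * m) * (ennreal (norm (x - y) powr - (l + 1)) * indicator (ball x \<rho>) y) \<partial>lborel)"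
      by (rule nn_integral_add) measurable
    also have "(\<integral>\<^sup>+ y. ennreal 2 * ennreal (f y * norm (x - y) powr - l) \<partial>lborel) = ennreal 2 * riesz l f x"
      unfolding riesz_def by (rule nn_integral_cmult) measurable
    also have "riesz l f x = ennreal (u x)" using u_eq[of x] by (simp add: f_def[abs_def])
    also have "(\<integral>\<^sup>+ y. ennreal (2 * \<rho> * m) * (ennreal (norm (x - y) powr - (l + 1)) * indicator (ball x \<rho>) y) \<partial>lborel)
      = ennreal (2 * \<rho> * m) * (\<integral>\<^sup>+ y. ennreal (norm (x - y) powr - (l + 1)) * indicator (ball x \<rho>) y \<partial>lborel)"
      by (rule nn_integral_cmult) measurable
    also have "\<dots> \<le> ennreal (2 * \<rho> * m) * ennreal (C1 * \<rho> powr (real DIM('a) - (l + 1)))"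
      using \<rho> by (intro mult_left_mono C1(2)[rule_format]) auto
    finally have "ennreal (norm x) * riesz (l + 1) f x \<le> ennreal 2 * ennreal (u x) + ennreal (2 * \<rho> * m) * ennreal (C1 * \<rho> powr (real DIM('a) - (l + 1)))"
      by (simp add: add_left_mono)
    also have "\<dots> = ennreal (2 * u x + 2 * \<rho> * m * (C1 * \<rho> powr (n - (l + 1))))"
    proof -
      have "0 \<le> 2 * \<rho> * m" "0 \<le> C1 * \<rho> powr (n - (l + 1))" "0 \<le> 2 * u x"
        using u_pos[of x] m \<rho> C1 by auto
      then show ?thesis
        unfolding n_def[symmetric] ennreal_mult[OF zero_le_numeral less_imp_le[OF u_pos], symmetric]
        by (simp only: ennreal_mult[symmetric]) (rule ennreal_plus[symmetric], assumption, rule mult_nonneg_nonneg; assumption)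
    qed
    also have "2 * \<rho> * m * (C1 * \<rho> powr (n - (l + 1))) = 2 * m * C1 * (\<rho> powr 1 * \<rho> powr (n - (l + 1)))"
      using \<rho> by simp
    also have "\<rho> powr 1 * \<rho> powr (n - (l + 1)) = \<rho> powr (n - l)" unfolding powr_add[symmetric] by simp
    finally show ?thesis by (simp add: \<rho>_def)
  qed
  obtain c where c: "c > 0" "\<forall>x. c * (1 + norm x) powr - l \<le> u x" using u_lower by blast
  obtain c' where c': "c' > 0" "\<forall>x. 1 \<le> norm x \<longrightarrow> c' * norm x powr - l \<le> u x" using u_lower_powr by blast
  \<comment> \<open>\<open>D1\<close> serves 0 < |x| <= 2 R, where the near part has order |x|^(n -
    l - s1) with a positive exponent; \<open>D2\<close> serves |x| > 2 R, where it is at most of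
    order |x|^-l because h > n.\<close>
  define D1 where "D1 = 2 * B powr q * C1 * R powr (n - l - s1) / (c * (1 + 2 * R) powr - l)"
  define D2 where "D2 = 2 * K powr q * C1 * 2 powr l / c'"
  have D: "0 \<le> D1" "0 \<le> D2" using C1 c c' by (auto simp: D1_def D2_def)
  have main: "ennreal (norm x) * riesz (l + 1) f x \<le> ennreal ((2 + D1 + D2) * u x)" for x
  proof -
    consider "x = 0" | "x \<noteq> 0" "norm x \<le> 2 * R" | "2 * R < norm x" by fastforce
    then show ?thesis
    proof cases
      case 2
      define \<rho> where "\<rho> = norm x / 2"
      have \<rho>: "0 < \<rho>" "\<rho> \<le> R" using 2 by (auto simp: \<rho>_def)
      have "ennreal (norm x) * riesz (l + 1) f x \<le> ennreal (2 * u x + 2 * (B powr q * \<rho> powr - s1) * C1 * (norm x / 2) powr (n - l))"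
      proof (rule general[OF 2(1)])
        fix y :: 'a assume "norm x / 2 \<le> norm y"
        then show "f y \<le> B powr q * \<rho> powr - s1"
          unfolding f_def using B[of y] v_pos[of y] q s1 \<rho> by (intro mult_mono powr_mono2 powr_mono2') (auto simp: \<rho>_def)
      qed auto
      also have "2 * (B powr q * \<rho> powr - s1) * C1 * (norm x / 2) powr (n - l) = 2 * B powr q * C1 * (\<rho> powr - s1 * \<rho> powr (n - l))"
        by (simp add: \<rho>_def)
      also have "\<rho> powr - s1 * \<rho> powr (n - l) = \<rho> powr (n - l - s1)" unfolding powr_add[symmetric] by simp
      also have "ennreal (2 * u x + 2 * B powr q * C1 * \<rho> powr (n - l - s1)) \<le> ennreal ((2 + D1 + D2) * u x)"
      proof (rule ennreal_leI)
        have "2 * B powr q * C1 * \<rho> powr (n - l - s1) \<le> 2 * B powr q * C1 * R powr (n - l - s1)"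
          using \<rho> C1 s1 by (intro mult_left_mono powr_mono2) (auto simp: n_def)
        also have "\<dots> = D1 * (c * (1 + 2 * R) powr - l)" using c R by (simp add: D1_def)
        also have "\<dots> \<le> D1 * u x"
        proof (intro mult_left_mono D)
          have "(1 + 2 * R) powr - l \<le> (1 + norm x) powr - l"
            using 2 l by (intro powr_mono2') (auto intro: add_pos_nonneg)
          then have "c * (1 + 2 * R) powr - l \<le> c * (1 + norm x) powr - l" using c by (intro mult_left_mono) auto
          then show "c * (1 + 2 * R) powr - l \<le> u x" using c(2)[rule_format, of x] by linarith
        qed
        finally have "2 * B powr q * C1 * \<rho> powr (n - l - s1) \<le> D1 * u x" .
        moreover have "0 \<le> D2 * u x" using D u_pos[of x] by simp
        ultimately show "2 * u x + 2 * B powr q * C1 * \<rho> powr (n - l - s1) \<le> (2 + D1 + D2) * u x"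
          by (simp add: algebra_simps)
      qed
      finally show ?thesis .
    next
      case 3
      define \<rho> where "\<rho> = norm x / 2"
      have \<rho>: "R \<le> \<rho>" "1 \<le> \<rho>" using 3 R by (auto simp: \<rho>_def)
      have x0: "x \<noteq> 0" "1 \<le> norm x" using 3 R by auto
      have "ennreal (norm x) * riesz (l + 1) f x \<le> ennreal (2 * u x + 2 * (K powr q * \<rho> powr - h) * C1 * (norm x / 2) powr (n - l))"
      proof (rule general[OF x0(1)])
        fix y :: 'a assume y: "norm x / 2 \<le> norm y"
        then have "v y \<le> K * norm y powr - g" using \<rho> by (intro dec) (auto simp: \<rho>_def)
        then have "f y \<le> (K * norm y powr - g) powr q * norm y powr - s1"
          unfolding f_def using v_pos[of y] q by (intro mult_right_mono powr_mono2) auto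
        also have "\<dots> = K powr q * (norm y powr (- g * q) * norm y powr - s1)"
          by (simp only: powr_mult powr_powr mult.assoc)
        also have "norm y powr (- g * q) * norm y powr - s1 = norm y powr - h"
          unfolding powr_add[symmetric] h_def by (simp add: mult.commute)
        also have "K powr q * norm y powr - h \<le> K powr q * \<rho> powr - h"
          using y \<rho> h0 by (intro mult_left_mono powr_mono2') (auto simp: \<rho>_def)
        finally show "f y \<le> K powr q * \<rho> powr - h" .
      qed auto
      also have "2 * (K powr q * \<rho> powr - h) * C1 * (norm x / 2) powr (n - l) = 2 * K powr q * C1 * (\<rho> powr - h * \<rho> powr (n - l))"
        by (simp add: \<rho>_def)
      also have "\<rho> powr - h * \<rho> powr (n - l) = \<rho> powr (n - l - h)" unfolding powr_add[symmetric] by simp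
      also have "ennreal (2 * u x + 2 * K powr q * C1 * \<rho> powr (n - l - h)) \<le> ennreal ((2 + D1 + D2) * u x)"
      proof (rule ennreal_leI)
        have "\<rho> powr (n - l - h) \<le> \<rho> powr - l" using \<rho> hn by (intro powr_mono) auto
        also have "\<rho> powr - l = 2 powr l * norm x powr - l" using half_powr[of "norm x" "- l"] by (simp add: \<rho>_def)
        finally have "2 * K powr q * C1 * \<rho> powr (n - l - h) \<le> 2 * K powr q * C1 * (2 powr l * norm x powr - l)"
          using C1 by (intro mult_left_mono) auto
        also have "\<dots> = D2 * (c' * norm x powr - l)" using c' by (simp add: D2_def)
        also have "\<dots> \<le> D2 * u x" using c'(2)[rule_format, OF x0(2)] D by (intro mult_left_mono) auto
        finally have "2 * K powr q * C1 * \<rho> powr (n - l - h) \<le> D2 * u x" .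
        moreover have "0 \<le> D1 * u x" using D u_pos[of x] by simp
        ultimately show "2 * u x + 2 * K powr q * C1 * \<rho> powr (n - l - h) \<le> (2 + D1 + D2) * u x"
          by (simp add: algebra_simps)
      qed
      finally show ?thesis .
    qed simp
  qed
  show ?thesis using main D unfolding f_def[abs_def] by (intro exI[of _ "2 + D1 + D2"]) auto
qed

text \<open>\<open>powr_neg_tangent\<close> integrated against the source. The gradient potential
  sits at \<open>z\<close>, the point where \<open>u\<close> is bounded from above, so that
  \<open>gradient_potential_le\<close> can turn it into a multiple of \<open>u z\<close>
  itself.\<close>

lemma u_difference:
  "ennreal (u z) \<le> ennreal (u x) + ennreal (l * norm (z - x)) * riesz (l + 1) (\<lambda>y. v y powr q * norm y powr - s1) z"
proof -
  define f where "f y = v y powr q * norm y powr - s1" for y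
  have [measurable]: "f \<in> borel_measurable borel" unfolding f_def by measurable
  have f0: "0 \<le> f y" for y by (simp add: f_def)
  have "riesz l f z \<le> (\<integral>\<^sup>+ y. ennreal (f y * norm (x - y) powr - l) + ennreal (l * norm (z - x)) * ennreal (f y * norm (z - y) powr - (l + 1)) \<partial>lborel)"
    unfolding riesz_def
  proof (intro nn_integral_mono_AE)
    have "AE y in lborel. y \<noteq> x" "AE y in lborel. y \<noteq> z" by (rule AE_lborel_singleton)+
    then show "AE y in lborel. ennreal (f y * norm (z - y) powr - l) \<le> ennreal (f y * norm (x - y) powr - l)
      + ennreal (l * norm (z - x)) * ennreal (f y * norm (z - y) powr - (l + 1))"
    proof eventually_elim
      case (elim y)
      have "\<bar>norm (z - y) - norm (x - y)\<bar> \<le> norm (z - x)"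
        using norm_triangle_ineq3[of "z - y" "x - y"] by simp
      then have "l * \<bar>norm (z - y) - norm (x - y)\<bar> * norm (z - y) powr - (l + 1) \<le> l * norm (z - x) * norm (z - y) powr - (l + 1)"
        using l by (intro mult_right_mono mult_left_mono) auto
      moreover have "norm (z - y) powr - l \<le> norm (x - y) powr - l + l * \<bar>norm (z - y) - norm (x - y)\<bar> * norm (z - y) powr - (l + 1)"
        using elim l by (intro powr_neg_tangent) auto
      ultimately have "norm (z - y) powr - l \<le> norm (x - y) powr - l + l * norm (z - x) * norm (z - y) powr - (l + 1)" by linarith
      then have "f y * norm (z - y) powr - l \<le> f y * (norm (x - y) powr - l + l * norm (z - x) * norm (z - y) powr - (l + 1))"
        using f0 by (intro mult_left_mono) auto
      then have "ennreal (f y * norm (z - y) powr - l) \<le> ennreal (f y * norm (x - y) powr - l + l * norm (z - x) * (f y * norm (z - y) powr - (l + 1)))"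
        by (intro ennreal_leI) (simp add: algebra_simps)
      also have "\<dots> = ennreal (f y * norm (x - y) powr - l) + ennreal (l * norm (z - x)) * ennreal (f y * norm (z - y) powr - (l + 1))"
        using f0 l by (subst ennreal_plus) (auto simp: ennreal_mult)
      finally show ?case .
    qed
  qed
  also have "\<dots> = riesz l f x + ennreal (l * norm (z - x)) * riesz (l + 1) f z"
    unfolding riesz_def by (simp add: nn_integral_add nn_integral_cmult)
  finally show ?thesis using u_eq[of x] u_eq[of z] by (simp add: f_def[abs_def])
qed

lemma u_dilate:
  assumes t: "0 < t"
  shows "ennreal (u (t *\<^sub>R x)) = ennreal (t powr (real DIM('a) - l - s1)) * riesz l (\<lambda>z. v (t *\<^sub>R z) powr q * norm z powr - s1) x"
proof -
  have "ennreal (u (t *\<^sub>R x)) = ennreal (t powr (real DIM('a) - l)) * riesz l (\<lambda>z. v (t *\<^sub>R z) powr q * norm (t *\<^sub>R z) powr - s1) x"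
    unfolding u_eq by (rule riesz_scale[OF _ _ t]) auto
  also have "(\<lambda>z. v (t *\<^sub>R z) powr q * norm (t *\<^sub>R z) powr - s1) = (\<lambda>z. t powr - s1 * (v (t *\<^sub>R z) powr q * norm z powr - s1))"
  proof
    fix z :: 'a
    have "norm (t *\<^sub>R z) = t * norm z" using t by simp
    then have "norm (t *\<^sub>R z) powr - s1 = t powr - s1 * norm z powr - s1" by (simp only: powr_mult)
    then show "v (t *\<^sub>R z) powr q * norm (t *\<^sub>R z) powr - s1 = t powr - s1 * (v (t *\<^sub>R z) powr q * norm z powr - s1)" by simp
  qed
  also have "riesz l \<dots> x = ennreal (t powr - s1) * riesz l (\<lambda>z. v (t *\<^sub>R z) powr q * norm z powr - s1) x"
    by (rule riesz_cmult) auto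
  also have "ennreal (t powr (real DIM('a) - l)) * (ennreal (t powr - s1) * riesz l (\<lambda>z. v (t *\<^sub>R z) powr q * norm z powr - s1) x)
    = ennreal (t powr (real DIM('a) - l) * t powr - s1) * riesz l (\<lambda>z. v (t *\<^sub>R z) powr q * norm z powr - s1) x"
    by (simp add: ennreal_mult mult.assoc)
  also have "t powr (real DIM('a) - l) * t powr - s1 = t powr (real DIM('a) - l - s1)"
    unfolding powr_add[symmetric] by simp
  finally show ?thesis .
qed

end

section \<open>Relative Lipschitz bound, finite energy and the Pohozaev argument\<close>

context hardy_sobolev_system
begin

text \<open>\<open>u_difference\<close> is applied in both directions, with z = t x and with z = x;
  the small multiple of \<open>u z\<close> on the right is absorbed when |t - 1| is small. Division
  by \<open>u x\<close> gives a bound uniform in \<open>x\<close>, as the Taylor expansion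
  requires.\<close>

lemma u_relative_lipschitz:
  assumes l1: "l + 1 < real DIM('a)"
    and B: "\<And>x. v x \<le> B" and R: "1 \<le> R" and K: "0 < K" and dec: "\<And>x. R \<le> norm x \<Longrightarrow> v x \<le> K * norm x powr - g"
    and h: "real DIM('a) < q * g + s1" and g: "0 < g"
  shows "\<exists>D>0. \<exists>\<eta>>0. \<eta> \<le> 1 / 2 \<and> (\<forall>t x. \<bar>t - 1\<bar> \<le> \<eta> \<longrightarrow> \<bar>u (t *\<^sub>R x) / u x - 1\<bar> \<le> D * \<bar>t - 1\<bar> \<and> \<bar>u (t *\<^sub>R x) / u x - 1\<bar> \<le> 1 / 2)"
proof -
  obtain C where C: "C > 0" "\<forall>x. ennreal (norm x) * riesz (l + 1) (\<lambda>y. v y powr q * norm y powr - s1) x \<le> ennreal (C * u x)"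
    using gradient_potential_le[OF assms] by blast
  define D where "D = 2 * l * C"
  have D: "D > 0" using l C by (simp add: D_def)
  \<comment> \<open>The factor 2 allows |t x - x| to be measured by |t x| as well as by |x|, since t
    >= 1/2.\<close>
  have step: "u z \<le> u x + 2 * l * C * d * u z" if d: "0 \<le> d" "norm (z - x) \<le> 2 * d * norm z" for z x d
  proof -
    have "ennreal (u z) \<le> ennreal (u x) + ennreal (l * norm (z - x)) * riesz (l + 1) (\<lambda>y. v y powr q * norm y powr - s1) z"
      by (rule u_difference)
    also have "\<dots> \<le> ennreal (u x) + ennreal (l * (2 * d * norm z)) * riesz (l + 1) (\<lambda>y. v y powr q * norm y powr - s1) z"
      using d l by (intro add_left_mono mult_right_mono ennreal_leI mult_left_mono) auto
    also have "ennreal (l * (2 * d * norm z)) = ennreal (2 * l * d) * ennreal (norm z)"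
      using d l by (subst ennreal_mult[symmetric]) (auto simp: mult_ac)
    also have "ennreal (2 * l * d) * ennreal (norm z) * riesz (l + 1) (\<lambda>y. v y powr q * norm y powr - s1) z
      \<le> ennreal (2 * l * d) * ennreal (C * u z)"
      unfolding mult.assoc by (intro mult_left_mono C(2)[rule_format]) auto
    also have "ennreal (2 * l * d) * ennreal (C * u z) = ennreal (2 * l * C * d * u z)"
      using d l C u_pos[of z] by (subst ennreal_mult[symmetric]) (auto simp: mult_ac)
    also have "ennreal (u x) + ennreal (2 * l * C * d * u z) = ennreal (u x + 2 * l * C * d * u z)"
      using d l C u_pos[of z] u_pos[of x] by (intro ennreal_plus[symmetric]) auto
    finally have "ennreal (u z) \<le> ennreal (u x + 2 * l * C * d * u z)" by (simp add: add_left_mono)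
    then show ?thesis using d l C u_pos[of z] u_pos[of x] by (subst (asm) ennreal_le_iff) (auto intro!: add_nonneg_nonneg)
  qed
  \<comment> \<open>Then D |t - 1| <= 1/4, which gives s <= 2 and from this |s - 1| <= 1/2 for the
    ratio \<open>s\<close>.\<close>
  define \<eta> where "\<eta> = min (1 / 2) (1 / (4 * D))"
  have \<eta>: "0 < \<eta>" "\<eta> \<le> 1 / 2" "\<eta> \<le> 1 / (4 * D)" using D by (auto simp: \<eta>_def)
  have "\<bar>u (t *\<^sub>R x) / u x - 1\<bar> \<le> 2 * D * \<bar>t - 1\<bar> \<and> \<bar>u (t *\<^sub>R x) / u x - 1\<bar> \<le> 1 / 2" if t: "\<bar>t - 1\<bar> \<le> \<eta>" for t x
  proof -
    define \<epsilon> where "\<epsilon> = D * \<bar>t - 1\<bar>"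
    have t2: "1 / 2 \<le> t" using t \<eta> by linarith
    have "D * \<bar>t - 1\<bar> \<le> D * (1 / (4 * D))" using t \<eta> D by (intro mult_left_mono) auto
    then have \<epsilon>: "0 \<le> \<epsilon>" "\<epsilon> \<le> 1 / 4" using D by (auto simp: \<epsilon>_def)
    have e: "t *\<^sub>R x - x = (t - 1) *\<^sub>R x" by (simp add: scaleR_diff_left)
    have nrm: "norm (t *\<^sub>R x - x) = \<bar>t - 1\<bar> * norm x" unfolding e by simp
    define s where "s = u (t *\<^sub>R x) / u x"
    have s0: "s > 0" using u_pos by (simp add: s_def)
    have us: "u (t *\<^sub>R x) = s * u x" using u_pos[of x] by (simp add: s_def)
    have "1 * norm x \<le> 2 * t * norm x" using t2 by (intro mult_right_mono) auto
    then have "\<bar>t - 1\<bar> * norm x \<le> \<bar>t - 1\<bar> * (2 * t * norm x)" by (intro mult_left_mono) auto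
    then have "norm (t *\<^sub>R x - x) \<le> 2 * \<bar>t - 1\<bar> * norm (t *\<^sub>R x)" unfolding nrm using t2 by (simp add: mult_ac)
    then have "u (t *\<^sub>R x) \<le> u x + 2 * l * C * \<bar>t - 1\<bar> * u (t *\<^sub>R x)" by (intro step) auto
    then have "s * u x \<le> (1 + \<epsilon> * s) * u x" by (simp add: us \<epsilon>_def D_def algebra_simps)
    then have 1: "s \<le> 1 + \<epsilon> * s" using u_pos[of x] by simp
    have "norm (x - t *\<^sub>R x) \<le> 2 * \<bar>t - 1\<bar> * norm x" using nrm by (simp add: norm_minus_commute)
    then have "u x \<le> u (t *\<^sub>R x) + 2 * l * C * \<bar>t - 1\<bar> * u x" by (intro step) auto
    then have "1 * u x \<le> (s + \<epsilon>) * u x" by (simp add: us \<epsilon>_def D_def algebra_simps)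
    then have 2: "1 \<le> s + \<epsilon>" using u_pos[of x] by simp
    have "\<epsilon> * s \<le> 1 / 4 * s" using \<epsilon> s0 by (intro mult_right_mono) auto
    then have "s \<le> 2" using 1 by linarith
    then have "\<epsilon> * s \<le> \<epsilon> * 2" using \<epsilon> by (intro mult_left_mono) auto
    then have "s - 1 \<le> 2 * \<epsilon>" "1 - s \<le> \<epsilon>" using 1 2 by auto
    then have "\<bar>s - 1\<bar> \<le> 2 * \<epsilon>" "\<bar>s - 1\<bar> \<le> 1 / 2" using \<epsilon> by linarith+
    then show ?thesis unfolding s_def \<epsilon>_def by simp
  qed
  then show ?thesis using D \<eta>(1,2) by (intro exI[of _ "2 * D"] conjI exI[of _ \<eta>]) auto
qed

text \<open>From p l > p a = b + n - l - s2 follows (p + 1) l + s2 > n, so the fast decay of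
  \<open>u\<close> makes the energy finite at infinity; at the origin s2 < n suffices.\<close>

lemma energy_finite:
  assumes Bu: "\<And>x. u x \<le> B" and R: "1 \<le> R" and C: "0 < C" and dec: "\<And>x. R \<le> norm x \<Longrightarrow> u x \<le> C * norm x powr - l"
  shows "(\<integral>\<^sup>+ x. ennreal (u x powr (p + 1) * norm x powr - s2) \<partial>lborel) < \<infinity>"
proof -
  have al: "a < l" using ab b by simp
  have "p * a < p * l" using al p by simp
  then have hn: "real DIM('a) < (p + 1) * l + s2" using pa b by (simp add: algebra_simps)
  obtain C1 where C1: "C1 > 0" "\<forall>r>0. (\<integral>\<^sup>+ (y::'a). ennreal (norm y powr - ((p + 1) * l + s2)) * indicator (- ball 0 r) y \<partial>lborel)
            \<le> ennreal (C1 * r powr (real DIM('a) - ((p + 1) * l + s2)))"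
    using nn_integral_norm_powr_compl_ball[OF hn] by blast
  have "s2 < real DIM('a)" using s2 l by simp
  from nn_integral_norm_powr_ball[OF s2(1) this]
  obtain C2 where C2: "C2 > 0" "\<forall>r>0. \<forall>x::'a. (\<integral>\<^sup>+ y. ennreal (norm (x - y) powr - s2) * indicator (ball x r) y \<partial>lborel)
            \<le> ennreal (C2 * r powr (real DIM('a) - s2))" by blast
  have "(\<integral>\<^sup>+ x. ennreal (u x powr (p + 1) * norm x powr - s2) \<partial>lborel)
    \<le> (\<integral>\<^sup>+ (x::'a). ennreal (B powr (p + 1)) * (ennreal (norm (0 - x) powr - s2) * indicator (ball 0 R) x)
       + ennreal (C powr (p + 1)) * (ennreal (norm x powr - ((p + 1) * l + s2)) * indicator (- ball 0 R) x) \<partial>lborel)"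
  proof (intro nn_integral_mono)
    fix x
    show "ennreal (u x powr (p + 1) * norm x powr - s2) \<le> ennreal (B powr (p + 1)) * (ennreal (norm (0 - x) powr - s2) * indicator (ball 0 R) x)
       + ennreal (C powr (p + 1)) * (ennreal (norm x powr - ((p + 1) * l + s2)) * indicator (- ball 0 R) x)"
    proof (cases "x \<in> ball 0 R")
      case True
      have "u x powr (p + 1) * norm x powr - s2 \<le> B powr (p + 1) * norm (0 - x) powr - s2"
        using Bu[of x] u_pos[of x] p by (auto intro!: mult_right_mono powr_mono2)
      then have "ennreal (u x powr (p + 1) * norm x powr - s2) \<le> ennreal (B powr (p + 1)) * ennreal (norm (0 - x) powr - s2)"
        by (simp add: ennreal_mult[symmetric] ennreal_leI)
      then show ?thesis using True by simp
    next
      case False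
      then have "u x \<le> C * norm x powr - l" by (intro dec) auto
      then have "u x powr (p + 1) * norm x powr - s2 \<le> (C * norm x powr - l) powr (p + 1) * norm x powr - s2"
        using u_pos[of x] p by (intro mult_right_mono powr_mono2) auto
      also have "\<dots> = C powr (p + 1) * (norm x powr (- l * (p + 1)) * norm x powr - s2)"
        by (simp only: powr_mult powr_powr mult.assoc)
      also have "norm x powr (- l * (p + 1)) * norm x powr - s2 = norm x powr - ((p + 1) * l + s2)"
        unfolding powr_add[symmetric] by (simp add: algebra_simps)
      finally have "ennreal (u x powr (p + 1) * norm x powr - s2) \<le> ennreal (C powr (p + 1)) * ennreal (norm x powr - ((p + 1) * l + s2))"
        by (simp add: ennreal_mult[symmetric] ennreal_leI)
      then show ?thesis using False by simp
    qed
  qed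
  also have "\<dots> = ennreal (B powr (p + 1)) * (\<integral>\<^sup>+ (x::'a). ennreal (norm (0 - x) powr - s2) * indicator (ball 0 R) x \<partial>lborel)
       + ennreal (C powr (p + 1)) * (\<integral>\<^sup>+ (x::'a). ennreal (norm x powr - ((p + 1) * l + s2)) * indicator (- ball 0 R) x \<partial>lborel)"
    by (simp add: nn_integral_add nn_integral_cmult)
  also have "\<dots> \<le> ennreal (B powr (p + 1)) * ennreal (C2 * R powr (real DIM('a) - s2))
       + ennreal (C powr (p + 1)) * ennreal (C1 * R powr (real DIM('a) - ((p + 1) * l + s2)))"
    using R by (intro add_mono mult_left_mono C2(2)[rule_format] C1(2)[rule_format]) auto
  also have "\<dots> < \<infinity>" by (simp add: ennreal_mult_less_top)
  finally show ?thesis .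
qed

text \<open>Pohozaev identity. Pairing the dilate \<open>u (t x)\<close> with \<open>u\<^sup>p |x|\<^sup>-\<^sup>s\<close> gives an exact identity for every \<open>t\<close>;
  bounding one side by Young's inequality and the other by a Taylor expansion of \<open>s\<^sup>p\<^sup>+\<^sup>1\<close> shows that
  a function of \<open>t\<close> vanishing at \<open>t = 1\<close> is nonnegative nearby, so no differentiability of \<open>u\<close> or \<open>v\<close> is needed.\<close>

lemma critical_of_fast_decay:
  assumes l1: "l + 1 < real DIM('a)"
    and Bu: "\<And>x. u x \<le> B" and B: "\<And>x. v x \<le> B" and R: "1 \<le> R" and K: "0 < K" and dec: "\<And>x. R \<le> norm x \<Longrightarrow> v x \<le> K * norm x powr - g"
    and h: "real DIM('a) < q * g + s1" and g: "0 < g"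
  shows "(real DIM('a) - s1) / (1 + q) + (real DIM('a) - s2) / (1 + p) = l"
proof -
  define n where "n = real DIM('a)"
  \<comment> \<open>\<open>E\<close> and \<open>F\<close> are energies of dilates, which scale by
    exact powers of t; \<open>G\<close> and \<open>H\<close> pair a dilate with the undilated
    functions.\<close>
  define E where "E t = (\<integral>\<^sup>+ x. ennreal (u (t *\<^sub>R x) powr (p + 1) * norm x powr - s2) \<partial>lborel)" for t
  define F where "F t = (\<integral>\<^sup>+ x. ennreal (v (t *\<^sub>R x) powr (q + 1) * norm x powr - s1) \<partial>lborel)" for t
  define G where "G t = (\<integral>\<^sup>+ x. ennreal (u x powr p * norm x powr - s2) * ennreal (u (t *\<^sub>R x)) \<partial>lborel)" for t
  define H where "H t = (\<integral>\<^sup>+ x. ennreal (v (t *\<^sub>R x) powr q * norm x powr - s1) * ennreal (v x) \<partial>lborel)" for t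
  have E_scale: "E t = ennreal (t powr (s2 - n)) * E 1" if "0 < t" for t
    unfolding E_def scaleR_one n_def by (rule nn_integral_dilate_weight) (use that in auto)
  have F_scale: "F t = ennreal (t powr (s1 - n)) * F 1" if "0 < t" for t
    unfolding F_def scaleR_one n_def by (rule nn_integral_dilate_weight) (use that in auto)
  \<comment> \<open>The identity that carries the proof: it combines the dilated equation for
    \<open>u\<close>, the symmetry of the kernel and the equation for \<open>v\<close>.\<close>
  have GH: "G t = ennreal (t powr (n - l - s1)) * H t" if t: "0 < t" for t
  proof -
    have "G t = (\<integral>\<^sup>+ x. ennreal (t powr (n - l - s1)) * (ennreal (u x powr p * norm x powr - s2) * riesz l (\<lambda>z. v (t *\<^sub>R z) powr q * norm z powr - s1) x) \<partial>lborel)"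
      unfolding G_def u_dilate[OF t] n_def by (intro nn_integral_cong) (simp only: mult_ac)
    also have "\<dots> = ennreal (t powr (n - l - s1)) * (\<integral>\<^sup>+ x. ennreal (u x powr p * norm x powr - s2) * riesz l (\<lambda>z. v (t *\<^sub>R z) powr q * norm z powr - s1) x \<partial>lborel)"
      by (rule nn_integral_cmult) measurable
    also have "(\<integral>\<^sup>+ x. ennreal (u x powr p * norm x powr - s2) * riesz l (\<lambda>z. v (t *\<^sub>R z) powr q * norm z powr - s1) x \<partial>lborel)
      = (\<integral>\<^sup>+ x. ennreal (v (t *\<^sub>R x) powr q * norm x powr - s1) * riesz l (\<lambda>y. u y powr p * norm y powr - s2) x \<partial>lborel)"
      by (intro riesz_commute) auto
    also have "\<dots> = H t" unfolding H_def v_eq ..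
    finally show ?thesis .
  qed
  have powr1: "w powr (z + 1) = w powr z * w" if "0 < w" for w z :: real using that by (simp add: powr_add)
  have G1: "G 1 = E 1"
    unfolding G_def E_def using u_pos by (intro nn_integral_cong) (simp add: ennreal_mult'[symmetric] powr1 mult_ac less_imp_le)
  have H1: "H 1 = F 1"
    unfolding H_def F_def using v_pos by (intro nn_integral_cong) (simp add: ennreal_mult'[symmetric] powr1 mult_ac less_imp_le)
  \<comment> \<open>At t = 1 the identity says that the two energies coincide, so that a single
    number \<open>e\<close> remains.\<close>
  have FE: "F 1 = E 1" using GH[of 1] G1 H1 by simp
  obtain C where C: "C > 0" "\<forall>x. 2 * R \<le> norm x \<longrightarrow> u x \<le> C * norm x powr - l"
    using u_fast[OF B R K dec h] by blast
  have "E 1 < \<infinity>"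
    unfolding E_def scaleR_one using R C by (intro energy_finite[OF Bu, of "2 * R" C]) auto
  then obtain e where e: "E 1 = ennreal e" "0 \<le> e" by (cases "E 1") auto
  have "E 1 \<noteq> 0"
  proof
    assume "E 1 = 0"
    then have "emeasure lborel {x \<in> space lborel. ennreal (u x powr (p + 1) * norm x powr - s2) \<noteq> 0} = 0"
      unfolding E_def scaleR_one by (subst (asm) nn_integral_0_iff) measurable
    also have "{x \<in> space lborel. ennreal (u x powr (p + 1) * norm x powr - s2) \<noteq> 0} = UNIV - {0}"
      using u_pos by (auto simp: less_le)
    also have "emeasure lborel (UNIV - {0::'a}) = emeasure lborel (UNIV :: 'a set)"
      by (rule emeasure_Diff_null_set) auto
    finally show False by simp
  qed
  then have e0: "0 < e" using e by (cases "e = 0") auto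
  obtain D \<eta> where D: "D > 0" and \<eta>: "\<eta> > 0" "\<eta> \<le> 1 / 2"
    and lip: "\<And>t x. \<bar>t - 1\<bar> \<le> \<eta> \<Longrightarrow> \<bar>u (t *\<^sub>R x) / u x - 1\<bar> \<le> D * \<bar>t - 1\<bar> \<and> \<bar>u (t *\<^sub>R x) / u x - 1\<bar> \<le> 1 / 2"
    using u_relative_lipschitz[OF l1 B R K dec h g] by blast
  have p2: "2 \<le> p + 1" using p by simp
  obtain A where A: "A > 0" "\<forall>s. \<bar>s - 1\<bar> \<le> 1 / 2 \<longrightarrow> s powr (p + 1) \<le> 1 + (p + 1) * (s - 1) + A * (s - 1)\<^sup>2"
    using powr_le_taylor2[OF p2] by blast
  define A' where "A' = A * D\<^sup>2"
  have A': "A' \<ge> 0" using A by (simp add: A'_def)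
  \<comment> \<open>A lower bound for \<open>G t\<close>: with s = u(tx) / u(x), the Taylor bound
    for s^(p + 1) is multiplied by u^(p + 1) |x|^-s2 and integrated. The error is quadratic in t - 1
    because |s - 1| <= D |t - 1| uniformly in x.\<close>
  have E_le: "E t + ennreal p * E 1 \<le> ennreal (p + 1) * G t + ennreal (A' * (t - 1)\<^sup>2) * E 1" if t: "\<bar>t - 1\<bar> \<le> \<eta>" for t
  proof -
    have "E t + ennreal p * E 1 = (\<integral>\<^sup>+ x. ennreal (u (t *\<^sub>R x) powr (p + 1) * norm x powr - s2)
        + ennreal p * ennreal (u x powr (p + 1) * norm x powr - s2) \<partial>lborel)"
      unfolding E_def scaleR_one by (simp add: nn_integral_add nn_integral_cmult)
    also have "\<dots> \<le> (\<integral>\<^sup>+ x. ennreal (p + 1) * (ennreal (u x powr p * norm x powr - s2) * ennreal (u (t *\<^sub>R x)))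
        + ennreal (A' * (t - 1)\<^sup>2) * ennreal (u x powr (p + 1) * norm x powr - s2) \<partial>lborel)"
    proof (intro nn_integral_mono)
      fix x
      define s where "s = u (t *\<^sub>R x) / u x"
      have us: "u (t *\<^sub>R x) = s * u x" using u_pos[of x] by (simp add: s_def)
      have "\<bar>s - 1\<bar> \<le> D * \<bar>t - 1\<bar>" "\<bar>s - 1\<bar> \<le> 1 / 2" using lip[OF t, of x] by (auto simp: s_def)
      then have "\<bar>s - 1\<bar>\<^sup>2 \<le> (D * \<bar>t - 1\<bar>)\<^sup>2" by (intro power_mono) auto
      then have "A * (s - 1)\<^sup>2 \<le> A * (D * \<bar>t - 1\<bar>)\<^sup>2" using A by (intro mult_left_mono) auto
      also have "\<dots> = A' * (t - 1)\<^sup>2" by (simp add: A'_def power_mult_distrib)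
      finally have "s powr (p + 1) + p \<le> (p + 1) * s + A' * (t - 1)\<^sup>2"
        using A(2)[rule_format, OF \<open>\<bar>s - 1\<bar> \<le> 1 / 2\<close>] by (simp add: algebra_simps)
      then have "(s powr (p + 1) + p) * (u x powr (p + 1) * norm x powr - s2) \<le> ((p + 1) * s + A' * (t - 1)\<^sup>2) * (u x powr (p + 1) * norm x powr - s2)"
        by (intro mult_right_mono) auto
      moreover have "u (t *\<^sub>R x) powr (p + 1) = s powr (p + 1) * u x powr (p + 1)" unfolding us by (simp only: powr_mult)
      moreover have "u x powr p * u (t *\<^sub>R x) = s * u x powr (p + 1)" unfolding us powr1[OF u_pos] by (simp only: mult_ac)
      ultimately have "u (t *\<^sub>R x) powr (p + 1) * norm x powr - s2 + p * (u x powr (p + 1) * norm x powr - s2)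
        \<le> (p + 1) * ((u x powr p * u (t *\<^sub>R x)) * norm x powr - s2) + A' * (t - 1)\<^sup>2 * (u x powr (p + 1) * norm x powr - s2)"
        by (simp add: algebra_simps)
      then have "ennreal (u (t *\<^sub>R x) powr (p + 1) * norm x powr - s2 + p * (u x powr (p + 1) * norm x powr - s2))
        \<le> ennreal ((p + 1) * (u x powr p * norm x powr - s2 * u (t *\<^sub>R x)) + A' * (t - 1)\<^sup>2 * (u x powr (p + 1) * norm x powr - s2))"
        by (intro ennreal_leI) (simp add: mult_ac)
      moreover have "ennreal (u (t *\<^sub>R x) powr (p + 1) * norm x powr - s2 + p * (u x powr (p + 1) * norm x powr - s2))
        = ennreal (u (t *\<^sub>R x) powr (p + 1) * norm x powr - s2) + ennreal p * ennreal (u x powr (p + 1) * norm x powr - s2)"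
        using p by (subst ennreal_plus) (auto simp: ennreal_mult)
      moreover have "ennreal ((p + 1) * (u x powr p * norm x powr - s2 * u (t *\<^sub>R x)) + A' * (t - 1)\<^sup>2 * (u x powr (p + 1) * norm x powr - s2))
        = ennreal ((p + 1) * (u x powr p * norm x powr - s2 * u (t *\<^sub>R x))) + ennreal (A' * (t - 1)\<^sup>2 * (u x powr (p + 1) * norm x powr - s2))"
        using p A' u_pos[of "t *\<^sub>R x"] by (intro ennreal_plus) auto
      moreover have "ennreal ((p + 1) * (u x powr p * norm x powr - s2 * u (t *\<^sub>R x))) = ennreal (p + 1) * (ennreal (u x powr p * norm x powr - s2) * ennreal (u (t *\<^sub>R x)))"
      proof -
        have "ennreal (u x powr p * norm x powr - s2) * ennreal (u (t *\<^sub>R x)) = ennreal (u x powr p * norm x powr - s2 * u (t *\<^sub>R x))"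
          using u_pos[of "t *\<^sub>R x"] by (intro ennreal_mult[symmetric]) auto
        then show ?thesis using p u_pos[of "t *\<^sub>R x"] by (simp only:) (intro ennreal_mult; simp)
      qed
      moreover have "ennreal (A' * (t - 1)\<^sup>2 * (u x powr (p + 1) * norm x powr - s2)) = ennreal (A' * (t - 1)\<^sup>2) * ennreal (u x powr (p + 1) * norm x powr - s2)"
        using A' by (intro ennreal_mult) auto
      ultimately show "ennreal (u (t *\<^sub>R x) powr (p + 1) * norm x powr - s2) + ennreal p * ennreal (u x powr (p + 1) * norm x powr - s2)
        \<le> ennreal (p + 1) * (ennreal (u x powr p * norm x powr - s2) * ennreal (u (t *\<^sub>R x)))
        + ennreal (A' * (t - 1)\<^sup>2) * ennreal (u x powr (p + 1) * norm x powr - s2)" by (simp only:)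
    qed
    also have "\<dots> = ennreal (p + 1) * G t + ennreal (A' * (t - 1)\<^sup>2) * E 1"
      unfolding E_def G_def scaleR_one by (rule nn_integral_lincomb) measurable
    finally show ?thesis .
  qed
  \<comment> \<open>An upper bound for \<open>H t\<close> by Young's inequality with exponents (q +
    1) / q and q + 1; it is an equality at t = 1.\<close>
  have H_le: "H t \<le> ennreal (q / (q + 1)) * F t + ennreal (1 / (q + 1)) * F 1" for t
  proof -
    have "H t \<le> (\<integral>\<^sup>+ x. ennreal (q / (q + 1)) * ennreal (v (t *\<^sub>R x) powr (q + 1) * norm x powr - s1)
       + ennreal (1 / (q + 1)) * ennreal (v x powr (q + 1) * norm x powr - s1) \<partial>lborel)"
      unfolding H_def
    proof (intro nn_integral_mono)
      fix x
      define y where "y = v (t *\<^sub>R x)"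
      define z where "z = v x"
      have yz: "0 < y" "0 < z" using v_pos by (auto simp: y_def z_def)
      have "(y powr (q + 1)) powr (q / (q + 1)) * (z powr (q + 1)) powr (1 / (q + 1)) \<le> q / (q + 1) * y powr (q + 1) + 1 / (q + 1) * z powr (q + 1)"
        using q yz by (intro Youngs_inequality_0) (auto simp: field_simps)
      then have "y powr q * z \<le> q / (q + 1) * y powr (q + 1) + 1 / (q + 1) * z powr (q + 1)"
        using q yz by (simp add: powr_powr)
      then have "y powr q * z * norm x powr - s1 \<le> (q / (q + 1) * y powr (q + 1) + 1 / (q + 1) * z powr (q + 1)) * norm x powr - s1"
        by (intro mult_right_mono) auto
      then have "ennreal (y powr q * norm x powr - s1 * z) \<le> ennreal (q / (q + 1) * (y powr (q + 1) * norm x powr - s1) + 1 / (q + 1) * (z powr (q + 1) * norm x powr - s1))"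
        by (intro ennreal_leI) (simp add: algebra_simps)
      moreover have "ennreal (y powr q * norm x powr - s1 * z) = ennreal (y powr q * norm x powr - s1) * ennreal z"
        using yz by (intro ennreal_mult) auto
      moreover have "ennreal (q / (q + 1) * (y powr (q + 1) * norm x powr - s1) + 1 / (q + 1) * (z powr (q + 1) * norm x powr - s1))
        = ennreal (q / (q + 1) * (y powr (q + 1) * norm x powr - s1)) + ennreal (1 / (q + 1) * (z powr (q + 1) * norm x powr - s1))"
        using q by (intro ennreal_plus) auto
      moreover have "ennreal (q / (q + 1) * (y powr (q + 1) * norm x powr - s1)) = ennreal (q / (q + 1)) * ennreal (y powr (q + 1) * norm x powr - s1)"
        using q by (intro ennreal_mult) auto
      moreover have "ennreal (1 / (q + 1) * (z powr (q + 1) * norm x powr - s1)) = ennreal (1 / (q + 1)) * ennreal (z powr (q + 1) * norm x powr - s1)"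
        using q by (intro ennreal_mult) auto
      ultimately show "ennreal (v (t *\<^sub>R x) powr q * norm x powr - s1) * ennreal (v x)
        \<le> ennreal (q / (q + 1)) * ennreal (v (t *\<^sub>R x) powr (q + 1) * norm x powr - s1)
       + ennreal (1 / (q + 1)) * ennreal (v x powr (q + 1) * norm x powr - s1)" unfolding y_def z_def by (simp only:)
    qed
    also have "\<dots> = ennreal (q / (q + 1)) * F t + ennreal (1 / (q + 1)) * F 1"
      unfolding F_def scaleR_one by (rule nn_integral_lincomb) measurable
    finally show ?thesis .
  qed
  \<comment> \<open>What the two bounds leave after insertion into the identity and division by the
    energy \<open>e\<close>: an explicit smooth function of t, whatever the regularity of u and
    v.\<close>
  define \<Phi> where "\<Phi> t = (p + 1) * (t powr (n - l - s1) * (q / (q + 1) * t powr (s1 - n) + 1 / (q + 1))) + A' * (t - 1)\<^sup>2 - t powr (s2 - n) - p" for t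
  have \<Phi>_nonneg: "0 \<le> \<Phi> t" if t: "\<bar>t - 1\<bar> \<le> \<eta>" for t
  proof -
    have t0: "0 < t" using t \<eta> by linarith
    define X where "X = t powr (n - l - s1)"
    define Y where "Y = q / (q + 1) * t powr (s1 - n) + 1 / (q + 1)"
    have XY: "0 \<le> X" "0 \<le> Y" using q by (auto simp: X_def Y_def)
    have "G t \<le> ennreal X * (ennreal (q / (q + 1)) * (ennreal (t powr (s1 - n)) * ennreal e) + ennreal (1 / (q + 1)) * ennreal e)"
      using mult_left_mono[OF H_le[of t], of "ennreal X"] F_scale[OF t0] GH[OF t0] FE e by (simp add: X_def)
    also have "\<dots> = ennreal (X * (Y * e))"
    proof -
      have "ennreal (q / (q + 1)) * (ennreal (t powr (s1 - n)) * ennreal e) + ennreal (1 / (q + 1)) * ennreal e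
        = ennreal (q / (q + 1) * (t powr (s1 - n) * e)) + ennreal (1 / (q + 1) * e)"
        using q e by (simp only: ennreal_mult[symmetric] powr_ge_zero mult_nonneg_nonneg divide_nonneg_nonneg order_trans[OF zero_le_one less_imp_le[OF q]] add_nonneg_nonneg zero_le_one)
      also have "\<dots> = ennreal (q / (q + 1) * (t powr (s1 - n) * e) + 1 / (q + 1) * e)"
        using q e by (intro ennreal_plus[symmetric]) auto
      also have "q / (q + 1) * (t powr (s1 - n) * e) + 1 / (q + 1) * e = Y * e" by (simp add: Y_def algebra_simps)
      finally show ?thesis using XY e by (simp only: ennreal_mult[symmetric] mult_nonneg_nonneg)
    qed
    finally have Gle: "G t \<le> ennreal (X * (Y * e))" .
    have "ennreal ((t powr (s2 - n) + p) * e) = E t + ennreal p * E 1"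
      using e p E_scale[OF t0] by (simp add: distrib_right ennreal_mult)
    also have "\<dots> \<le> ennreal (p + 1) * G t + ennreal (A' * (t - 1)\<^sup>2) * E 1" by (rule E_le[OF t])
    also have "\<dots> \<le> ennreal (p + 1) * ennreal (X * (Y * e)) + ennreal (A' * (t - 1)\<^sup>2) * ennreal e"
      unfolding e(1) by (intro add_right_mono mult_left_mono Gle) auto
    also have "\<dots> = ennreal ((p + 1) * (X * (Y * e)) + A' * (t - 1)\<^sup>2 * e)"
      using p XY A' e by (subst ennreal_plus) (auto simp: ennreal_mult)
    finally have "(t powr (s2 - n) + p) * e \<le> (p + 1) * (X * (Y * e)) + A' * (t - 1)\<^sup>2 * e"
      using p XY A' e by (subst (asm) ennreal_le_iff) (auto intro!: add_nonneg_nonneg mult_nonneg_nonneg)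
    also have "\<dots> = ((p + 1) * (X * Y) + A' * (t - 1)\<^sup>2) * e" by (simp add: algebra_simps)
    finally have "t powr (s2 - n) + p \<le> (p + 1) * (X * Y) + A' * (t - 1)\<^sup>2" using e0 by simp
    then show ?thesis by (simp add: \<Phi>_def X_def Y_def)
  qed
  have \<Phi>1: "\<Phi> 1 = 0" using q by (simp add: \<Phi>_def add_divide_distrib[symmetric])
  \<comment> \<open>The derivative of \<Phi> at 1, to which the quadratic error does not
    contribute.\<close>
  define m where "m = (p + 1) * ((n - l - s1) * (q / (q + 1) + 1 / (q + 1)) + q / (q + 1) * (s1 - n)) - (s2 - n)"
  have "DERIV (\<lambda>t. (p + 1) * (t powr k1 * (c1 * t powr k2 + c2)) + A' * (t - 1)\<^sup>2 - t powr k3 - p) 1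
     :> (p + 1) * (k1 * (c1 + c2) + c1 * k2) - k3" for c1 c2 k1 k2 k3
    by (auto intro!: derivative_eq_intros simp: algebra_simps)
  then have "DERIV \<Phi> 1 :> m" unfolding \<Phi>_def m_def .
  moreover have "0 < \<eta>" by (rule \<eta>)
  moreover have "\<forall>y. \<bar>1 - y\<bar> < \<eta> \<longrightarrow> \<Phi> 1 \<le> \<Phi> y"
    using \<Phi>_nonneg \<Phi>1 by (simp add: abs_minus_commute)
  \<comment> \<open>\<Phi> has a local minimum at the interior point t = 1. The relation m = 0
    rearranges to the critical condition.\<close>
  ultimately have "m = 0" by (rule DERIV_local_min)
  moreover have "q / (q + 1) + 1 / (q + 1) = 1" using q by (simp add: add_divide_distrib[symmetric])
  ultimately have "(p + 1) * ((n - l - s1) + q / (q + 1) * (s1 - n)) = s2 - n" by (simp add: m_def)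
  then have "(n - l - s1) + q / (q + 1) * (s1 - n) = (s2 - n) / (p + 1)" using p by (simp add: field_simps)
  moreover have "q / (q + 1) = 1 - 1 / (q + 1)" using q by (simp add: field_simps)
  ultimately have "(n - l - s1) + (1 - 1 / (q + 1)) * (s1 - n) = (s2 - n) / (p + 1)" by simp
  then have "- l - (s1 - n) / (q + 1) = (s2 - n) / (p + 1)" by (simp add: left_diff_distrib)
  moreover have "(s1 - n) / (q + 1) = - ((n - s1) / (1 + q))" "(s2 - n) / (p + 1) = - ((n - s2) / (1 + p))"
    by (simp_all add: minus_divide_left add.commute)
  ultimately show ?thesis by (simp add: n_def)
qed

end

section \<open>Translation of the integral equations into the abstract system, and assembly\<close>

lemma asymp_sim_upper:
  assumes "asymp_sim f g"
  shows "\<exists>C>0. \<exists>R\<ge>1. \<forall>x. R \<le> norm x \<longrightarrow> f x \<le> C * g x"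
proof -
  obtain c C R where "c > 0" "C > 0" "\<forall>x. R \<le> norm x \<longrightarrow> c * g x \<le> f x \<and> f x \<le> C * g x"
    using assms unfolding asymp_sim_def by blast
  then show ?thesis by (intro exI[of _ C] conjI exI[of _ "max 1 R"]) auto
qed

theorem theorem1p4:
  fixes u v :: "'a::euclidean_space \<Rightarrow> real" and \<alpha> \<sigma>1 \<sigma>2 p q :: real
  assumes dim: "DIM('a) \<ge> 3"
    and alpha: "0 < \<alpha>" "\<alpha> < real DIM('a)"
    and sig1: "0 \<le> \<sigma>1" "\<sigma>1 < \<alpha>"
    and sig2: "0 \<le> \<sigma>2" "\<sigma>2 < \<alpha>"
    and pq: "q \<ge> p" "p > 1"
    and sig12: "\<sigma>1 \<ge> \<sigma>2"
    and upos: "\<And>x. u x > 0" and vpos: "\<And>x. v x > 0"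
    and umeas: "u \<in> borel_measurable lborel" and vmeas: "v \<in> borel_measurable lborel"
    and ueq: "\<And>x. ennreal (u x) = (\<integral>\<^sup>+ y. ennreal (v y powr q /
               (norm (x - y) powr (real DIM('a) - \<alpha>) * norm y powr \<sigma>1)) \<partial>lborel)"
    and veq: "\<And>x. ennreal (v x) = (\<integral>\<^sup>+ y. ennreal (u y powr p /
               (norm (x - y) powr (real DIM('a) - \<alpha>) * norm y powr \<sigma>2)) \<partial>lborel)"
    and nonsub: "(real DIM('a) - \<sigma>1) / (1 + q) + (real DIM('a) - \<sigma>2) / (1 + p)
                   \<le> real DIM('a) - \<alpha>"
  shows "(integrable_sol u v \<alpha> \<sigma>1 \<sigma>2 p q \<longleftrightarrow>
            bounded (range u) \<and> bounded (range v) \<and>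
            asymp_sim u (\<lambda>x. norm x powr (- (real DIM('a) - \<alpha>))) \<and>
            (p * (real DIM('a) - \<alpha>) + \<sigma>2 > real DIM('a) \<longrightarrow>
               asymp_sim v (\<lambda>x. norm x powr (- (real DIM('a) - \<alpha>)))) \<and>
            (p * (real DIM('a) - \<alpha>) + \<sigma>2 = real DIM('a) \<longrightarrow>
               asymp_sim v (\<lambda>x. norm x powr (- (real DIM('a) - \<alpha>)) * ln (norm x))) \<and>
            (p * (real DIM('a) - \<alpha>) + \<sigma>2 < real DIM('a) \<longrightarrow>
               asymp_sim v (\<lambda>x. norm x powr (- (p * (real DIM('a) - \<alpha>) - (\<alpha> - \<sigma>2))))))
         \<and> (1 < \<alpha> \<longrightarrow> integrable_sol u v \<alpha> \<sigma>1 \<sigma>2 p q \<longrightarrow>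
              (real DIM('a) - \<sigma>1) / (1 + q) + (real DIM('a) - \<sigma>2) / (1 + p)
                = real DIM('a) - \<alpha>)"
proof -
  define n where "n = real DIM('a)"
  define l where "l = n - \<alpha>"
  define a where "a = exp_q0 \<alpha> \<sigma>1 \<sigma>2 p q"
  define b where "b = exp_p0 \<alpha> \<sigma>1 \<sigma>2 p q"
  have q1: "1 < q" using pq by simp
  have "1 * 1 < p * q" using pq q1 by (intro mult_strict_mono) auto
  then have pq1: "0 < p * q - 1" by simp
  have a_eq: "a * (p * q - 1) = \<alpha> * (1 + q) - (\<sigma>1 + \<sigma>2 * q)"
    using pq1 by (simp add: a_def exp_q0_def)
  have b_eq: "b * (p * q - 1) = \<alpha> * (1 + p) - (\<sigma>2 + \<sigma>1 * p)"
    using pq1 by (simp add: b_def exp_p0_def)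
  have "\<sigma>2 * q < \<alpha> * q" "\<sigma>1 * p < \<alpha> * p" using sig1 sig2 pq q1 by auto
  then have "0 < a * (p * q - 1)" "0 < b * (p * q - 1)"
    unfolding a_eq b_eq using sig1 sig2 by (auto simp: algebra_simps)
  then have a0: "0 < a" and b0: "0 < b" using pq1 by (auto simp: zero_less_mult_iff)
  have "(q * b) * (p * q - 1) = q * (\<alpha> * (1 + p) - (\<sigma>2 + \<sigma>1 * p))" by (simp only: mult.assoc b_eq)
  also have "\<dots> = (\<alpha> * (1 + q) - (\<sigma>1 + \<sigma>2 * q)) + (\<alpha> - \<sigma>1) * (p * q - 1)" by (simp add: algebra_simps)
  also have "\<dots> = (a + \<alpha> - \<sigma>1) * (p * q - 1)" unfolding a_eq[symmetric] by (simp add: algebra_simps)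
  finally have "(q * b) * (p * q - 1) = (a + \<alpha> - \<sigma>1) * (p * q - 1)" .
  then have qb: "q * b = a + \<alpha> - \<sigma>1" using pq1 by simp
  have "(p * a) * (p * q - 1) = p * (\<alpha> * (1 + q) - (\<sigma>1 + \<sigma>2 * q))" by (simp only: mult.assoc a_eq)
  also have "\<dots> = (\<alpha> * (1 + p) - (\<sigma>2 + \<sigma>1 * p)) + (\<alpha> - \<sigma>2) * (p * q - 1)" by (simp add: algebra_simps)
  also have "\<dots> = (b + \<alpha> - \<sigma>2) * (p * q - 1)" unfolding b_eq[symmetric] by (simp add: algebra_simps)
  finally have "(p * a) * (p * q - 1) = (b + \<alpha> - \<sigma>2) * (p * q - 1)" .
  then have pa: "p * a = b + \<alpha> - \<sigma>2" using pq1 by simp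
  \<comment> \<open>(a - b)(p q - 1) = (\<alpha> - \<sigma>2)(q - p) + (\<sigma>1 - \<sigma>2)(p -
    1); this is where q >= p and \<sigma>1 >= \<sigma>2 enter.\<close>
  have ba: "b \<le> a"
  proof -
    have "(\<alpha> - \<sigma>2) * (q - p) \<ge> 0" "(\<sigma>1 - \<sigma>2) * (p - 1) \<ge> 0" using sig2 pq sig12 by auto
    then have "b * (p * q - 1) \<le> a * (p * q - 1)" unfolding a_eq b_eq by (simp add: algebra_simps)
    then show ?thesis using pq1 by simp
  qed
  \<comment> \<open>The non-subcritical condition with denominators cleared, rearranged by (1 + p)(1
    + q) = (p q - 1) + (2 + p + q).\<close>
  have ab: "a + b \<le> l"
  proof -
    have "((n - \<sigma>1) / (1 + q) + (n - \<sigma>2) / (1 + p)) * ((1 + q) * (1 + p)) \<le> (n - \<alpha>) * ((1 + q) * (1 + p))"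
      using nonsub pq q1 by (intro mult_right_mono) (auto simp: n_def)
    also have "((n - \<sigma>1) / (1 + q) + (n - \<sigma>2) / (1 + p)) * ((1 + q) * (1 + p)) = (n - \<sigma>1) * (1 + p) + (n - \<sigma>2) * (1 + q)"
    proof -
      have "(X / Q + Y / P) * (Q * P) = X * P + Y * Q" if "0 < Q" "0 < P" for X Y P Q :: real
        using that by (simp add: field_simps)
      then show ?thesis using pq q1 by simp
    qed
    finally have "(a + b) * (p * q - 1) \<le> l * (p * q - 1)"
      unfolding distrib_right a_eq b_eq l_def by (simp add: algebra_simps)
    then show ?thesis using pq1 by simp
  qed
  have l: "0 < l" "l < real DIM('a)" using alpha by (auto simp: l_def n_def)
  have al: "a < l" "b < l" using ab a0 b0 by auto
  have \<alpha>l: "real DIM('a) - l = \<alpha>" by (simp add: l_def n_def)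
  \<comment> \<open>Also valid at y = x and y = 0, where both sides are 0 because
    \<open>0 powr z = 0\<close> and division by 0 gives 0.\<close>
  have kernel: "w y powr r / (norm (x - y) powr (real DIM('a) - \<alpha>) * norm y powr s) = w y powr r * norm y powr - s * norm (x - y) powr - l"
    for w :: "'a \<Rightarrow> real" and x y r s
    by (simp only: l_def n_def powr_minus divide_inverse inverse_mult_distrib mult_ac)
  interpret hardy_sobolev_system u v l \<sigma>1 \<sigma>2 p q a b
  proof
    show "ennreal (u x) = riesz l (\<lambda>y. v y powr q * norm y powr - \<sigma>1) x" for x
      unfolding ueq riesz_def kernel ..
    show "ennreal (v x) = riesz l (\<lambda>y. u y powr p * norm y powr - \<sigma>2) x" for x
      unfolding veq riesz_def kernel ..
  qed (use l sig1 sig2 pq q1 a0 b0 ab qb pa umeas vmeas upos vpos in \<open>auto simp: \<alpha>l\<close>)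
  interpret sw: hardy_sobolev_system v u l \<sigma>2 \<sigma>1 q p b a by (rule swap)
  have sol: "integrable_sol u v \<alpha> \<sigma>1 \<sigma>2 p q \<longleftrightarrow>
     (\<integral>\<^sup>+ x. ennreal (u x powr (real DIM('a) / a)) \<partial>lborel) < \<infinity> \<and> (\<integral>\<^sup>+ x. ennreal (v x powr (real DIM('a) / b)) \<partial>lborel) < \<infinity>"
    unfolding integrable_sol_def in_Lp_def a_def[symmetric] b_def[symmetric]
    using umeas vmeas upos vpos by (simp add: less_imp_le)
  \<comment> \<open>From a < l, multiplied by p, and \<open>pa\<close>: the source of
    \<open>v\<close> decays fast enough for its potential to converge, and even the slow rate of
    \<open>v\<close> beats the critical exponent \<open>b\<close>.\<close>
  have h2: "\<alpha> < p * l + \<sigma>2" "b < p * l - (\<alpha> - \<sigma>2)"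
  proof -
    have "p * a < p * l" using al pq by simp
    then show "\<alpha> < p * l + \<sigma>2" "b < p * l - (\<alpha> - \<sigma>2)" using pa b0 \<alpha>l by linarith+
  qed
  \<comment> \<open>Shared by both parts of the theorem: (i) needs it for the sharp rates, (ii) for
    the Pohozaev argument.\<close>
  have forward: "\<exists>B g K R. (\<forall>x. u x \<le> B) \<and> (\<forall>x. v x \<le> B) \<and> real DIM('a) < q * g + \<sigma>1 \<and> 0 < g \<and> 0 < K \<and> 1 \<le> R
      \<and> (\<forall>x. R \<le> norm x \<longrightarrow> v x \<le> K * norm x powr - g)"
    if int: "integrable_sol u v \<alpha> \<sigma>1 \<sigma>2 p q"
  proof -
    interpret int: integrable_hardy_sobolev_system u v l \<sigma>1 \<sigma>2 p q a b
      by unfold_locales (use int sol in auto)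
    obtain B1 where B1: "B1 > 0" "\<forall>x. u x \<le> B1" using int.u_bounded[OF ba] by blast
    obtain B2 where B2: "B2 > 0" "\<forall>x. v x \<le> B2" using int.v_bounded_of_u_bounded[OF B1(1)] B1(2) by blast
    define B where "B = max B1 B2"
    have B: "u x \<le> B" "v x \<le> B" for x using B1(2) B2(2) by (auto simp: B_def le_max_iff_disj)
    show ?thesis using int.v_fast_decay[OF ba B] B by blast
  qed
  have bounded_iff: "bounded (range w) \<longleftrightarrow> (\<exists>B. \<forall>x. w x \<le> B)" if "\<And>x. 0 < w x" for w :: "'a \<Rightarrow> real"
    unfolding bounded_iff using that by (auto simp: less_imp_le)
  show ?thesis
  proof (intro conjI iffI impI)
    assume int: "integrable_sol u v \<alpha> \<sigma>1 \<sigma>2 p q"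
    obtain B g K R where B: "\<And>x. u x \<le> B" "\<And>x. v x \<le> B" and g: "real DIM('a) < q * g + \<sigma>1" "0 < g" and K: "0 < K" and R: "1 \<le> R"
      and dec: "\<And>x. R \<le> norm x \<Longrightarrow> v x \<le> K * norm x powr - g"
      using forward[OF int] by blast
    show "bounded (range u)" "bounded (range v)" using B by (auto simp: bounded_iff upos vpos)
    have "asymp_sim u (\<lambda>x. norm x powr - l)" by (rule u_asymp_fast[OF B(2) R K dec g(1)])
    then show "asymp_sim u (\<lambda>x. norm x powr - (real DIM('a) - \<alpha>))" by (simp add: l_def n_def)
    \<comment> \<open>The two-sided rate |x|^-l of \<open>u\<close> feeds the equation for
      \<open>v\<close>, whose source then has exponent p l + \<sigma>2; its position relative to n
      decides the regime.\<close>
    obtain C where C: "C > 0" "\<And>x. 2 * R \<le> norm x \<Longrightarrow> u x \<le> C * norm x powr - l"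
      using u_fast[OF B(2) R K dec g(1)] by blast
    obtain c where c: "c > 0" "\<And>x. 1 \<le> norm x \<Longrightarrow> c * norm x powr - l \<le> u x" using u_lower_powr by blast
    have R2: "1 \<le> 2 * R" using R by simp
    {
      assume "real DIM('a) < p * (real DIM('a) - \<alpha>) + \<sigma>2"
      then have "asymp_sim v (\<lambda>x. norm x powr - l)"
        by (intro sw.u_asymp_fast[OF B(1) R2 C]) (auto simp: l_def n_def)
      then show "asymp_sim v (\<lambda>x. norm x powr - (real DIM('a) - \<alpha>))" by (simp add: l_def n_def)
    next
      assume "p * (real DIM('a) - \<alpha>) + \<sigma>2 = real DIM('a)"
      then have "asymp_sim v (\<lambda>x. norm x powr - l * ln (norm x))"
        by (intro sw.u_asymp_log[OF B(1) R2 C c]) (auto simp: l_def n_def)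
      then show "asymp_sim v (\<lambda>x. norm x powr - (real DIM('a) - \<alpha>) * ln (norm x))" by (simp add: l_def n_def)
    next
      assume "p * (real DIM('a) - \<alpha>) + \<sigma>2 < real DIM('a)"
      then have "asymp_sim v (\<lambda>x. norm x powr (real DIM('a) - l - (p * l + \<sigma>2)))"
        using h2 by (intro sw.u_asymp_slow[OF B(1) R2 C c]) (auto simp: l_def n_def)
      moreover have "real DIM('a) - l - (p * l + \<sigma>2) = - (p * (real DIM('a) - \<alpha>) - (\<alpha> - \<sigma>2))"
        by (simp add: l_def n_def)
      ultimately show "asymp_sim v (\<lambda>x. norm x powr - (p * (real DIM('a) - \<alpha>) - (\<alpha> - \<sigma>2)))" by simp
    }
  next
    assume asm: "bounded (range u) \<and> bounded (range v) \<and>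
            asymp_sim u (\<lambda>x. norm x powr (- (real DIM('a) - \<alpha>))) \<and>
            (p * (real DIM('a) - \<alpha>) + \<sigma>2 > real DIM('a) \<longrightarrow>
               asymp_sim v (\<lambda>x. norm x powr (- (real DIM('a) - \<alpha>)))) \<and>
            (p * (real DIM('a) - \<alpha>) + \<sigma>2 = real DIM('a) \<longrightarrow>
               asymp_sim v (\<lambda>x. norm x powr (- (real DIM('a) - \<alpha>)) * ln (norm x))) \<and>
            (p * (real DIM('a) - \<alpha>) + \<sigma>2 < real DIM('a) \<longrightarrow>
               asymp_sim v (\<lambda>x. norm x powr (- (p * (real DIM('a) - \<alpha>) - (\<alpha> - \<sigma>2)))))"
    obtain Bu where Bu: "\<And>x. u x \<le> Bu" using asm upos by (auto simp: bounded_iff)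
    obtain Bv where Bv: "\<And>x. v x \<le> Bv" using asm vpos by (auto simp: bounded_iff)
    have "asymp_sim u (\<lambda>x. norm x powr - l)" using asm by (simp add: l_def n_def)
    then obtain Cu Ru where Cu: "Ru \<ge> 1" "\<And>x. Ru \<le> norm x \<Longrightarrow> u x \<le> Cu * norm x powr - l"
      using asymp_sim_upper by blast
    \<comment> \<open>In each regime \<open>v\<close> decays strictly faster than |x|^-b, which
      together with boundedness gives integrability.\<close>
    have "\<exists>C m R. 1 \<le> R \<and> b < m \<and> (\<forall>x. R \<le> norm x \<longrightarrow> v x \<le> C * norm x powr - m)"
    proof -
      consider "real DIM('a) < p * (real DIM('a) - \<alpha>) + \<sigma>2" | "p * (real DIM('a) - \<alpha>) + \<sigma>2 = real DIM('a)" | "p * (real DIM('a) - \<alpha>) + \<sigma>2 < real DIM('a)"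
        by linarith
      then show ?thesis
      proof cases
        case 1
        then have "asymp_sim v (\<lambda>x. norm x powr - l)" using asm by (simp add: l_def n_def)
        then show ?thesis using asymp_sim_upper al by blast
      next
        case 2
        then have "asymp_sim v (\<lambda>x. norm x powr - l * ln (norm x))" using asm by (simp add: l_def n_def)
        then obtain C R where C: "C > 0" "R \<ge> 1" "\<And>x. R \<le> norm x \<Longrightarrow> v x \<le> C * (norm x powr - l * ln (norm x))"
          using asymp_sim_upper by blast
        \<comment> \<open>Half of the gap between \<open>l\<close> and \<open>b\<close> pays for the
          logarithm.\<close>
        define d where "d = (l - b) / 2"
        have d: "0 < d" "b < l - d" using al by (auto simp: d_def field_simps)
        have "v x \<le> C / d * norm x powr - (l - d)" if x: "R \<le> norm x" for x
        proof -
          have "ln (norm x) \<le> norm x powr d / d" using x C(2) d by (intro ln_powr_bound) auto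
          then have "C * (norm x powr - l * ln (norm x)) \<le> C * (norm x powr - l * (norm x powr d / d))"
            using C(1) by (intro mult_left_mono) auto
          also have "\<dots> = C / d * (norm x powr - l * norm x powr d)" by simp
          also have "norm x powr - l * norm x powr d = norm x powr - (l - d)" unfolding powr_add[symmetric] by simp
          finally show ?thesis using C(3)[OF x] by linarith
        qed
        then show ?thesis using C(2) d(2) by blast
      next
        case 3
        then have "asymp_sim v (\<lambda>x. norm x powr - (p * l - (\<alpha> - \<sigma>2)))" using asm by (simp add: l_def n_def)
        then show ?thesis using asymp_sim_upper h2(2) by blast
      qed
    qed
    then obtain Cv m Rv where Cv: "1 \<le> Rv" "b < m" "\<And>x. Rv \<le> norm x \<Longrightarrow> v x \<le> Cv * norm x powr - m" by blast
    have "(\<integral>\<^sup>+ x. ennreal (u x powr (real DIM('a) / a)) \<partial>lborel) < \<infinity>"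
      by (rule powr_integrable_of_decay[where B = Bu and m = l and R = Ru and C = Cu])
        (use Bu Cu a0 al upos in \<open>auto simp: less_imp_le\<close>)
    moreover have "(\<integral>\<^sup>+ x. ennreal (v x powr (real DIM('a) / b)) \<partial>lborel) < \<infinity>"
      by (rule powr_integrable_of_decay[where B = Bv and m = m and R = Rv and C = Cv])
        (use Bv Cv b0 vpos in \<open>auto simp: less_imp_le\<close>)
    ultimately show "integrable_sol u v \<alpha> \<sigma>1 \<sigma>2 p q" using sol by blast
  next
    assume \<alpha>1: "1 < \<alpha>" and int: "integrable_sol u v \<alpha> \<sigma>1 \<sigma>2 p q"
    obtain B g K R where B: "\<And>x. u x \<le> B" "\<And>x. v x \<le> B" and g: "real DIM('a) < q * g + \<sigma>1" "0 < g" and K: "0 < K" and R: "1 \<le> R"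
      and dec: "\<And>x. R \<le> norm x \<Longrightarrow> v x \<le> K * norm x powr - g"
      using forward[OF int] by blast
    have "l + 1 < real DIM('a)" using \<alpha>1 by (simp add: l_def n_def)
    from critical_of_fast_decay[OF this B R K dec g]
    show "(real DIM('a) - \<sigma>1) / (1 + q) + (real DIM('a) - \<sigma>2) / (1 + p) = real DIM('a) - \<alpha>"
      by (simp add: l_def n_def)
  qed
qed

end
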